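(* Let $V$ be a finite set, let $w_1,w_2\colon2^V\to\mathbf{R}\cup\{+\infty\}$ be valuated matroids whose effective domains are the base families $\mathcal{B}_1,\mathcal{B}_2$ of matroids $(V,\mathcal{B}_1)$, $(V,\mathcal{B}_2)$, and let $q\colon V\to\mathbf{R}$ satisfy either $q(v)\ge0$ for all $v\in V$, or $q(v)\le0$ for all $v\in V$. Then the problem minimize $w_1(X_1)+w_2(X_2)+q(X_1\cap X_2)$ subject to $X_1\in\mathcal{B}_1$, $X_2\in\mathcal{B}_2$ can be solved in strongly polynomial time.
   Context: A function $\omega\colon2^V\to\mathbf{R}\cup\{+\infty\}$, with effective domain $\operatorname{dom}\omega=\{X\mid\omega(X)<+\infty\}$, is a valuated matroid if for all $X,Y\in\operatorname{dom}\omega$ and $v\in X\setminus Y$ there exists $u\in Y\setminus X$ with $\omega(X)+\omega(Y)\ge\omega((X\setminus\{v\})\cup\{u\})+\omega((Y\cup\{v\})\setminus\{u\})$. For $X\subseteq V$, $q(X)=\sum_{v\in X}q(v)$. The functions $w_1,w_2$ are given by evaluation oracles together with a member of each effective domain; strongly polynomial means polynomial in $|V|$ counting arithmetic operations and oracle calls. To solve the problem means to output an optimal solution. *)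

theory Defs
  imports Complex_Main "HOL-Library.Extended_Real" "HOL-Computational_Algebra.Polynomial"
begin

section \<open>Matroids and valuated matroids\<close>

definition matroid_bases :: "'a set \<Rightarrow> 'a set set \<Rightarrow> bool" where
  "matroid_bases V \<B> \<longleftrightarrow>
     finite V \<and> \<B> \<subseteq> Pow V \<and> \<B> \<noteq> {} \<and>
     (\<forall>X\<in>\<B>. \<forall>Y\<in>\<B>. \<forall>x\<in>X - Y. \<exists>y\<in>Y - X. (X - {x}) \<union> {y} \<in> \<B>)"

text \<open>A function \<open>2\<^sup>V \<rightarrow> R \<union> {+\<infinity>}\<close> is a HOL function on all sets of which only the values on
  subsets of \<open>V\<close> matter.\<close>

definition eff_dom :: "'a set \<Rightarrow> ('a set \<Rightarrow> ereal) \<Rightarrow> 'a set set" where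
  "eff_dom V w = {X. X \<subseteq> V \<and> w X < \<infinity>}"

definition valuated_matroid :: "'a set \<Rightarrow> ('a set \<Rightarrow> ereal) \<Rightarrow> bool" where
  "valuated_matroid V w \<longleftrightarrow>
     (\<forall>X. X \<subseteq> V \<longrightarrow> w X \<noteq> -\<infinity>) \<and>
     (\<forall>X\<in>eff_dom V w. \<forall>Y\<in>eff_dom V w. \<forall>v\<in>X - Y. \<exists>u\<in>Y - X.
        w X + w Y \<ge> w ((X - {v}) \<union> {u}) + w ((Y \<union> {v}) - {u}))"


section \<open>Programs over the reals with evaluation oracles\<close>

text \<open>
  A program is a fixed finite command of a while language (a real RAM).  The memory consists of
  named arrays of natural numbers and named arrays of real numbers; a scalar is cell \<open>0\<close> of an array.
  Natural numbers, used for control and indexing, only have addition and truncated subtraction: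
  unit-cost multiplication and division of integers would allow large numbers to be abused for
  parallel computation.  The reals have the four arithmetic operations (with \<open>x / 0 = 0\<close>)
  and comparison, but no rounding and no conversion to natural numbers.  The constants are integers.
\<close>

type_synonym vname = string

datatype nexp = NConst nat | NCell vname nexp | NAdd nexp nexp | NSub nexp nexp

datatype rexp = RConst int | RCell vname nexp
  | RAdd rexp rexp | RSub rexp rexp | RMul rexp rexp | RDiv rexp rexp

datatype bexp = NLess nexp nexp | RLess rexp rexp | Neg bexp | Conj bexp bexp

datatype fun_id = W1 | W2

text \<open>
  \<open>Query k x f r\<close> evaluates the oracle of the \<open>k\<close>-th function on the set whose characteristic vector
  is stored in the array \<open>x\<close>.  It sets \<open>f[0]\<close> to \<open>0\<close> if the value is \<open>+\<infinity>\<close> and to \<open>1\<close> otherwise; in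
  the latter case it stores the value in \<open>r[0]\<close>.
\<close>

datatype com = Skip
  | NAssign vname nexp nexp
  | RAssign vname nexp rexp
  | Query fun_id vname vname vname
  | Seq com com
  | If bexp com com
  | While bexp com

type_synonym state = "(vname \<Rightarrow> nat \<Rightarrow> nat) \<times> (vname \<Rightarrow> nat \<Rightarrow> real)"

definition upd :: "(vname \<Rightarrow> nat \<Rightarrow> 'b) \<Rightarrow> vname \<Rightarrow> nat \<Rightarrow> 'b \<Rightarrow> vname \<Rightarrow> nat \<Rightarrow> 'b" where
  "upd m x i a = m(x := (m x)(i := a))"

primrec nval :: "nexp \<Rightarrow> state \<Rightarrow> nat" where
  "nval (NConst k) s = k"
| "nval (NCell x a) s = fst s x (nval a s)"
| "nval (NAdd a b) s = nval a s + nval b s"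
| "nval (NSub a b) s = nval a s - nval b s"

primrec rval :: "rexp \<Rightarrow> state \<Rightarrow> real" where
  "rval (RConst k) s = of_int k"
| "rval (RCell x a) s = snd s x (nval a s)"
| "rval (RAdd a b) s = rval a s + rval b s"
| "rval (RSub a b) s = rval a s - rval b s"
| "rval (RMul a b) s = rval a s * rval b s"
| "rval (RDiv a b) s = rval a s / rval b s"

primrec bval :: "bexp \<Rightarrow> state \<Rightarrow> bool" where
  "bval (NLess a b) s \<longleftrightarrow> nval a s < nval b s"
| "bval (RLess a b) s \<longleftrightarrow> rval a s < rval b s"
| "bval (Neg b) s \<longleftrightarrow> \<not> bval b s"
| "bval (Conj b c) s \<longleftrightarrow> bval b s \<and> bval c s"

text \<open>Every operation, comparison and memory access inside an expression costs one.\<close>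

primrec ncost :: "nexp \<Rightarrow> nat" where
  "ncost (NConst k) = 1"
| "ncost (NCell x a) = ncost a + 1"
| "ncost (NAdd a b) = ncost a + ncost b + 1"
| "ncost (NSub a b) = ncost a + ncost b + 1"

primrec rcost :: "rexp \<Rightarrow> nat" where
  "rcost (RConst k) = 1"
| "rcost (RCell x a) = ncost a + 1"
| "rcost (RAdd a b) = rcost a + rcost b + 1"
| "rcost (RSub a b) = rcost a + rcost b + 1"
| "rcost (RMul a b) = rcost a + rcost b + 1"
| "rcost (RDiv a b) = rcost a + rcost b + 1"

primrec bcost :: "bexp \<Rightarrow> nat" where
  "bcost (NLess a b) = ncost a + ncost b + 1"
| "bcost (RLess a b) = rcost a + rcost b + 1"
| "bcost (Neg b) = bcost b + 1"
| "bcost (Conj b c) = bcost b + bcost c + 1"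

text \<open>
  \<open>exec orc c s t s'\<close>: started in state \<open>s\<close>, the command \<open>c\<close> terminates in state \<open>s'\<close> after \<open>t\<close> steps,
  where \<open>orc\<close> gives the oracle answers for characteristic vectors.  All steps are counted: an oracle
  call costs one, like an arithmetic operation, and control flow is not free either.
\<close>

inductive exec :: "(fun_id \<Rightarrow> (nat \<Rightarrow> nat) \<Rightarrow> ereal) \<Rightarrow> com \<Rightarrow> state \<Rightarrow> nat \<Rightarrow> state \<Rightarrow> bool"
  for orc where
  Skip: "exec orc Skip s 1 s"
| NAssign: "exec orc (NAssign x i a) s (ncost i + ncost a + 1)
              (upd (fst s) x (nval i s) (nval a s), snd s)"
| RAssign: "exec orc (RAssign x i a) s (ncost i + rcost a + 1)
              (fst s, upd (snd s) x (nval i s) (rval a s))"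
| Query_fin: "orc k (fst s x) = ereal a \<Longrightarrow>
     exec orc (Query k x f r) s 1 (upd (fst s) f 0 1, upd (snd s) r 0 a)"
| Query_inf: "orc k (fst s x) = \<infinity> \<Longrightarrow>
     exec orc (Query k x f r) s 1 (upd (fst s) f 0 0, snd s)"
| Seq: "exec orc c s t s' \<Longrightarrow> exec orc d s' t' s'' \<Longrightarrow> exec orc (Seq c d) s (t + t' + 1) s''"
| If_True: "bval b s \<Longrightarrow> exec orc c s t s' \<Longrightarrow> exec orc (If b c d) s (bcost b + t + 1) s'"
| If_False: "\<not> bval b s \<Longrightarrow> exec orc d s t s' \<Longrightarrow> exec orc (If b c d) s (bcost b + t + 1) s'"
| While_False: "\<not> bval b s \<Longrightarrow> exec orc (While b c) s (bcost b + 1) s"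
| While_True: "bval b s \<Longrightarrow> exec orc c s t s' \<Longrightarrow> exec orc (While b c) s' t' s'' \<Longrightarrow>
     exec orc (While b c) s (bcost b + t + t' + 1) s''"

inductive_cases SkipE: "exec orc Skip s t s'"
inductive_cases NAssignE: "exec orc (NAssign x i a) s t s'"
inductive_cases RAssignE: "exec orc (RAssign x i a) s t s'"
inductive_cases QueryE: "exec orc (Query k x f r) s t s'"
inductive_cases SeqE: "exec orc (Seq c d) s t s'"
inductive_cases IfE: "exec orc (If b c d) s t s'"
inductive_cases WhileE: "exec orc (While b c) s t s'"

lemma exec_deterministic:
  "exec orc c s t s' \<Longrightarrow> exec orc c s u s'' \<Longrightarrow> u = t \<and> s'' = s'"
proof (induction arbitrary: u s'' rule: exec.induct)
  case (Skip s)
  then show ?case by (rule SkipE) simp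
next
  case (NAssign x i a s)
  then show ?case by (rule NAssignE) simp
next
  case (RAssign x i a s)
  then show ?case by (rule RAssignE) simp
next
  case (Query_fin k s x a f r)
  from Query_fin.prems show ?case by (rule QueryE) (simp_all add: Query_fin.hyps)
next
  case (Query_inf k s x f r)
  from Query_inf.prems show ?case by (rule QueryE) (simp_all add: Query_inf.hyps)
next
  case (Seq c s t s' d t' s3)
  from Seq.prems obtain r v v' where
    "u = v + v' + 1" "exec orc c s v r" "exec orc d r v' s''"
    by (rule SeqE) simp
  with Seq.IH show ?case by metis
next
  case (If_True b s c t s' d)
  from If_True.prems If_True.hyps(1) obtain v where
    "u = bcost b + v + 1" "exec orc c s v s''"
    by (auto elim: IfE)
  with If_True.IH show ?case by metis
next
  case (If_False b s d t s' c)
  from If_False.prems If_False.hyps(1) obtain v where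
    "u = bcost b + v + 1" "exec orc d s v s''"
    by (auto elim: IfE)
  with If_False.IH show ?case by metis
next
  case (While_False b s c)
  from While_False.prems show ?case by (rule WhileE) (simp_all add: While_False.hyps)
next
  case (While_True b s c t s' t' s3)
  from While_True.prems obtain r v v' where
    "u = bcost b + v + v' + 1" "exec orc c s v r" "exec orc (While b c) r v' s''"
    by (rule WhileE) (use While_True.hyps(1) in simp_all)
  with While_True.IH show ?case by metis
qed


section \<open>Inputs, outputs and running time\<close>

text \<open>
  The elements of \<open>V\<close> are presented to a program as the indices \<open>0, \<dots>, card V - 1\<close>, by way of a
  bijection \<open>e\<close>.  A subset of \<open>V\<close> is represented by an array that is nonzero exactly at the indices
  of its members; cells beyond \<open>card V - 1\<close> are ignored.
\<close>

definition decode :: "(nat \<Rightarrow> 'a) \<Rightarrow> 'a set \<Rightarrow> (nat \<Rightarrow> nat) \<Rightarrow> 'a set" where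
  "decode e V x = e ` {i. i < card V \<and> x i \<noteq> 0}"

definition encode :: "(nat \<Rightarrow> 'a) \<Rightarrow> 'a set \<Rightarrow> 'a set \<Rightarrow> nat \<Rightarrow> nat" where
  "encode e V X = (\<lambda>i. if i < card V \<and> e i \<in> X then 1 else 0)"

definition oracles ::
  "(nat \<Rightarrow> 'a) \<Rightarrow> 'a set \<Rightarrow> ('a set \<Rightarrow> ereal) \<Rightarrow> ('a set \<Rightarrow> ereal) \<Rightarrow> fun_id \<Rightarrow> (nat \<Rightarrow> nat) \<Rightarrow> ereal"
where
  "oracles e V w1 w2 k x = (case k of W1 \<Rightarrow> w1 (decode e V x) | W2 \<Rightarrow> w2 (decode e V x))"

text \<open>The input consists of \<open>card V\<close>, of members \<open>B1\<close> and \<open>B2\<close> of the two effective domains, and of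
  the vector \<open>q\<close>.\<close>

definition init_state :: "(nat \<Rightarrow> 'a) \<Rightarrow> 'a set \<Rightarrow> 'a set \<Rightarrow> 'a set \<Rightarrow> ('a \<Rightarrow> real) \<Rightarrow> state" where
  "init_state e V B1 B2 q =
     ((\<lambda>_ _. 0)(''n'' := (\<lambda>_. 0)(0 := card V), ''B1'' := encode e V B1, ''B2'' := encode e V B2),
      (\<lambda>_ _. 0)(''q'' := (\<lambda>i. if i < card V then q (e i) else 0)))"

text \<open>For every enumeration of \<open>V\<close> and every choice of the two given members, the program \<open>P\<close> stops
  within \<open>T\<close> steps, and the pair of sets it leaves in the arrays \<open>X1\<close> and \<open>X2\<close> belongs to \<open>Sol\<close>.\<close>

definition solves_within ::
  "com \<Rightarrow> nat \<Rightarrow> 'a set \<Rightarrow> ('a set \<Rightarrow> ereal) \<Rightarrow> ('a set \<Rightarrow> ereal) \<Rightarrow> ('a \<Rightarrow> real) \<Rightarrow>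
    ('a set \<times> 'a set) set \<Rightarrow> bool"
where
  "solves_within P T V w1 w2 q Sol \<longleftrightarrow>
     (\<forall>e B1 B2. bij_betw e {..<card V} V \<longrightarrow> B1 \<in> eff_dom V w1 \<longrightarrow> B2 \<in> eff_dom V w2 \<longrightarrow>
       (\<exists>t s. exec (oracles e V w1 w2) P (init_state e V B1 B2 q) t s \<and> t \<le> T \<and>
          (decode e V (fst s ''X1''), decode e V (fst s ''X2'')) \<in> Sol))"

end

theory Submission
  imports Defs
begin

text \<open>
  If \<open>q \<le> 0\<close>, replace the second matroid by its dual: since \<open>q(X\<^sub>1 \<inter> X\<^sub>2) = q(X\<^sub>1) - q(X\<^sub>1 - X\<^sub>2)\<close>, this
  adds a linear term to \<open>w\<^sub>1\<close> and turns the rewards into penalties \<open>Q = \<bar>q\<bar> \<ge> 0\<close>.  On the disjoint union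
  of two copies of \<open>V\<close> the task is then to minimise a single valuated matroid \<open>f\<close> plus a penalty
  \<open>Q(v)\<close> for each pair of copies of the same element \<open>v\<close> that lies in the base.

  A potential \<open>p\<close> certifies that \<open>X\<close> is optimal if \<open>X\<close> minimises \<open>f - p\<close> over the bases and each pair,
  taken alone, minimises \<open>p + Q\<close> over its four states.  Without penalties \<open>p = 0\<close> certifies a base
  found greedily.  The penalties are then introduced one element at a time.  If both copies of the
  element lie in the base, a shortest path computation from them in the exchange graph, with lengths
  reduced by \<open>p\<close>, yields the new potential, and the base changes along the path unless the new
  penalty is at most its length.  Dijkstra's algorithm with strict relaxation gives every node the
  earliest possible parent, hence the path has no shortcuts among the tight exchanges, and
  exchanging along it leads to another minimiser of \<open>f - p\<close>.
\<close>

section \<open>Valuated matroids and optimality certificates\<close>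

text \<open>A penalty \<open>Q \<ge> 0\<close> makes the cost of a pair supermodular in its two
  memberships, which for two elements is exactly M-natural convexity. The penalised task is thus a
  valuated matroid intersection problem, and a potential is a weight splitting: \<open>f - p\<close>
  and \<open>p + Q\<close> are minimised by the same set. This is where the common sign of
  \<open>q\<close> enters.

  Raising a single penalty spoils a certificate only at the two copies of its element, so these are
  the sources and one augmentation repairs it. There is one such phase per element whatever the
  numbers are, which is the origin of strong polynomiality.

  The obstacle is ties. Many exchanges may be tight at once, and exchanging along a merely shortest
  path can leave the family of bases if a tight exchange jumps ahead on the path. It is enough to
  exclude jumps in one direction, from nodes nearer to the source to nodes farther away. Ranking the
  nodes in the order in which they are finished, and never replacing a parent in a tie, excludes
  these.\<close>

locale real_valuated_matroid =
  fixes U :: "'b set" and \<B> :: "'b set set" and f :: "'b set \<Rightarrow> real"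
  assumes finite_ground: "finite U"
    and bases_subset: "X \<in> \<B> \<Longrightarrow> X \<subseteq> U"
    and exchange: "X \<in> \<B> \<Longrightarrow> Y \<in> \<B> \<Longrightarrow> v \<in> X \<Longrightarrow> v \<notin> Y \<Longrightarrow>
      \<exists>u. u \<in> Y \<and> u \<notin> X \<and> insert u (X - {v}) \<in> \<B> \<and> insert v (Y - {u}) \<in> \<B> \<and>
        f (insert u (X - {v})) + f (insert v (Y - {u})) \<le> f X + f Y"
begin

lemma finite_base: "X \<in> \<B> \<Longrightarrow> finite X"
  using bases_subset finite_ground finite_subset by blast

text \<open>The two products of an exchange together contain the same elements, with multiplicity,
  as \<open>X\<close> and \<open>Y\<close>, so a linear term cancels from the inequality. Potentials
  can therefore be subtracted freely.\<close>

lemma add_linear: "real_valuated_matroid U \<B> (\<lambda>X. f X - sum p X)"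
proof
  fix X Y v assume XY: "X \<in> \<B>" "Y \<in> \<B>" and v: "v \<in> X" "v \<notin> Y"
  obtain u where u: "u \<in> Y" "u \<notin> X" "insert u (X - {v}) \<in> \<B>" "insert v (Y - {u}) \<in> \<B>"
    "f (insert u (X - {v})) + f (insert v (Y - {u})) \<le> f X + f Y"
    using exchange[OF XY v] by blast
  have "sum p (insert u (X - {v})) + sum p (insert v (Y - {u})) = sum p X + sum p Y"
    using u v XY finite_base by (simp add: sum.insert_if sum_diff1)
  with u show "\<exists>u. u \<in> Y \<and> u \<notin> X \<and> insert u (X - {v}) \<in> \<B> \<and> insert v (Y - {u}) \<in> \<B> \<and>
        f (insert u (X - {v})) - sum p (insert u (X - {v})) +
        (f (insert v (Y - {u})) - sum p (insert v (Y - {u}))) \<le> f X - sum p X + (f Y - sum p Y)"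
    by (intro exI[of _ u]) simp
qed (auto simp: finite_ground dest: bases_subset)

text \<open>Exchanging \<open>Y\<close> against \<open>X\<close> brings \<open>Y\<close> one element
  closer to \<open>X\<close>. The other product is a neighbour of \<open>X\<close> and costs at
  least \<open>f X\<close>, so the new \<open>Y\<close> is no dearer than the old one.\<close>

lemma local_optimum_global:
  assumes X: "X \<in> \<B>"
    and loc: "\<And>u v. u \<in> X \<Longrightarrow> v \<notin> X \<Longrightarrow> insert v (X - {u}) \<in> \<B> \<Longrightarrow> f X \<le> f (insert v (X - {u}))"
  shows "Y \<in> \<B> \<Longrightarrow> f X \<le> f Y"
proof (induction "card (Y - X)" arbitrary: Y rule: less_induct)
  case less
  show ?case
  proof (cases "Y - X = {}")
    case True
    \<comment> \<open>An element of \<open>X - Y\<close> would need a partner in the empty set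
      \<open>Y - X\<close>.\<close>
    then have "X - Y = {}"
      using exchange[OF X less.prems] by blast
    with True show ?thesis by (metis Diff_eq_empty_iff order_refl subset_antisym)
  next
    case False
    then obtain v where v: "v \<in> Y" "v \<notin> X" by blast
    obtain u where u: "u \<in> X" "u \<notin> Y" "insert u (Y - {v}) \<in> \<B>" "insert v (X - {u}) \<in> \<B>"
      "f (insert u (Y - {v})) + f (insert v (X - {u})) \<le> f Y + f X"
      using exchange[OF less.prems X v] by blast
    have "insert u (Y - {v}) - X = (Y - X) - {v}" using u(1) by blast
    moreover have "finite (Y - X)" using finite_base less.prems by blast
    ultimately have "card (insert u (Y - {v}) - X) < card (Y - X)"
      using v by (metis DiffI card_Diff1_less)
    from less.hyps[OF this u(3)] loc[OF u(1) v(2) u(4)] u(5) show ?thesis by linarith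
  qed
qed

text \<open>Correctness of one greedy step: when \<open>v\<close> becomes available, a single swap
  suffices to restore optimality. Exchanging \<open>Y\<close> against \<open>B\<close> at
  \<open>v\<close> leaves one product inside \<open>S\<close>, which costs at least
  \<open>f B\<close>, so the other one costs at most \<open>f Y\<close>.\<close>

lemma minimizer_extend:
  assumes B: "B \<in> \<B>" "B \<subseteq> S" and min: "\<And>Y. Y \<in> \<B> \<Longrightarrow> Y \<subseteq> S \<Longrightarrow> f B \<le> f Y"
    and Y: "Y \<in> \<B>" "Y \<subseteq> insert v S" "v \<in> Y" and v: "v \<notin> B"
  shows "\<exists>u\<in>B. insert v (B - {u}) \<in> \<B> \<and> f (insert v (B - {u})) \<le> f Y"
proof -
  obtain u where u: "u \<in> B" "u \<notin> Y" "insert u (Y - {v}) \<in> \<B>" "insert v (B - {u}) \<in> \<B>"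
    "f (insert u (Y - {v})) + f (insert v (B - {u})) \<le> f Y + f B"
    using exchange[OF Y(1) B(1) Y(3) v] by blast
  have "f B \<le> f (insert u (Y - {v}))" using min[OF u(3)] B(2) Y(2) u(1) by blast
  with u show ?thesis by (intro bexI[of _ u]) auto
qed

text \<open>The two products of an exchange between minimisers cost together at most twice the
  minimum, so both are minimisers. The minimisers thus form the bases of a matroid, as
  \<open>exchange_without_shortcuts\<close> requires.\<close>

lemma minimizers_exchange:
  assumes "X \<in> \<B>" "\<And>Z. Z \<in> \<B> \<Longrightarrow> f X \<le> f Z" "Y \<in> \<B>" "\<And>Z. Z \<in> \<B> \<Longrightarrow> f Y \<le> f Z"
    and "v \<in> X" "v \<notin> Y"
  shows "\<exists>u. u \<in> Y \<and> u \<notin> X \<and> insert u (X - {v}) \<in> \<B> \<and> (\<forall>Z\<in>\<B>. f (insert u (X - {v})) \<le> f Z)"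
proof -
  obtain u where u: "u \<in> Y" "u \<notin> X" "insert u (X - {v}) \<in> \<B>" "insert v (Y - {u}) \<in> \<B>"
    "f (insert u (X - {v})) + f (insert v (Y - {u})) \<le> f X + f Y"
    using exchange[OF assms(1,3,5,6)] by blast
  have "f (insert u (X - {v})) \<le> f X" using u(5) assms(4)[OF u(4)] by linarith
  then show ?thesis using u assms(2) by (meson order_trans)
qed

end

text \<open>The pairs come in reverse path order: for each pair, the exchanges of its entering element
  with the leaving elements of the pairs behind it are not available.\<close>

lemma exchange_without_shortcuts:
  assumes exch: "\<And>X Y v. X \<in> M \<Longrightarrow> Y \<in> M \<Longrightarrow> v \<in> X \<Longrightarrow> v \<notin> Y \<Longrightarrow>
      \<exists>u. u \<in> Y \<and> u \<notin> X \<and> insert u (X - {v}) \<in> M"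
  shows "B \<in> M \<Longrightarrow> distinct (map fst ps) \<Longrightarrow> distinct (map snd ps) \<Longrightarrow>
    (\<And>u v. (u, v) \<in> set ps \<Longrightarrow> u \<in> B \<and> v \<notin> B \<and> insert v (B - {u}) \<in> M) \<Longrightarrow>
    sorted_wrt (\<lambda>(u, v) (u', v'). insert v (B - {u'}) \<notin> M) ps \<Longrightarrow>
    (B - fst ` set ps) \<union> snd ` set ps \<in> M"
proof (induction ps arbitrary: B)
  case Nil
  then show ?case by simp
next
  case (Cons a ps)
  obtain u v where a: "a = (u, v)" by (cases a)
  define B' where "B' = insert v (B - {u})"
  have uv: "u \<in> B" "v \<notin> B" "B' \<in> M" using Cons.prems(4)[of u v] by (auto simp: a B'_def)
  have no: "insert v (B - {u'}) \<notin> M" if "(u', v') \<in> set ps" for u' v'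
    using Cons.prems(5) that by (auto simp: a)
  \<comment> \<open>The first exchange does not alter which of the remaining ones are available, so
    the induction can continue from \<open>B'\<close>. In both directions the exchange property
    offers two partners for \<open>u'\<close>, and the wrong one would put the forbidden set
    \<open>insert v (B - {u'})\<close> into \<open>M\<close>.\<close>
  have iff: "insert v' (B' - {u'}) \<in> M \<longleftrightarrow> insert v' (B - {u'}) \<in> M"
    if u': "u' \<in> fst ` set ps" and v': "v' \<in> snd ` set ps" for u' v'
  proof -
    obtain b c where bc: "(u', b) \<in> set ps" "(c, v') \<in> set ps" using u' v' by auto
    have 1: "u' \<in> B" "u' \<noteq> u" "insert v (B - {u'}) \<notin> M"
      using u' Cons.prems(2) Cons.prems(4)[of u' b] no[OF bc(1)] bc by (auto simp: a)
    have 2: "v' \<notin> B" "v' \<noteq> v" using v' Cons.prems(3) Cons.prems(4)[of c v'] bc by (auto simp: a)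
    show ?thesis
    proof
      assume *: "insert v' (B' - {u'}) \<in> M"
      obtain z where z: "z \<in> insert v' (B' - {u'})" "z \<notin> B" "insert z (B - {u'}) \<in> M"
        using exch[OF Cons.prems(1) * 1(1)] 1 2 uv by (auto simp: B'_def)
      then show "insert v' (B - {u'}) \<in> M" using 1 by (auto simp: B'_def)
    next
      assume *: "insert v' (B - {u'}) \<in> M"
      obtain z where z: "z \<in> insert v' (B - {u'})" "z \<notin> B'" "insert z (B' - {u'}) \<in> M"
        using exch[OF uv(3) *, of u'] 1 2 uv by (auto simp: B'_def)
      then have "z = v' \<or> z = u" by (auto simp: B'_def)
      moreover have "insert u (B' - {u'}) = insert v (B - {u'})"
        using 1 uv by (auto simp: B'_def)
      ultimately show "insert v' (B' - {u'}) \<in> M" using z(3) 1(3) by metis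
    qed
  qed
  have "(B' - fst ` set ps) \<union> snd ` set ps \<in> M"
  proof (rule Cons.IH)
    show "B' \<in> M" by (rule uv)
    show "distinct (map fst ps)" "distinct (map snd ps)" using Cons.prems by auto
    show "u' \<in> B' \<and> v' \<notin> B' \<and> insert v' (B' - {u'}) \<in> M" if "(u', v') \<in> set ps" for u' v'
    proof -
      have m: "u' \<in> fst ` set ps" "v' \<in> snd ` set ps" using that by force+
      have "u' \<in> B \<and> v' \<notin> B \<and> insert v' (B - {u'}) \<in> M" using Cons.prems(4)[of u' v'] that by auto
      moreover have "u' \<noteq> u" "v' \<noteq> v" using m Cons.prems(2,3) by (auto simp: a)
      ultimately show ?thesis using iff[OF m] by (auto simp: B'_def)
    qed
    have "sorted_wrt (\<lambda>(u, v) (u', v'). insert v (B - {u'}) \<notin> M) ps" using Cons.prems by simp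
    then show "sorted_wrt (\<lambda>(u, v) (u', v'). insert v (B' - {u'}) \<notin> M) ps"
      using iff by (elim sorted_wrt_mono_rel[rotated]) force
  qed
  moreover have "(B' - fst ` set ps) \<union> snd ` set ps = (B - fst ` set (a # ps)) \<union> snd ` set (a # ps)"
  proof -
    have "v \<notin> fst ` set ps" using Cons.prems(4) uv by force
    then show ?thesis by (auto simp: a B'_def)
  qed
  ultimately show ?case by simp
qed

section \<open>Pairs, the exchange graph and optimality certificates\<close>

definition mate :: "nat \<Rightarrow> nat \<Rightarrow> nat" where
  "mate n x = (if x < n then n + x else x - n)"

lemma mate_less: "x < 2 * n \<Longrightarrow> mate n x < 2 * n"
  and mate_mate: "x < 2 * n \<Longrightarrow> mate n (mate n x) = x"
  and mate_neq: "x < 2 * n \<Longrightarrow> mate n x \<noteq> x"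
  by (auto simp: mate_def)

text \<open>The membership of \<open>x\<close> and its mate minimises \<open>p x a + p (mate x) b + Q x a b\<close> over
  \<open>a, b \<in> {0, 1}\<close>, where \<open>Q \<ge> 0\<close>.  The case where \<open>x\<close> alone belongs to \<open>X\<close> is covered by the
  condition for the mate.\<close>

definition pair_optimal :: "nat \<Rightarrow> nat set \<Rightarrow> (nat \<Rightarrow> real) \<Rightarrow> (nat \<Rightarrow> real) \<Rightarrow> nat \<Rightarrow> bool" where
  "pair_optimal n X p Q x \<longleftrightarrow>
     (x \<notin> X \<and> mate n x \<notin> X \<longrightarrow> 0 \<le> p x) \<and>
     (x \<notin> X \<and> mate n x \<in> X \<longrightarrow> - Q x \<le> p x \<and> p (mate n x) \<le> p x \<and> p (mate n x) \<le> 0) \<and>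
     (x \<in> X \<and> mate n x \<in> X \<longrightarrow> p x \<le> - Q x)"

text \<open>Arcs of the exchange graph: an element leaves the base for another one, or the base swaps an
  entering element for its mate.\<close>

definition arc :: "nat \<Rightarrow> nat set set \<Rightarrow> nat set \<Rightarrow> nat \<Rightarrow> nat \<Rightarrow> bool" where
  "arc n \<B> X x y \<longleftrightarrow> (x \<in> X \<and> y \<notin> X \<and> insert y (X - {x}) \<in> \<B>) \<or> (x \<notin> X \<and> y \<in> X \<and> y = mate n x)"

definition arc_length :: "(nat set \<Rightarrow> real) \<Rightarrow> nat set \<Rightarrow> (nat \<Rightarrow> real) \<Rightarrow> nat \<Rightarrow> nat \<Rightarrow> real" where
  "arc_length f X p x y = (if x \<in> X then f (insert y (X - {x})) - f X - p y + p x else p x - p y)"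

text \<open>The value \<open>0\<close> of \<open>par\<close> marks a root and \<open>Suc x\<close> stands for the parent \<open>x\<close>.  The last
  condition says that the parent is the first node, with respect to \<open>rk\<close>, on a shortest path.\<close>

definition shortest_forest ::
  "nat \<Rightarrow> (nat \<Rightarrow> nat \<Rightarrow> bool) \<Rightarrow> (nat \<Rightarrow> nat \<Rightarrow> real) \<Rightarrow> (nat \<Rightarrow> real) \<Rightarrow>
    (nat \<Rightarrow> real) \<Rightarrow> (nat \<Rightarrow> nat) \<Rightarrow> (nat \<Rightarrow> nat) \<Rightarrow> bool" where
  "shortest_forest N E l k d par rk \<longleftrightarrow>
     (\<forall>x<N. d x \<le> k x \<and> rk x \<le> N \<and> 0 < rk x) \<and>
     (\<forall>x<N. \<forall>y<N. E x y \<longrightarrow> d y \<le> d x + l x y) \<and>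
     (\<forall>y<N. par y = 0 \<longrightarrow> d y = k y) \<and>
     (\<forall>y<N. \<forall>x. par y = Suc x \<longrightarrow> x < N \<and> E x y \<and> d y = d x + l x y \<and> rk x < rk y \<and>
        (\<forall>z<N. E z y \<longrightarrow> rk z < rk x \<longrightarrow> d y < d z + l z y))"

text \<open>The list runs from a node back to its root, against the direction of the path.\<close>

inductive parent_path :: "(nat \<Rightarrow> nat) \<Rightarrow> nat \<Rightarrow> nat list \<Rightarrow> bool" for par where
  parent_path_0: "parent_path par 0 []"
| parent_path_Suc: "parent_path par (par x) L \<Longrightarrow> parent_path par (Suc x) (x # L)"

inductive_simps parent_path_0_iff [simp]: "parent_path par 0 L"
inductive_simps parent_path_Suc_iff: "parent_path par (Suc x) L"

text \<open>Ranks strictly decrease towards the root, so following parents stops, visits no node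
  twice and takes at most \<open>rk x\<close> nodes.\<close>

lemma parent_path_exists:
  assumes "shortest_forest N E l k d par rk"
  shows "x < N \<Longrightarrow> \<exists>L. parent_path par (Suc x) L \<and> length L \<le> rk x \<and> distinct L \<and>
    (\<forall>y\<in>set L. rk y \<le> rk x \<and> y < N)"
proof (induction "rk x" arbitrary: x rule: less_induct)
  case less
  have rk: "0 < rk x" using assms less.prems by (auto simp: shortest_forest_def)
  show ?case
  proof (cases "par x")
    case 0
    then show ?thesis using less.prems rk
      by (intro exI[of _ "[x]"]) (auto simp: parent_path_Suc_iff)
  next
    case (Suc y)
    then have y: "y < N" "rk y < rk x" using assms less.prems by (auto simp: shortest_forest_def)
    from less.hyps[OF y(2,1)] obtain L where L: "parent_path par (Suc y) L" "length L \<le> rk y"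
      "distinct L" "\<forall>z\<in>set L. rk z \<le> rk y \<and> z < N" by blast
    then show ?thesis using y Suc less.prems
      by (intro exI[of _ "x # L"]) (auto simp: parent_path_Suc_iff)
  qed
qed

locale pair_problem = real_valuated_matroid "{..<2 * n}" \<B> f
  for n :: nat and \<B> :: "nat set set" and f :: "nat set \<Rightarrow> real"
begin

definition penalty :: "(nat \<Rightarrow> real) \<Rightarrow> nat set \<Rightarrow> real" where
  "penalty Q X = (\<Sum>i<n. if i \<in> X \<and> n + i \<in> X then Q i else 0)"

definition certified :: "nat set \<Rightarrow> (nat \<Rightarrow> real) \<Rightarrow> (nat \<Rightarrow> real) \<Rightarrow> bool" where
  "certified X p Q \<longleftrightarrow> X \<in> \<B> \<and> (\<forall>Y\<in>\<B>. f X - sum p X \<le> f Y - sum p Y) \<and>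
     (\<forall>x<2 * n. pair_optimal n X p Q x)"

lemma sum_by_pairs:
  assumes "X \<subseteq> {..<2 * n}"
  shows "sum p X = (\<Sum>i<n. (if i \<in> X then p i else 0) + (if n + i \<in> X then p (n + i) else (0::real)))"
proof -
  have "sum p X = (\<Sum>i<2 * n. if i \<in> X then p i else 0)"
    by (rule sum.mono_neutral_cong_left) (use assms in auto)
  also have "{..<2 * n} = {..<n} \<union> {n..<2 * n}" by auto
  also have "(\<Sum>i\<in>\<dots>. if i \<in> X then p i else 0) =
      (\<Sum>i<n. if i \<in> X then p i else 0) + (\<Sum>i\<in>{n..<2 * n}. if i \<in> X then p i else 0)"
    by (rule sum.union_disjoint) auto
  also have "(\<Sum>i\<in>{n..<2 * n}. if i \<in> X then p i else 0) = (\<Sum>i<n. if n + i \<in> X then p (n + i) else 0)"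
    by (rule sum.reindex_bij_witness[of _ "\<lambda>i. n + i" "\<lambda>i. i - n"]) auto
  finally show ?thesis by (simp add: sum.distrib)
qed

text \<open>Weak duality: \<open>f - sum p\<close> is minimised at \<open>X\<close> by assumption,
  \<open>sum p + penalty\<close> splits into pairs and is minimised pair by pair, and the potentials
  cancel when the two inequalities are added.\<close>

lemma certified_optimal:
  assumes cert: "certified X p Q" and Y: "Y \<in> \<B>"
    and Q: "\<And>i. i < n \<Longrightarrow> 0 \<le> Q i \<and> Q (n + i) = Q i"
  shows "f X + penalty Q X \<le> f Y + penalty Q Y"
proof -
  have "sum p X + penalty Q X \<le> sum p Y + penalty Q Y"
  proof -
    have X: "X \<in> \<B>" using cert by (simp add: certified_def)
    have "(if i \<in> X then p i else 0) + (if n + i \<in> X then p (n + i) else 0) +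
        (if i \<in> X \<and> n + i \<in> X then Q i else 0) \<le>
        (if i \<in> Y then p i else 0) + (if n + i \<in> Y then p (n + i) else 0) +
        (if i \<in> Y \<and> n + i \<in> Y then Q i else 0)" if i: "i < n" for i
    proof -
      \<comment> \<open>Both orientations are taken, because \<open>pair_optimal\<close> covers only
        one of the two states with a single member.\<close>
      have "pair_optimal n X p Q i" "pair_optimal n X p Q (n + i)"
        using cert i by (auto simp: certified_def)
      then show ?thesis using Q[OF i] i
        by (cases "i \<in> X"; cases "n + i \<in> X") (auto simp: pair_optimal_def mate_def)
    qed
    then show ?thesis unfolding penalty_def
      sum_by_pairs[OF bases_subset[OF X]] sum_by_pairs[OF bases_subset[OF Y]] sum.distrib[symmetric]
      by (intro sum_mono) auto
  qed
  moreover have "f X - sum p X \<le> f Y - sum p Y" using cert Y by (simp add: certified_def)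
  ultimately show ?thesis by linarith
qed

lemma certified_zero:
  assumes "X \<in> \<B>" "\<And>Y. Y \<in> \<B> \<Longrightarrow> f X \<le> f Y"
  shows "certified X (\<lambda>x. 0) (\<lambda>x. 0)"
  using assms by (simp add: certified_def pair_optimal_def)

lemma certified_cong:
  assumes "certified X p Q" "\<And>x. x < 2 * n \<Longrightarrow> p' x = p x \<and> Q' x = Q x"
  shows "certified X p' Q'"
proof -
  have "sum p' Y = sum p Y" if "Y \<in> \<B>" for Y
    using assms(2) bases_subset[OF that] by (intro sum.cong) auto
  then show ?thesis using assms by (simp add: certified_def pair_optimal_def mate_less)
qed

end

section \<open>Augmentation along a shortest path\<close>

text \<open>The penalty of the pair \<open>i\<close>, \<open>n + i\<close> becomes \<open>c\<close>.
  The start values \<open>m - p x\<close> bring the shifted potential of both sources down to at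
  most \<open>m - D\<close>, with equality at the source where the path begins. The cap
  \<open>c + m\<close> is the length at which paying the new penalty is as good as any path. The
  other bounds on \<open>D\<close> are the lengths of paths that end by adding \<open>v\<close>,
  including the penalty incurred if the mate of \<open>v\<close> is in the base. In closed form,
  \<open>p'\<close> is \<open>p + min d D - D\<close>, so nodes at distance \<open>D\<close> or more
  keep their potential.\<close>

locale augmentation = pair_problem n \<B> f
  for n :: nat and \<B> :: "nat set set" and f :: "nat set \<Rightarrow> real" +
  fixes X :: "nat set" and p Q :: "nat \<Rightarrow> real" and i :: nat and c :: real
    and d :: "nat \<Rightarrow> real" and par rk :: "nat \<Rightarrow> nat" and m D :: real and p' Q' :: "nat \<Rightarrow> real"
  defines "m \<equiv> max (p i) (p (n + i))"
    and "p' \<equiv> \<lambda>x. if d x < D then p x - D + d x else p x"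
    and "Q' \<equiv> Q(i := c, n + i := c)"
  assumes cert: "certified X p Q" and i: "i < n" "i \<in> X" "n + i \<in> X"
    and Q: "\<And>x. x < 2 * n \<Longrightarrow> 0 \<le> Q x \<and> Q (mate n x) = Q x"
    and forest: "shortest_forest (2 * n) (arc n \<B> X) (arc_length f X p)
       (\<lambda>x. if x = i \<or> x = n + i then m - p x else c + m) d par rk"
    and D: "D \<le> c + m"
      "\<And>v. v < 2 * n \<Longrightarrow> v \<notin> X \<Longrightarrow> D \<le> d v + p v + (if mate n v \<in> X then Q v else 0)"
begin

lemma base: "X \<in> \<B>"
  and minimal: "Y \<in> \<B> \<Longrightarrow> f X - sum p X \<le> f Y - sum p Y"
  and pair_optimal: "x < 2 * n \<Longrightarrow> pair_optimal n X p Q x"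
  using cert by (auto simp: certified_def)

lemma in_ground: "x \<in> X \<Longrightarrow> x < 2 * n"
  using bases_subset[OF base] by blast

lemma exchange_in_ground: "insert v (X - {u}) \<in> \<B> \<Longrightarrow> v < 2 * n"
  using bases_subset by blast

lemma sum_exchange: "u \<in> X \<Longrightarrow> v \<notin> X \<Longrightarrow> sum g (insert v (X - {u})) = sum g X - g u + (g v :: real)"
  using finite_base[OF base] by (simp add: sum.insert_if sum_diff1)

lemma slack_nonneg:
  assumes "u \<in> X" "v \<notin> X" "insert v (X - {u}) \<in> \<B>"
  shows "0 \<le> arc_length f X p u v"
  using minimal[OF assms(3)] assms sum_exchange[of u v p] by (simp add: arc_length_def)

text \<open>Exchange arcs are nonnegative because \<open>X\<close> minimises \<open>f - p\<close>,
  arcs between mates because of the condition \<open>p (mate n x) \<le> p x\<close> in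
  \<open>pair_optimal\<close>. Hence distances do not decrease from a parent to its child.\<close>

lemma arc_length_nonneg: "x < 2 * n \<Longrightarrow> arc n \<B> X x y \<Longrightarrow> 0 \<le> arc_length f X p x y"
  using slack_nonneg[of x y] pair_optimal[of x]
  by (auto simp: arc_def arc_length_def pair_optimal_def)

lemma triangle: "x < 2 * n \<Longrightarrow> y < 2 * n \<Longrightarrow> arc n \<B> X x y \<Longrightarrow> d y \<le> d x + arc_length f X p x y"
  using forest unfolding shortest_forest_def by blast

lemma parent:
  assumes "y < 2 * n" "par y = Suc x"
  shows "x < 2 * n" "arc n \<B> X x y" "d y = d x + arc_length f X p x y" "rk x < rk y" "d x \<le> d y"
    "\<And>z. z < 2 * n \<Longrightarrow> arc n \<B> X z y \<Longrightarrow> rk z < rk x \<Longrightarrow> d y < d z + arc_length f X p z y"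
proof -
  have *: "x < 2 * n \<and> arc n \<B> X x y \<and> d y = d x + arc_length f X p x y \<and> rk x < rk y \<and>
      (\<forall>z<2 * n. arc n \<B> X z y \<longrightarrow> rk z < rk x \<longrightarrow> d y < d z + arc_length f X p z y)"
    using forest assms unfolding shortest_forest_def by blast
  then show "x < 2 * n" "arc n \<B> X x y" "d y = d x + arc_length f X p x y" "rk x < rk y"
    "\<And>z. z < 2 * n \<Longrightarrow> arc n \<B> X z y \<Longrightarrow> rk z < rk x \<Longrightarrow> d y < d z + arc_length f X p z y"
    by blast+
  then show "d x \<le> d y" using arc_length_nonneg[of x y] by linarith
qed

text \<open>All other nodes start at the cap \<open>c + m\<close>, so below the cap only the two
  sources can be roots.\<close>

lemma root: "y < 2 * n \<Longrightarrow> par y = 0 \<Longrightarrow> d y < c + m \<Longrightarrow> (y = i \<or> y = n + i) \<and> d y = m - p y"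
proof -
  assume y: "y < 2 * n" "par y = 0" "d y < c + m"
  have "d y = (if y = i \<or> y = n + i then m - p y else c + m)"
    using forest y(1,2) unfolding shortest_forest_def by blast
  then show ?thesis using y(3) by (simp split: if_splits)
qed

text \<open>By \<open>local_optimum_global\<close> only single swaps matter, and for these the shift
  by \<open>min d D\<close> keeps the reduced cost nonnegative: this is the triangle inequality for
  \<open>d\<close>.\<close>

lemma minimal':
  assumes "Y \<in> \<B>" shows "f X - sum p' X \<le> f Y - sum p' Y"
proof -
  interpret M: real_valuated_matroid "{..<2 * n}" \<B> "\<lambda>X. f X - sum p' X" by (rule add_linear)
  show ?thesis
  proof (rule M.local_optimum_global[OF base _ assms])
    fix u v assume uv: "u \<in> X" "v \<notin> X" "insert v (X - {u}) \<in> \<B>"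
    have "d v \<le> d u + arc_length f X p u v"
      using uv in_ground exchange_in_ground by (intro triangle) (auto simp: arc_def)
    with slack_nonneg[OF uv] show "f X - sum p' X \<le> f (insert v (X - {u})) - sum p' (insert v (X - {u}))"
      using uv by (auto simp: sum_exchange arc_length_def p'_def)
  qed
qed

lemma p'_le: "p' x \<le> p x"
  by (simp add: p'_def)

text \<open>The choice of \<open>D\<close> protects the lower bounds, the upper bounds survive since
  potentials only decrease, and the order between mates is the triangle inequality on their
  arc.\<close>

lemma pair_optimal':
  assumes x: "x < 2 * n" "x \<noteq> i" "x \<noteq> n + i"
  shows "pair_optimal n X p' Q x"
proof -
  have y: "mate n x < 2 * n" using x by (simp add: mate_less)
  note px = pair_optimal[OF x(1), unfolded pair_optimal_def]
  show ?thesis unfolding pair_optimal_def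
  proof (intro conjI impI; elim conjE)
    assume "x \<notin> X" "mate n x \<notin> X"
    then show "0 \<le> p' x" using px D(2)[OF x(1)] by (auto simp: p'_def)
  next
    assume a: "x \<notin> X" "mate n x \<in> X"
    then show "- Q x \<le> p' x" using px D(2)[OF x(1)] by (auto simp: p'_def)
    show "p' (mate n x) \<le> 0" using px a p'_le order_trans by blast
    have "d (mate n x) \<le> d x + (p x - p (mate n x))"
      using triangle[OF x(1) y] a by (auto simp: arc_def arc_length_def)
    then show "p' (mate n x) \<le> p' x" using px a by (auto simp: p'_def)
  next
    assume "x \<in> X" "mate n x \<in> X"
    then show "p' x \<le> - Q x" using px p'_le order_trans by blast
  qed
qed

lemma source: "x = i \<or> x = n + i \<Longrightarrow> x \<in> X \<and> x < 2 * n \<and> mate n x \<in> X \<and> p' x \<le> m - D \<and> p' x \<le> 0"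
proof (intro conjI)
  assume x: "x = i \<or> x = n + i"
  show "x \<in> X" "x < 2 * n" "mate n x \<in> X" using x i by (auto simp: mate_def)
  have "d x \<le> (if x = i \<or> x = n + i then m - p x else c + m)"
    using forest \<open>x < 2 * n\<close> unfolding shortest_forest_def by blast
  then have "d x \<le> m - p x" using x by simp
  moreover have "p x \<le> m" using x by (auto simp: m_def)
  ultimately show "p' x \<le> m - D" by (auto simp: p'_def)
  have "p x \<le> - Q x" using pair_optimal[of x] \<open>x \<in> X\<close> \<open>x < 2 * n\<close> \<open>mate n x \<in> X\<close>
    by (simp add: pair_optimal_def)
  then show "p' x \<le> 0" using Q[of x] p'_le[of x] \<open>x < 2 * n\<close> by auto
qed

text \<open>When \<open>D\<close> reaches the cap, both sources have \<open>p' \<le> - c\<close>, so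
  keeping both copies and paying the penalty is optimal for this pair.\<close>

lemma certified_no_path:
  assumes "D = c + m" shows "certified X p' Q'"
  unfolding certified_def
proof (intro conjI ballI allI impI base minimal')
  fix x assume x: "x < 2 * n"
  show "pair_optimal n X p' Q' x"
  proof (cases "x = i \<or> x = n + i")
    case True
    then show ?thesis using source[OF True] assms by (auto simp: pair_optimal_def Q'_def)
  next
    case False
    then show ?thesis using pair_optimal'[of x] x by (simp add: pair_optimal_def Q'_def)
  qed
qed

text \<open>The path alternates between exchange arcs, collected in \<open>ps\<close> starting from
  the \<open>y\<close> end, and arcs between mates. The clauses about mates say that every node
  other than the two ends \<open>s\<close> and \<open>y\<close> occurs together with its mate. The
  ordering of \<open>ps\<close> by rank is the form in which the absence of shortcuts will be
  used.\<close>

lemma augmenting_path: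
  assumes "parent_path par (Suc y) L" "y < 2 * n" "y \<notin> X" "d y < c + m"
  shows "\<exists>ps s. fst ` set ps = set L \<inter> X \<and> snd ` set ps = set L - X \<and>
    (\<forall>(u, v)\<in>set ps. par v = Suc u) \<and>
    sorted_wrt (\<lambda>(u, v) (u', v'). rk u' < rk u \<and> rk v' < rk u) ps \<and>
    (s = i \<or> s = n + i) \<and> s \<in> set L \<and> d s = m - p s \<and>
    (\<forall>x\<in>set L - X. x = y \<or> (mate n x \<in> set L \<inter> X \<and> par (mate n x) = Suc x)) \<and>
    (\<forall>x\<in>set L \<inter> X. x = s \<or> (mate n x \<in> set L - X \<and> mate n x \<noteq> y)) \<and>
    (\<forall>x\<in>set L. x < 2 * n \<and> rk x \<le> rk y \<and> d x \<le> d y)"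
  using assms
proof (induction "rk y" arbitrary: y L rule: less_induct)
  case less
  \<comment> \<open>A root below the cap is a source and hence in \<open>X\<close>, whereas
    \<open>y\<close> is not.\<close>
  obtain u where u: "par y = Suc u"
    using root[of y] less.prems i by (cases "par y") auto
  note pu = parent[OF less.prems(2) u]
  have uX: "u \<in> X" using pu(2) less.prems(3) by (auto simp: arc_def)
  obtain L' where L: "L = y # u # L'" and L': "parent_path par (par u) L'"
    using less.prems(1) u by (auto simp: parent_path_Suc_iff)
  show ?case
  proof (cases "par u")
    case 0
    then have "L' = []" using L' by simp
    moreover have "(u = i \<or> u = n + i) \<and> d u = m - p u"
      using root[OF pu(1) 0] pu(5) less.prems(4) by linarith
    ultimately show ?thesis using u uX pu less.prems
      by (intro exI[of _ "[(u, y)]"] exI[of _ u]) (auto simp: L)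
  next
    case (Suc v)
    note pv = parent[OF pu(1) Suc]
    have v: "v \<notin> X" "u = mate n v" using pv(2) uX by (auto simp: arc_def)
    have vu: "mate n u = v" using v mate_mate[OF pv(1)] by simp
    have "rk v < rk y" "d v < c + m" using pu pv less.prems by linarith+
    with less.hyps[of v L'] L' Suc v pv(1) obtain ps s where IH:
      "fst ` set ps = set L' \<inter> X" "snd ` set ps = set L' - X"
      "\<forall>(u, v)\<in>set ps. par v = Suc u"
      "sorted_wrt (\<lambda>(u, v) (u', v'). rk u' < rk u \<and> rk v' < rk u) ps"
      "s = i \<or> s = n + i" "s \<in> set L'" "d s = m - p s"
      "\<forall>x\<in>set L' - X. x = v \<or> (mate n x \<in> set L' \<inter> X \<and> par (mate n x) = Suc x)"
      "\<forall>x\<in>set L' \<inter> X. x = s \<or> (mate n x \<in> set L' - X \<and> mate n x \<noteq> v)"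
      "\<forall>x\<in>set L'. x < 2 * n \<and> rk x \<le> rk v \<and> d x \<le> d v"
      by auto
    have vL: "v \<in> set L'" using L' Suc by (auto simp: parent_path_Suc_iff)
    have rkL: "x \<in> set L' \<Longrightarrow> rk x < rk u \<and> rk x < rk y \<and> x \<noteq> y" for x
      using IH(10) pv(4) pu(4) by fastforce
    show ?thesis
    proof (intro exI[of _ "(u, y) # ps"] exI[of _ s] conjI)
      show "sorted_wrt (\<lambda>(u, v) (u', v'). rk u' < rk u \<and> rk v' < rk u) ((u, y) # ps)"
      proof -
        have "u' \<in> set L' \<and> v' \<in> set L'" if "(u', v') \<in> set ps" for u' v'
          using that IH(1,2) by force
        then show ?thesis using IH(4) rkL by auto
      qed
      show "\<forall>x\<in>set L - X. x = y \<or> (mate n x \<in> set L \<inter> X \<and> par (mate n x) = Suc x)"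
        using IH(8) uX v Suc by (auto simp: L)
      show "\<forall>x\<in>set L \<inter> X. x = s \<or> (mate n x \<in> set L - X \<and> mate n x \<noteq> y)"
        using IH(9) rkL rkL[OF vL] vL v(1) less.prems(3) vu by (auto simp: L)
      show "\<forall>x\<in>set L. x < 2 * n \<and> rk x \<le> rk y \<and> d x \<le> d y"
        using IH(10) less.prems pu pv by (force simp: L)
    qed (use IH uX less.prems u in \<open>auto simp: L\<close>)
  qed
qed

text \<open>After the shift all arcs of the path are tight, so each exchange on it stays among the
  minimisers of \<open>f - p'\<close>, and the absence of shortcuts lets all of them be carried out
  together. Only the two end pairs change their number of members.\<close>

lemma certified_path:
  assumes y: "y < 2 * n" "y \<notin> X" "D = d y + p y + (if mate n y \<in> X then Q y else 0)" "D < c + m"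
    and L: "parent_path par (Suc y) L"
  shows "certified ((X - set L) \<union> (set L - X)) p' Q'"
proof -
  \<comment> \<open>Adding \<open>y\<close> has nonnegative cost by \<open>pair_optimal\<close>.
    Since no node of the path is farther than \<open>y\<close>, the formula
    \<open>p x - D + d x\<close> then holds on the whole path.\<close>
  have dy: "d y \<le> D"
    using y pair_optimal[OF y(1)] by (auto simp: pair_optimal_def)
  then have "d y < c + m" using y by simp
  from augmenting_path[OF L y(1,2) this] obtain ps s where
    ps: "fst ` set ps = set L \<inter> X" "snd ` set ps = set L - X"
      "\<forall>(u, v)\<in>set ps. par v = Suc u"
      "sorted_wrt (\<lambda>(u, v) (u', v'). rk u' < rk u \<and> rk v' < rk u) ps"
    and s: "s = i \<or> s = n + i" "s \<in> set L" "d s = m - p s"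
    and L1: "\<forall>x\<in>set L - X. x = y \<or> (mate n x \<in> set L \<inter> X \<and> par (mate n x) = Suc x)"
    and L2: "\<forall>x\<in>set L \<inter> X. x = s \<or> (mate n x \<in> set L - X \<and> mate n x \<noteq> y)"
    and L3: "\<forall>x\<in>set L. x < 2 * n \<and> rk x \<le> rk y \<and> d x \<le> d y"
    by (elim exE conjE) (rule that)
  have parent_ps: "par v = Suc u" if "(u, v) \<in> set ps" for u v
    using ps(3) that by auto
  note L1 = L1[rule_format, OF DiffI] and L2 = L2[rule_format, OF IntI] and L3 = L3[rule_format]
  note s' = source[OF s(1)]
  have yL: "y \<in> set L" using L by (auto simp: parent_path_Suc_iff)
  define M where "M = {Z \<in> \<B>. \<forall>Y\<in>\<B>. f Z - sum p' Z \<le> f Y - sum p' Y}"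
  interpret M: real_valuated_matroid "{..<2 * n}" \<B> "\<lambda>X. f X - sum p' X" by (rule add_linear)
  have M_iff: "insert v (X - {u}) \<in> M \<longleftrightarrow>
      insert v (X - {u}) \<in> \<B> \<and> arc_length f X p' u v \<le> 0" if "u \<in> X" "v \<notin> X" for u v
  proof -
    have eq: "arc_length f X p' u v =
        (f (insert v (X - {u})) - sum p' (insert v (X - {u}))) - (f X - sum p' X)"
      unfolding sum_exchange[OF that] using that by (simp add: arc_length_def)
    show ?thesis
    proof
      assume "insert v (X - {u}) \<in> M"
      then have "insert v (X - {u}) \<in> \<B> \<and>
          f (insert v (X - {u})) - sum p' (insert v (X - {u})) \<le> f X - sum p' X"
        unfolding M_def using base by blast
      then show "insert v (X - {u}) \<in> \<B> \<and> arc_length f X p' u v \<le> 0"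
        unfolding eq by simp
    next
      assume "insert v (X - {u}) \<in> \<B> \<and> arc_length f X p' u v \<le> 0"
      then show "insert v (X - {u}) \<in> M"
        unfolding eq M_def using minimal' by (smt (verit) mem_Collect_eq)
    qed
  qed
  have p': "p' x = p x - D + d x" if "x \<in> set L" for x
    using L3[OF that] dy by (auto simp: p'_def)
  have pairL: "u \<in> set L" "v \<in> set L" "u \<in> X" "v \<notin> X" if "(u, v) \<in> set ps" for u v
    using that ps(1,2) by force+
  have "(X - fst ` set ps) \<union> snd ` set ps \<in> M"
  proof (rule exchange_without_shortcuts)
    show "\<exists>u. u \<in> Z \<and> u \<notin> Y \<and> insert u (Y - {v}) \<in> M" if "Y \<in> M" "Z \<in> M" "v \<in> Y" "v \<notin> Z" for Y Z v
      using M.minimizers_exchange[of Y Z v] that by (auto simp: M_def)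
    show "X \<in> M" using base minimal' by (simp add: M_def)
    have rk_ps: "rk u < rk v" if "(u, v) \<in> set ps" for u v
      using parent(4)[of v u] parent_ps[OF that] pairL[OF that] L3 by blast
    have "sorted_wrt (\<lambda>a b. fst a \<noteq> fst b) ps" "sorted_wrt (\<lambda>a b. snd a \<noteq> snd b) ps"
      by (rule sorted_wrt_mono_rel[OF _ ps(4)]; clarsimp dest!: rk_ps)+
    then show "distinct (map fst ps)" "distinct (map snd ps)"
      by (induction ps) auto
    show "u \<in> X \<and> v \<notin> X \<and> insert v (X - {u}) \<in> M" if uv: "(u, v) \<in> set ps" for u v
    proof -
      note 1 = pairL[OF uv]
      note 2 = parent[of v u, OF _ parent_ps[OF uv]]
      have "arc n \<B> X u v" "d v = d u + arc_length f X p u v" using 2 L3 1 by blast+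
      then show ?thesis using 1 M_iff[of u v] p'[of u] p'[of v] by (auto simp: arc_def arc_length_def)
    qed
    show "sorted_wrt (\<lambda>(u, v) (u', v'). insert v (X - {u'}) \<notin> M) ps"
    proof (rule sorted_wrt_mono_rel[OF _ ps(4)], clarify)
      fix u v u' v'
      assume in_ps: "(u, v) \<in> set ps" "(u', v') \<in> set ps" and rk: "rk u' < rk u"
        and M: "insert v (X - {u'}) \<in> M"
      have "insert v (X - {u'}) \<in> \<B>" and le: "arc_length f X p' u' v \<le> 0"
        using M M_iff[of u' v] pairL[OF in_ps(1)] pairL[OF in_ps(2)] by auto
      then have "arc n \<B> X u' v" using pairL[OF in_ps(1)] pairL[OF in_ps(2)] by (auto simp: arc_def)
      \<comment> \<open>As \<open>u'\<close> ranks before the parent \<open>u\<close> of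
        \<open>v\<close>, it does not lie on a shortest path to \<open>v\<close>. Its arc therefore
        keeps a positive length after the shift.\<close>
      then have "d v < d u' + arc_length f X p u' v"
        using parent(6)[of v u u'] parent_ps[OF in_ps(1)] pairL[OF in_ps(1)] pairL[OF in_ps(2)] L3 rk by blast
      then show False using le pairL[OF in_ps(1)] pairL[OF in_ps(2)] p'[of u'] p'[of v]
        by (auto simp: arc_length_def)
    qed
  qed
  then have X': "(X - set L) \<union> (set L - X) \<in> M" (is "?X \<in> M")
  proof -
    have "(X - fst ` set ps) \<union> snd ` set ps = ?X" using ps(1,2) by auto
    then show "(X - fst ` set ps) \<union> snd ` set ps \<in> M \<Longrightarrow> ?thesis" by simp
  qed
  \<comment> \<open>The two ends of the path are flipped without their mates.\<close>
  have my: "mate n y \<notin> set L"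
  proof
    assume a: "mate n y \<in> set L"
    show False
    proof (cases "mate n y \<in> X")
      case True
      then have "mate n y = s" using L2[OF a] y by (simp add: mate_mate)
      then show False using s' y mate_mate[OF y(1)] by metis
    next
      case False
      then show False using L1[OF a] y mate_neq[OF y(1)] by (simp add: mate_mate)
    qed
  qed
  have ms: "mate n s \<notin> set L"
    using L2[of "mate n s"] s' s mate_neq[of s n] mate_mate[of s n] by auto
  have "pair_optimal n ?X p' Q' x" if x: "x < 2 * n" for x
  proof (cases "x = i \<or> x = n + i")
    case True
    have tight: "p' s = m - D" using s p'[OF s(2)] by simp
    have sx: "x = s \<or> x = mate n s" using True s i by (auto simp: mate_def)
    show ?thesis
    proof (cases "x = s")
      case True
      have "mate n s = i \<or> mate n s = n + i" using s i by (auto simp: mate_def)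
      from source[OF this] show ?thesis
        using True s s' ms tight D(1) by (auto simp: pair_optimal_def Q'_def)
    next
      case False
      then have "x = mate n s" using sx by simp
      then show ?thesis
        using s s' ms mate_mate[of s n] by (auto simp: pair_optimal_def)
    qed
  next
    case False
    have Q'x: "Q' x = Q x" using False by (simp add: Q'_def)
    have mx: "mate n x < 2 * n" "mate n (mate n x) = x" using x by (auto simp: mate_less mate_mate)
    have False': "mate n x \<noteq> i" "mate n x \<noteq> n + i"
      using False x i by (auto simp: mate_def split: if_splits)
    have "x \<noteq> i" "x \<noteq> n + i" using False by auto
    note po = pair_optimal'[OF x this, unfolded pair_optimal_def]
    note pm = pair_optimal'[OF mx(1) False', unfolded pair_optimal_def mx]
    \<comment> \<open>The bound \<open>D\<close> is attained at \<open>y\<close>, which puts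
      \<open>p' y\<close> exactly at the threshold where adding \<open>y\<close> to its pair costs
      nothing.\<close>
    have py: "p' y = - (if mate n y \<in> X then Q y else 0)"
      using p'[OF yL] y(3) by simp
    have Qx: "Q (mate n x) = Q x" "0 \<le> Q x" using Q x by auto
    have xs: "x \<noteq> s" "mate n x \<noteq> s" using False False' s by auto
    consider "x \<notin> set L" "mate n x \<notin> set L" | "x = y" | "mate n x = y" "x \<noteq> y"
      | "x \<in> set L" "x \<noteq> y" "mate n x \<in> set L" "mate n x \<noteq> y" "x \<in> X \<longleftrightarrow> mate n x \<notin> X" "p' x = p' (mate n x)"
    proof -
      \<comment> \<open>Inside the path the arc between mates is tight, which equates their
        potentials: swapping one for the other is free.\<close>
      have *: "mate n z \<in> set L \<and> mate n z \<noteq> y \<and> (z \<in> X \<longleftrightarrow> mate n z \<notin> X) \<and> p' z = p' (mate n z)"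
        if z: "z \<in> set L" "z \<noteq> y" "mate n z \<noteq> y" "z \<noteq> s" for z
      proof (cases "z \<in> X")
        case True
        then have w: "mate n z \<in> set L" "mate n z \<notin> X" "mate n z \<noteq> y" using L2[OF z(1)] z by auto
        have zz: "mate n (mate n z) = z" using L3[OF z(1)] by (simp add: mate_mate)
        have "par z = Suc (mate n z)" using L1[OF w(1,2)] w(3) zz by auto
        then have "d z = d (mate n z) + arc_length f X p (mate n z) z" using parent(3) L3[OF z(1)] by blast
        then show ?thesis using w True p'[OF z(1)] p'[OF w(1)] by (simp add: arc_length_def)
      next
        case False
        then have w: "mate n z \<in> set L" "mate n z \<in> X" "par (mate n z) = Suc z"
          using L1[OF z(1)] z by auto
        then have "d (mate n z) = d z + arc_length f X p z (mate n z)" using parent(3) L3[OF w(1)] by blast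
        then show ?thesis using w False p'[OF z(1)] p'[OF w(1)] z by (simp add: arc_length_def)
      qed
      show ?thesis using *[of x] *[of "mate n x"] mx xs that by metis
    qed
    then show ?thesis
    proof cases
      case 1
      then show ?thesis using po by (simp add: pair_optimal_def Q'x)
    next
      case 2
      then show ?thesis using po pm py yL my y Qx Q'x by (auto simp: pair_optimal_def)
    next
      case 3
      then have xy: "x = mate n y" using mx by simp
      then show ?thesis using po pm py yL my y Qx mx 3 Q'x by (auto simp: pair_optimal_def)
    next
      case 4
      then show ?thesis using po pm Qx mx by (auto simp: pair_optimal_def Q'x)
    qed
  qed
  then show ?thesis using X' by (auto simp: certified_def M_def)
qed

end

section \<open>Dijkstra's algorithm\<close>

text \<open>A nonzero rank marks a finished node. The strict inequality in the clause on parents is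
  the tie-breaking rule: no finished node ranked before the parent offers an equally short way to
  \<open>y\<close>.\<close>

definition dijkstra_inv ::
  "nat \<Rightarrow> (nat \<Rightarrow> nat \<Rightarrow> bool) \<Rightarrow> (nat \<Rightarrow> nat \<Rightarrow> real) \<Rightarrow> (nat \<Rightarrow> real) \<Rightarrow> nat \<Rightarrow>
    (nat \<Rightarrow> real) \<Rightarrow> (nat \<Rightarrow> nat) \<Rightarrow> (nat \<Rightarrow> nat) \<Rightarrow> bool" where
  "dijkstra_inv N E l k j d par rk \<longleftrightarrow>
     (\<forall>x<N. d x \<le> k x \<and> rk x \<le> j) \<and> card {x. x < N \<and> rk x \<noteq> 0} = j \<and>
     (\<forall>x<N. \<forall>y<N. rk x \<noteq> 0 \<longrightarrow> E x y \<longrightarrow> d y \<le> d x + l x y) \<and>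
     (\<forall>y<N. par y = 0 \<longrightarrow> d y = k y) \<and>
     (\<forall>y<N. \<forall>x. par y = Suc x \<longrightarrow> x < N \<and> rk x \<noteq> 0 \<and> E x y \<and> d y = d x + l x y \<and>
        (rk y \<noteq> 0 \<longrightarrow> rk x < rk y) \<and>
        (\<forall>z<N. rk z \<noteq> 0 \<longrightarrow> E z y \<longrightarrow> rk z < rk x \<longrightarrow> d y < d z + l z y)) \<and>
     (\<forall>x<N. \<forall>y<N. rk x \<noteq> 0 \<longrightarrow> rk y = 0 \<longrightarrow> d x \<le> d y)"

lemma dijkstra_init:
  "(\<And>x. x < N \<Longrightarrow> d x = k x \<and> par x = 0 \<and> rk x = 0) \<Longrightarrow> dijkstra_inv N E l k 0 d par rk"
  by (simp add: dijkstra_inv_def)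

lemma dijkstra_unfinished:
  assumes "dijkstra_inv N E l k j d par rk" "j < N"
  shows "\<exists>x<N. rk x = 0"
proof (rule ccontr)
  assume "\<not> ?thesis"
  then have "{x. x < N \<and> rk x \<noteq> 0} = {..<N}" by auto
  then show False using assms by (simp add: dijkstra_inv_def)
qed

lemma dijkstra_finished:
  assumes "dijkstra_inv N E l k N d par rk"
  shows "shortest_forest N E l k d par rk"
proof -
  have "card {x. x < N \<and> rk x \<noteq> 0} = card {..<N}" using assms by (simp add: dijkstra_inv_def)
  then have "{x. x < N \<and> rk x \<noteq> 0} = {..<N}" by (intro card_subset_eq) auto
  then have rk: "rk x \<noteq> 0" if "x < N" for x using that by blast
  show ?thesis unfolding shortest_forest_def
    using assms[unfolded dijkstra_inv_def] rk by (intro conjI) (meson neq0_conv)+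
qed

text \<open>The new rank of \<open>u\<close> exceeds all others, so \<open>u\<close> is no earlier
  rival of an existing parent. Where \<open>u\<close> itself becomes the parent, the old distance
  was already at most what any finished node offers, and the new one is strictly smaller.\<close>

lemma dijkstra_step:
  assumes inv: "dijkstra_inv N E l k j d par rk"
    and l: "\<And>x y. x < N \<Longrightarrow> y < N \<Longrightarrow> E x y \<Longrightarrow> 0 \<le> l x y"
    and u: "u < N" "rk u = 0" "\<And>y. y < N \<Longrightarrow> rk y = 0 \<Longrightarrow> d u \<le> d y"
    and rk': "\<And>y. y < N \<Longrightarrow> rk' y = (if y = u then Suc j else rk y)"
    and d': "\<And>y. y < N \<Longrightarrow> d' y = (if rk' y = 0 \<and> E u y \<and> d u + l u y < d y then d u + l u y else d y)"
    and par': "\<And>y. y < N \<Longrightarrow>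
      par' y = (if rk' y = 0 \<and> E u y \<and> d u + l u y < d y then Suc u else par y)"
  shows "dijkstra_inv N E l k (Suc j) d' par' rk'"
proof -
  note I = inv[unfolded dijkstra_inv_def]
  have le: "d' y \<le> d y" if "y < N" for y using d'[OF that] by simp
  have du: "d' y = d y" if "y < N" "rk' y \<noteq> 0" for y using d'[OF that(1)] that by simp
  have rku: "rk' u = Suc j" using rk' u by simp
  have rk0: "rk' y \<noteq> 0 \<longleftrightarrow> y = u \<or> rk y \<noteq> 0" if "y < N" for y using rk'[OF that] by simp
  have rkle: "rk y \<le> j" if "y < N" for y using I that by blast
  show ?thesis unfolding dijkstra_inv_def
  proof (intro conjI allI impI)
    show "d' x \<le> k x" if "x < N" for x using le[OF that] I that by (meson order_trans)
    show "rk' x \<le> Suc j" if "x < N" for x using rk'[OF that] rkle[OF that] by simp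
    have "{x. x < N \<and> rk' x \<noteq> 0} = insert u {x. x < N \<and> rk x \<noteq> 0}" using rk0 u(1) by blast
    then show "card {x. x < N \<and> rk' x \<noteq> 0} = Suc j" using I u(2) by simp
  next
    fix x y assume xy: "x < N" "y < N" "rk' x \<noteq> 0" "E x y"
    show "d' y \<le> d' x + l x y"
    proof (cases "x = u")
      case True
      have "d u \<le> d y \<or> rk y \<noteq> 0" using u xy by blast
      \<comment> \<open>A finished \<open>y\<close> is no farther than \<open>u\<close>, and lengths
        are nonnegative, so it has nothing to gain from \<open>u\<close>.\<close>
      moreover have "d y \<le> d u + l u y" if "rk' y \<noteq> 0"
      proof -
        have "d y \<le> d u" using that rk0[OF xy(2)] I xy(2) u(1,2) by blast
        then show ?thesis using l[of u y] xy True by fastforce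
      qed
      ultimately show ?thesis using d'[OF xy(2)] du[OF xy(1,3)] True xy by auto
    next
      case False
      then have "d y \<le> d x + l x y" using xy I rk0[OF xy(1)] by blast
      then show ?thesis using le[OF xy(2)] du[OF xy(1,3)] by simp
    qed
  next
    show "d' y = k y" if y: "y < N" "par' y = 0" for y
    proof -
      have "par y = 0" "d' y = d y" using par'[OF y(1)] d'[OF y(1)] y(2) by (auto split: if_splits)
      then show ?thesis using I y(1) by metis
    qed
  next
    fix y x assume y: "y < N" and par: "par' y = Suc x"
    have old: "x < N \<and> rk x \<noteq> 0 \<and> E x y \<and> d y = d x + l x y \<and> (rk y \<noteq> 0 \<longrightarrow> rk x < rk y) \<and>
        (\<forall>z<N. rk z \<noteq> 0 \<longrightarrow> E z y \<longrightarrow> rk z < rk x \<longrightarrow> d y < d z + l z y)"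
      if "par y = Suc x" using I that y by blast
    have "x < N \<and> rk' x \<noteq> 0 \<and> E x y \<and> d' y = d' x + l x y \<and> (rk' y \<noteq> 0 \<longrightarrow> rk' x < rk' y) \<and>
        (\<forall>z<N. rk' z \<noteq> 0 \<longrightarrow> E z y \<longrightarrow> rk' z < rk' x \<longrightarrow> d' y < d' z + l z y)"
    proof (cases "rk' y = 0 \<and> E u y \<and> d u + l u y < d y")
      case True
      then have xu: "x = u" using par par'[OF y] by simp
      have "d' y < d' z + l z y" if z: "z < N" "rk' z \<noteq> 0" "E z y" "rk' z < rk' u" for z
      proof -
        have "z \<noteq> u" using z by auto
        then have "d y \<le> d z + l z y" using I z y rk0[OF z(1)] by blast
        then show ?thesis using True d'[OF y] du[OF z(1,2)] by simp
      qed
      then show ?thesis using True xu u(1) d'[OF y] du[OF u(1)] rku by simp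
    next
      case False
      then have p: "par y = Suc x" and dy: "d' y = d y" using par par'[OF y] d'[OF y] by auto
      note o = old[OF p]
      have x: "x < N" "x \<noteq> u" "rk' x = rk x" using o u(2) rk'[of x] by auto
      have "rk' x < rk' y" if "rk' y \<noteq> 0"
        using that rk'[OF y] o x rkle[OF x(1)] by (auto split: if_splits)
      moreover have "d' y < d' z + l z y" if z: "z < N" "rk' z \<noteq> 0" "E z y" "rk' z < rk' x" for z
      proof -
        have "z \<noteq> u" using z x rkle[OF x(1)] rku by auto
        then have "rk z \<noteq> 0" "rk z < rk x" using z rk'[OF z(1)] x by auto
        then have "d y < d z + l z y" using o z(1,3) by blast
        then show ?thesis using dy du[OF z(1,2)] by simp
      qed
      ultimately show ?thesis using o x dy du[of x] by simp
    qed
    then show "x < N" "rk' x \<noteq> 0" "E x y" "d' y = d' x + l x y" "rk' y \<noteq> 0 \<Longrightarrow> rk' x < rk' y"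
      "\<And>z. z < N \<Longrightarrow> rk' z \<noteq> 0 \<Longrightarrow> E z y \<Longrightarrow> rk' z < rk' x \<Longrightarrow> d' y < d' z + l z y"
      by blast+
  next
    fix x y assume xy: "x < N" "y < N" "rk' x \<noteq> 0" "rk' y = 0"
    have y: "rk y = 0" using rk0[OF xy(2)] xy by blast
    have 1: "d x \<le> d u" using I xy u rk0[OF xy(1)] by blast
    have 2: "d u \<le> d y" using u xy y by blast
    show "d' x \<le> d' y" using 1 2 d'[OF xy(2)] du[OF xy(1,3)] l[OF u(1) xy(2)] by auto
  qed
qed

section \<open>Bounded loop programs\<close>

text \<open>With bounded loops only, every program is a total function on states and has a step
  bound that can be read off its syntax. Correctness can then be proved about \<open>den\<close>
  instead of the relation \<open>exec\<close>.\<close>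

datatype prog = PSkip
  | PN vname nexp nexp
  | PR vname nexp rexp
  | PQuery fun_id vname vname vname
  | PSeq prog prog (infixr ";;" 60)
  | PIf bexp prog prog
  | PFor vname vname prog

primrec compile :: "prog \<Rightarrow> com" where
  "compile PSkip = Skip"
| "compile (PN x i a) = NAssign x i a"
| "compile (PR x i a) = RAssign x i a"
| "compile (PQuery k x f r) = Query k x f r"
| "compile (c ;; d) = Seq (compile c) (compile d)"
| "compile (PIf b c d) = If b (compile c) (compile d)"
| "compile (PFor i b c) = Seq (NAssign i (NConst 0) (NConst 0))
     (While (NLess (NCell i (NConst 0)) (NCell b (NConst 0)))
       (Seq (compile c) (NAssign i (NConst 0) (NAdd (NCell i (NConst 0)) (NConst 1)))))"

primrec iterate_for :: "vname \<Rightarrow> (state \<Rightarrow> state) \<Rightarrow> nat \<Rightarrow> state \<Rightarrow> state" where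
  "iterate_for i g 0 s = (upd (fst s) i 0 0, snd s)"
| "iterate_for i g (Suc k) s =
     (upd (fst (g (iterate_for i g k s))) i 0 (Suc k), snd (g (iterate_for i g k s)))"

text \<open>The oracle value \<open>-\<infinity>\<close> would block \<open>exec\<close>, whereas
  \<open>den\<close> proceeds as if it were finite. This is why \<open>exec_compile\<close> excludes
  it.\<close>

primrec den :: "(fun_id \<Rightarrow> (nat \<Rightarrow> nat) \<Rightarrow> ereal) \<Rightarrow> prog \<Rightarrow> state \<Rightarrow> state" where
  "den orc PSkip s = s"
| "den orc (PN x i a) s = (upd (fst s) x (nval i s) (nval a s), snd s)"
| "den orc (PR x i a) s = (fst s, upd (snd s) x (nval i s) (rval a s))"
| "den orc (PQuery k x f r) s =
     (if orc k (fst s x) = \<infinity> then (upd (fst s) f 0 0, snd s)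
      else (upd (fst s) f 0 1, upd (snd s) r 0 (real_of_ereal (orc k (fst s x)))))"
| "den orc (c ;; d) s = den orc d (den orc c s)"
| "den orc (PIf b c d) s = (if bval b s then den orc c s else den orc d s)"
| "den orc (PFor i b c) s = iterate_for i (den orc c) (fst s b 0) s"

primrec nmods :: "prog \<Rightarrow> vname set" where
  "nmods PSkip = {}"
| "nmods (PN x i a) = {x}"
| "nmods (PR x i a) = {}"
| "nmods (PQuery k x f r) = {f}"
| "nmods (c ;; d) = nmods c \<union> nmods d"
| "nmods (PIf b c d) = nmods c \<union> nmods d"
| "nmods (PFor i b c) = insert i (nmods c)"

primrec rmods :: "prog \<Rightarrow> vname set" where
  "rmods PSkip = {}"
| "rmods (PN x i a) = {}"
| "rmods (PR x i a) = {x}"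
| "rmods (PQuery k x f r) = {r}"
| "rmods (c ;; d) = rmods c \<union> rmods d"
| "rmods (PIf b c d) = rmods c \<union> rmods d"
| "rmods (PFor i b c) = rmods c"

text \<open>Loop bounds are \<open>n\<close> or \<open>m\<close>, which \<open>exec_compile\<close>
  requires to stay unchanged, so the number of rounds is fixed in advance and at most
  \<open>N\<close>.\<close>

primrec well_formed :: "prog \<Rightarrow> bool" where
  "well_formed PSkip \<longleftrightarrow> True"
| "well_formed (PN x i a) \<longleftrightarrow> True"
| "well_formed (PR x i a) \<longleftrightarrow> True"
| "well_formed (PQuery k x f r) \<longleftrightarrow> True"
| "well_formed (c ;; d) \<longleftrightarrow> well_formed c \<and> well_formed d"
| "well_formed (PIf b c d) \<longleftrightarrow> well_formed c \<and> well_formed d"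
| "well_formed (PFor i b c) \<longleftrightarrow> well_formed c \<and> i \<notin> nmods c \<and> (b = ''n'' \<or> b = ''m'')"

text \<open>An upper bound that is polynomial in \<open>N\<close>: the branches of a conditional are
  added, as a maximum would not be a polynomial. One round of a loop spends 13 steps on its guard,
  its increment and control flow; the initial assignment and the last test account for 10.\<close>

primrec cost :: "nat \<Rightarrow> prog \<Rightarrow> nat" where
  "cost N PSkip = 1"
| "cost N (PN x i a) = ncost i + ncost a + 1"
| "cost N (PR x i a) = ncost i + rcost a + 1"
| "cost N (PQuery k x f r) = 1"
| "cost N (c ;; d) = cost N c + cost N d + 1"
| "cost N (PIf b c d) = bcost b + cost N c + cost N d + 1"
| "cost N (PFor i b c) = N * (cost N c + 13) + 10"

lemma cost_poly: "\<exists>p :: nat poly. \<forall>N. poly p N = cost N c"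
proof (induction c)
  case (PSeq c d)
  then obtain p q :: "nat poly" where "\<forall>N. poly p N = cost N c" "\<forall>N. poly q N = cost N d" by blast
  then show ?case by (intro exI[of _ "p + q + 1"]) simp
next
  case (PIf b c d)
  then obtain p q :: "nat poly" where "\<forall>N. poly p N = cost N c" "\<forall>N. poly q N = cost N d" by blast
  then show ?case by (intro exI[of _ "[:bcost b:] + p + q + 1"]) simp
next
  case (PFor i b c)
  then obtain p :: "nat poly" where "\<forall>N. poly p N = cost N c" by blast
  then show ?case by (intro exI[of _ "[:0, 1:] * (p + [:13:]) + [:10:]"]) simp
qed (auto intro: exI[of _ "[:c:]" for c])

section \<open>Frame properties, running time and loop rules\<close>

lemma iterate_for_frame_nat:
  "(\<And>s. fst (g s) x = fst s x) \<Longrightarrow> x \<noteq> i \<Longrightarrow> fst (iterate_for i g k s) x = fst s x"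
  by (induction k) (auto simp: upd_def)

lemma iterate_for_frame_real:
  "(\<And>s. snd (g s) x = snd s x) \<Longrightarrow> snd (iterate_for i g k s) x = snd s x"
  by (induction k) auto

lemma den_frame_nat: "x \<notin> nmods c \<Longrightarrow> fst (den orc c s) x = fst s x"
  by (induction c arbitrary: s) (auto simp: upd_def intro: iterate_for_frame_nat)

lemma den_frame_real: "x \<notin> rmods c \<Longrightarrow> snd (den orc c s) x = snd s x"
  by (induction c arbitrary: s) (auto simp: upd_def intro: iterate_for_frame_real)

lemma exec_compile:
  assumes orc: "\<And>k x. orc k x \<noteq> - \<infinity>"
  shows "well_formed c \<Longrightarrow> ''n'' \<notin> nmods c \<Longrightarrow> ''m'' \<notin> nmods c \<Longrightarrow> fst s ''n'' 0 \<le> N \<Longrightarrow>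
    fst s ''m'' 0 \<le> N \<Longrightarrow> \<exists>t. exec orc (compile c) s t (den orc c s) \<and> t \<le> cost N c"
proof (induction c arbitrary: s)
  case PSkip
  show ?case using exec.Skip[of orc s] by auto
next
  case (PN x i a)
  show ?case using exec.NAssign[of orc x i a s] by auto
next
  case (PR x i a)
  show ?case using exec.RAssign[of orc x i a s] by auto
next
  case (PQuery k x f r)
  show ?case
  proof (cases "orc k (fst s x)")
    case (real a)
    then show ?thesis using exec.Query_fin[of orc k s x a f r] real by auto
  next
    case PInf
    then show ?thesis using exec.Query_inf[of orc k s x f r] PInf by auto
  next
    case MInf
    then show ?thesis using orc by simp
  qed
next
  case (PSeq c d)
  obtain t where t: "exec orc (compile c) s t (den orc c s)" "t \<le> cost N c"
    using PSeq.IH(1)[of s] PSeq.prems by auto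
  obtain t' where t': "exec orc (compile d) (den orc c s) t' (den orc d (den orc c s))" "t' \<le> cost N d"
    using PSeq.IH(2)[of "den orc c s"] PSeq.prems by (auto simp: den_frame_nat)
  show ?case using exec.Seq[OF t(1) t'(1)] t(2) t'(2) by (intro exI conjI) auto
next
  case (PIf b c d)
  show ?case
  proof (cases "bval b s")
    case True
    obtain t where t: "exec orc (compile c) s t (den orc c s)" "t \<le> cost N c"
      using PIf.IH(1)[of s] PIf.prems by auto
    show ?thesis using exec.If_True[OF True t(1), of "compile d"] t(2) True by (intro exI conjI) auto
  next
    case False
    obtain t where t: "exec orc (compile d) s t (den orc d s)" "t \<le> cost N d"
      using PIf.IH(2)[of s] PIf.prems by auto
    show ?thesis using exec.If_False[OF False t(1), of "compile c"] t(2) False by (intro exI conjI) auto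
  qed
next
  case (PFor i b c)
  define k where "k = fst s b 0"
  have k: "k \<le> N" using PFor.prems by (auto simp: k_def)
  define S where "S = (\<lambda>j. iterate_for i (den orc c) j s)"
  define W where "W = While (NLess (NCell i (NConst 0)) (NCell b (NConst 0)))
       (Seq (compile c) (NAssign i (NConst 0) (NAdd (NCell i (NConst 0)) (NConst 1))))"
  have ib: "i \<noteq> ''n''" "i \<noteq> ''m''" "i \<notin> nmods c" "b = ''n'' \<or> b = ''m''" using PFor.prems by auto
  have Si: "fst (S j) i 0 = j" for j by (cases j) (auto simp: S_def upd_def)
  have Sx: "fst (S j) x = fst s x" if "x = ''n'' \<or> x = ''m''" for j x
    unfolding S_def using that PFor.prems ib
    by (intro iterate_for_frame_nat) (auto simp: den_frame_nat)
  have step: "\<exists>t. exec orc (compile c) (S j) t (den orc c (S j)) \<and> t \<le> cost N c" for j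
    using PFor.prems Sx[of "''n''" j] Sx[of "''m''" j] by (intro PFor.IH) auto
  \<comment> \<open>Induction on the number of rounds left: \<open>exec\<close> unfolds a loop at
    its first round, \<open>iterate_for\<close> at its last one.\<close>
  have "\<exists>t. exec orc W (S j) t (S k) \<and> t \<le> (k - j) * (cost N c + 13) + 6" if "j \<le> k" for j
    using that
  proof (induction "k - j" arbitrary: j)
    case 0
    then have "j = k" by simp
    moreover have "exec orc W (S k) 6 (S k)"
    proof -
      have "\<not> bval (NLess (NCell i (NConst 0)) (NCell b (NConst 0))) (S k)"
        using Si Sx ib(4) by (auto simp: k_def)
      from exec.While_False[OF this] show ?thesis by (simp add: W_def eval_nat_numeral)
    qed
    ultimately show ?case by auto
  next
    case (Suc l)
    have j: "j < k" and "l = k - Suc j" using Suc.hyps(2) by auto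
    have b: "bval (NLess (NCell i (NConst 0)) (NCell b (NConst 0))) (S j)"
      using Si Sx ib(4) j by (auto simp: k_def)
    obtain t where t: "exec orc (compile c) (S j) t (den orc c (S j))" "t \<le> cost N c"
      using step by blast
    have di: "fst (den orc c (S j)) i 0 = j" using Si ib(3) by (simp add: den_frame_nat)
    have "exec orc (NAssign i (NConst 0) (NAdd (NCell i (NConst 0)) (NConst 1))) (den orc c (S j)) 6 (S (Suc j))"
      using exec.NAssign[of orc i "NConst 0" "NAdd (NCell i (NConst 0)) (NConst 1)" "den orc c (S j)"] di
      by (simp add: S_def eval_nat_numeral)
    from exec.Seq[OF t(1) this] have body: "exec orc
       (Seq (compile c) (NAssign i (NConst 0) (NAdd (NCell i (NConst 0)) (NConst 1)))) (S j) (t + 7) (S (Suc j))"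
      by (simp add: eval_nat_numeral)
    obtain t' where t': "exec orc W (S (Suc j)) t' (S k)" "t' \<le> (k - Suc j) * (cost N c + 13) + 6"
      using Suc.hyps(1)[of "Suc j"] \<open>l = k - Suc j\<close> j by (auto simp del: mult_Suc)
    have "exec orc W (S j) (5 + (t + 7) + t' + 1) (S k)"
      using exec.While_True[OF b body, folded W_def, OF t'(1)] by (simp add: eval_nat_numeral)
    moreover have "k - j = Suc (k - Suc j)" using j by simp
    ultimately show ?case using t(2) t'(2) by (intro exI conjI) auto
  qed
  from this[of 0] obtain t where t: "exec orc W (S 0) t (S k)" "t \<le> k * (cost N c + 13) + 6" by auto
  have "exec orc (NAssign i (NConst 0) (NConst 0)) s 3 (S 0)"
    using exec.NAssign[of orc i "NConst 0" "NConst 0" s] by (simp add: S_def eval_nat_numeral)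
  from exec.Seq[OF this t(1)] have "exec orc (compile (PFor i b c)) s (3 + t + 1) (den orc (PFor i b c) s)"
    by (simp add: W_def S_def k_def eval_nat_numeral)
  moreover have "3 + t + 1 \<le> cost N (PFor i b c)"
    using t(2) mult_le_mono1[OF k, of "cost N c + 13"] unfolding cost.simps by linarith
  ultimately show ?case by blast
qed

lemma den_For_rule:
  assumes init: "I 0 (upd (fst s) i 0 0, snd s)"
    and step: "\<And>j s'. j < fst s b 0 \<Longrightarrow> I j s' \<Longrightarrow> fst s' i 0 = j \<Longrightarrow>
      I (Suc j) (upd (fst (den orc c s')) i 0 (Suc j), snd (den orc c s'))"
  shows "I (fst s b 0) (den orc (PFor i b c) s)"
proof -
  have "j \<le> fst s b 0 \<Longrightarrow> I j (iterate_for i (den orc c) j s)" for j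
  proof (induction j)
    case 0
    then show ?case using init by simp
  next
    case (Suc j)
    moreover have "fst (iterate_for i (den orc c) j s) i 0 = j" by (cases j) (simp_all add: upd_def)
    ultimately show ?case using step by simp
  qed
  then show ?thesis by simp
qed

text \<open>Spares each loop invariant the variables that the body does not touch.\<close>

lemma den_For_frame_rule:
  assumes init: "I 0 (upd (fst s) i 0 0, snd s)"
    and step: "\<And>j s'. j < fst s b 0 \<Longrightarrow> I j s' \<Longrightarrow> fst s' i 0 = j \<Longrightarrow>
      (\<And>x. x \<notin> insert i (nmods c) \<Longrightarrow> fst s' x = fst s x) \<Longrightarrow>
      (\<And>x. x \<notin> rmods c \<Longrightarrow> snd s' x = snd s x) \<Longrightarrow>
      I (Suc j) (upd (fst (den orc c s')) i 0 (Suc j), snd (den orc c s'))"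
  shows "I (fst s b 0) (den orc (PFor i b c) s)"
proof -
  define J where "J = (\<lambda>j s'. I j s' \<and> (\<forall>x. x \<notin> insert i (nmods c) \<longrightarrow> fst s' x = fst s x) \<and>
    (\<forall>x. x \<notin> rmods c \<longrightarrow> snd s' x = snd s x))"
  have "J (fst s b 0) (den orc (PFor i b c) s)"
  proof (rule den_For_rule)
    show "J 0 (upd (fst s) i 0 0, snd s)" using init by (auto simp: J_def upd_def)
    show "J (Suc j) (upd (fst (den orc c s')) i 0 (Suc j), snd (den orc c s'))"
      if "j < fst s b 0" "J j s'" "fst s' i 0 = j" for j s'
      using step[of j s'] that by (auto simp: J_def upd_def den_frame_nat den_frame_real)
  qed
  then show ?thesis by (simp add: J_def)
qed

section \<open>The program\<close>

abbreviation nvar :: "vname \<Rightarrow> nexp" where "nvar x \<equiv> NCell x (NConst 0)"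
abbreviation rvar :: "vname \<Rightarrow> rexp" where "rvar x \<equiv> RCell x (NConst 0)"
abbreviation nset :: "vname \<Rightarrow> nexp \<Rightarrow> prog" where "nset x a \<equiv> PN x (NConst 0) a"
abbreviation rset :: "vname \<Rightarrow> rexp \<Rightarrow> prog" where "rset x a \<equiv> PR x (NConst 0) a"
abbreviation Pos :: "nexp \<Rightarrow> bexp" where "Pos a \<equiv> NLess (NConst 0) a"
abbreviation NEq :: "nexp \<Rightarrow> nexp \<Rightarrow> bexp" where
  "NEq a b \<equiv> Conj (Neg (NLess a b)) (Neg (NLess b a))"

text \<open>
  Memory layout, with \<open>m = 2n\<close>: \<open>X\<close> the current base, a pair of sets of which the second one is
  complemented if \<open>F\<close>, the flag for \<open>q \<le> 0\<close>, is set; \<open>M\<close> the mates,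
  \<open>p\<close> the potential, \<open>Q\<close> the penalties already taken into account, \<open>d\<close>, \<open>P\<close> and \<open>D\<close> the distances,
  parents and ranks of Dijkstra's algorithm, \<open>e\<close> the bound on the distances and then the length of
  the augmenting path, \<open>y\<close> the value of the current base.  In \<open>P\<close>, \<open>s\<close>, \<open>t\<close> and \<open>w\<close>, a node \<open>x\<close> is
  stored as \<open>x + 1\<close>, and \<open>0\<close> means that there is none.
\<close>

definition eval_body :: prog where
  "eval_body = PIf (Pos (NCell ''X'' (NAdd (nvar ''n'') (nvar ''i''))))
     (PN ''T'' (nvar ''i'') (NSub (NConst 1) (nvar ''F'')))
     (PN ''T'' (nvar ''i'') (nvar ''F'')) ;;
     PIf (Conj (Pos (nvar ''F'')) (Pos (NCell ''X'' (nvar ''i''))))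
     (rset ''a'' (RAdd (rvar ''a'') (RCell ''q'' (nvar ''i'')))) PSkip"

text \<open>All oracle calls happen here. The cell \<open>f\<close> records whether the set in
  \<open>X\<close> is a base, and only in that case does \<open>r\<close> receive its value.\<close>

definition eval_prog :: prog where
  "eval_prog = rset ''a'' (RConst 0) ;;
     PFor ''i'' ''n'' eval_body ;;
     PQuery W1 ''X'' ''f1'' ''r1'' ;; PQuery W2 ''T'' ''f2'' ''r2'' ;;
     PIf (Conj (Pos (nvar ''f1'')) (Pos (nvar ''f2'')))
       (nset ''f'' (NConst 1) ;; rset ''r'' (RAdd (RAdd (rvar ''r1'') (rvar ''r2'')) (rvar ''a'')))
       (nset ''f'' (NConst 0))"

text \<open>The set is restored after the trial, but the entry at \<open>u\<close> comes back as
  \<open>1\<close> whatever nonzero number it was. Specifications therefore speak about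
  \<open>nodes\<close> rather than about the array.\<close>

definition try_prog :: prog where
  "try_prog = PN ''X'' (nvar ''u'') (NConst 0) ;; PN ''X'' (nvar ''v'') (NConst 1) ;; eval_prog ;;
     PN ''X'' (nvar ''v'') (NConst 0) ;; PN ''X'' (nvar ''u'') (NConst 1)"

definition greedy_search_body :: prog where
  "greedy_search_body = PIf (Pos (NCell ''X'' (nvar ''u'')))
     (try_prog ;; PIf (Conj (Pos (nvar ''f'')) (RLess (rvar ''r'') (rvar ''b'')))
     (rset ''b'' (rvar ''r'') ;; nset ''w'' (NAdd (nvar ''u'') (NConst 1))) PSkip) PSkip"

definition greedy_search :: prog where
  "greedy_search = PFor ''u'' ''m'' greedy_search_body"

definition greedy_body :: prog where
  "greedy_body = PIf (Pos (NCell ''X'' (nvar ''v''))) PSkip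
     (eval_prog ;; rset ''b'' (rvar ''r'') ;; nset ''w'' (NConst 0) ;; greedy_search ;;
     PIf (Pos (nvar ''w''))
     (PN ''X'' (nvar ''v'') (NConst 1) ;; PN ''X'' (NSub (nvar ''w'') (NConst 1)) (NConst 0)) PSkip)"

definition greedy_prog :: prog where
  "greedy_prog = PFor ''v'' ''m'' greedy_body"

text \<open>Finished nodes are skipped, and the strict comparison leaves the earlier parent in place
  when there is a tie.\<close>

definition relax_body :: prog where
  "relax_body = PIf (Pos (NCell ''D'' (nvar ''v''))) PSkip (
     nset ''g'' (NConst 0) ;;
     PIf (Pos (NCell ''X'' (nvar ''u'')))
       (PIf (Pos (NCell ''X'' (nvar ''v''))) PSkip
         (try_prog ;; PIf (Pos (nvar ''f''))
           (nset ''g'' (NConst 1) ;; rset ''l'' (RAdd (RSub (RSub (rvar ''r'') (rvar ''y''))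
              (RCell ''p'' (nvar ''v''))) (RCell ''p'' (nvar ''u'')))) PSkip))
       (PIf (Conj (Pos (NCell ''X'' (nvar ''v''))) (NEq (NCell ''M'' (nvar ''u'')) (nvar ''v'')))
         (nset ''g'' (NConst 1) ;;
          rset ''l'' (RSub (RCell ''p'' (nvar ''u'')) (RCell ''p'' (nvar ''v'')))) PSkip) ;;
     PIf (Conj (Pos (nvar ''g''))
         (RLess (RAdd (RCell ''d'' (nvar ''u'')) (rvar ''l'')) (RCell ''d'' (nvar ''v''))))
       (PR ''d'' (nvar ''v'') (RAdd (RCell ''d'' (nvar ''u'')) (rvar ''l'')) ;;
        PN ''P'' (nvar ''v'') (NAdd (nvar ''u'') (NConst 1))) PSkip)"

definition select_body :: prog where
  "select_body = PIf (Pos (NCell ''D'' (nvar ''v''))) PSkip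
     (PIf (Conj (Pos (nvar ''s''))
     (Neg (RLess (RCell ''d'' (nvar ''v'')) (RCell ''d'' (NSub (nvar ''s'') (NConst 1))))))
     PSkip (nset ''s'' (NAdd (nvar ''v'') (NConst 1))))"

definition select_min :: prog where
  "select_min = nset ''s'' (NConst 0) ;; PFor ''v'' ''m'' select_body"

definition dijkstra_body :: prog where
  "dijkstra_body = select_min ;;
     nset ''u'' (NSub (nvar ''s'') (NConst 1)) ;;
     PN ''D'' (nvar ''u'') (NAdd (nvar ''j'') (NConst 1)) ;;
     PFor ''v'' ''m'' relax_body"

definition dijkstra_prog :: prog where
  "dijkstra_prog = PFor ''j'' ''m'' dijkstra_body"

definition init_body :: prog where
  "init_body = PR ''d'' (nvar ''v'') (rvar ''e'') ;;
     PN ''P'' (nvar ''v'') (NConst 0) ;; PN ''D'' (nvar ''v'') (NConst 0)"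

definition init_prog :: prog where
  "init_prog = PFor ''v'' ''m'' init_body ;;
     PR ''d'' (nvar ''z'') (RSub (rvar ''h'') (RCell ''p'' (nvar ''z''))) ;;
     PR ''d'' (NAdd (nvar ''n'') (nvar ''z''))
       (RSub (rvar ''h'') (RCell ''p'' (NAdd (nvar ''n'') (nvar ''z''))))"

text \<open>The strict test leaves \<open>t\<close> at \<open>0\<close> if no path is shorter than
  the cap; flipping then does nothing.\<close>

definition terminal_body :: prog where
  "terminal_body = PIf (Pos (NCell ''X'' (nvar ''v''))) PSkip (
     rset ''l'' (RAdd (RCell ''d'' (nvar ''v'')) (RCell ''p'' (nvar ''v''))) ;;
     PIf (Pos (NCell ''X'' (NCell ''M'' (nvar ''v''))))
     (rset ''l'' (RAdd (rvar ''l'') (RCell ''Q'' (nvar ''v'')))) PSkip ;;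
     PIf (RLess (rvar ''l'') (rvar ''e''))
     (rset ''e'' (rvar ''l'') ;; nset ''t'' (NAdd (nvar ''v'') (NConst 1))) PSkip)"

definition terminal_prog :: prog where
  "terminal_prog = nset ''t'' (NConst 0) ;; PFor ''v'' ''m'' terminal_body"

definition potential_body :: prog where
  "potential_body = PIf (RLess (RCell ''d'' (nvar ''v'')) (rvar ''e''))
     (PR ''p'' (nvar ''v'') (RAdd (RSub (RCell ''p'' (nvar ''v'')) (rvar ''e'')) (RCell ''d'' (nvar ''v''))))
     PSkip"

definition potential_prog :: prog where
  "potential_prog = PFor ''v'' ''m'' potential_body"

definition flip_body :: prog where
  "flip_body = PIf (Pos (nvar ''t''))
     (PIf (Pos (NCell ''X'' (NSub (nvar ''t'') (NConst 1))))
     (PN ''X'' (NSub (nvar ''t'') (NConst 1)) (NConst 0))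
     (PN ''X'' (NSub (nvar ''t'') (NConst 1)) (NConst 1)) ;;
     nset ''t'' (NCell ''P'' (NSub (nvar ''t'') (NConst 1)))) PSkip"

text \<open>A path has at most \<open>2n\<close> nodes, so a bounded loop can follow it; the rounds
  after \<open>t\<close> has become \<open>0\<close> are idle.\<close>

definition flip_prog :: prog where
  "flip_prog = PFor ''v'' ''m'' flip_body"

definition augment_prog :: prog where
  "augment_prog = eval_prog ;; rset ''y'' (rvar ''r'') ;; init_prog ;; dijkstra_prog ;;
     terminal_prog ;; potential_prog ;; flip_prog"

text \<open>The certificate covers the new penalty as it stands unless both copies are in the base
  and the larger of their potentials exceeds \<open>- c\<close>.\<close>

definition phase_prog :: prog where
  "phase_prog =
     PIf (Pos (nvar ''F'')) (rset ''c'' (RSub (RConst 0) (RCell ''q'' (nvar ''z''))))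
       (rset ''c'' (RCell ''q'' (nvar ''z''))) ;;
     PIf (Conj (Pos (NCell ''X'' (nvar ''z''))) (Pos (NCell ''X'' (NAdd (nvar ''n'') (nvar ''z'')))))
       (PIf (RLess (RCell ''p'' (nvar ''z'')) (RCell ''p'' (NAdd (nvar ''n'') (nvar ''z''))))
          (rset ''h'' (RCell ''p'' (NAdd (nvar ''n'') (nvar ''z''))))
          (rset ''h'' (RCell ''p'' (nvar ''z''))) ;;
        rset ''e'' (RAdd (rvar ''c'') (rvar ''h'')) ;;
        PIf (RLess (RConst 0) (rvar ''e'')) augment_prog PSkip)
       PSkip ;;
     PR ''Q'' (nvar ''z'') (rvar ''c'') ;; PR ''Q'' (NAdd (nvar ''n'') (nvar ''z'')) (rvar ''c'')"

definition sign_body :: prog where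
  "sign_body = PIf (RLess (RCell ''q'' (nvar ''i'')) (RConst 0)) (nset ''F'' (NConst 1)) PSkip"

definition setup_body :: prog where
  "setup_body = PN ''M'' (nvar ''i'') (NAdd (nvar ''n'') (nvar ''i'')) ;;
     PN ''M'' (NAdd (nvar ''n'') (nvar ''i'')) (nvar ''i'') ;;
     PN ''X'' (nvar ''i'') (NCell ''B1'' (nvar ''i'')) ;;
     PIf (Pos (NCell ''B2'' (nvar ''i'')))
     (PN ''X'' (NAdd (nvar ''n'') (nvar ''i'')) (NSub (NConst 1) (nvar ''F'')))
     (PN ''X'' (NAdd (nvar ''n'') (nvar ''i'')) (nvar ''F''))"

definition setup_prog :: prog where
  "setup_prog =
     PFor ''i'' ''n'' sign_body ;;
     PFor ''i'' ''n'' setup_body"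

definition output_body :: prog where
  "output_body = PN ''X1'' (nvar ''i'') (NCell ''X'' (nvar ''i'')) ;;
     PIf (Pos (NCell ''X'' (NAdd (nvar ''n'') (nvar ''i''))))
     (PN ''X2'' (nvar ''i'') (NSub (NConst 1) (nvar ''F'')))
     (PN ''X2'' (nvar ''i'') (nvar ''F''))"

definition output_prog :: prog where
  "output_prog = PFor ''i'' ''n'' output_body"

definition solver_prog :: prog where
  "solver_prog = setup_prog ;; greedy_prog ;; PFor ''z'' ''n'' phase_prog ;; output_prog"

section \<open>Syntactic side conditions\<close>

lemma mods_eval_body [simp]:
  "nmods eval_body = {''T''}" "rmods eval_body = {''a''}"
  by (auto simp: eval_body_def)

lemma mods_eval [simp]:
  "nmods eval_prog = {''i'', ''T'', ''f1'', ''f2'', ''f''}" "rmods eval_prog = {''a'', ''r1'', ''r2'', ''r''}"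
  by (auto simp: eval_prog_def)

lemma mods_try [simp]:
  "nmods try_prog = {''i'', ''T'', ''f1'', ''f2'', ''f'', ''X''}"
  "rmods try_prog = {''a'', ''r1'', ''r2'', ''r''}"
  by (auto simp: try_prog_def)

lemma mods_greedy_search_body [simp]:
  "nmods greedy_search_body = {''i'', ''T'', ''f1'', ''f2'', ''f'', ''X'', ''w''}" "rmods greedy_search_body = {''a'', ''r1'', ''r2'', ''r'', ''b''}"
  by (auto simp: greedy_search_body_def)

lemma mods_greedy_search [simp]:
  "nmods greedy_search = {''i'', ''T'', ''f1'', ''f2'', ''f'', ''X'', ''u'', ''w''}"
  "rmods greedy_search = {''a'', ''r1'', ''r2'', ''r'', ''b''}"
  by (auto simp: greedy_search_def)

lemma mods_greedy_body [simp]: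
  "nmods greedy_body = {''i'', ''T'', ''f1'', ''f2'', ''f'', ''X'', ''u'', ''w''}" "rmods greedy_body = {''a'', ''r1'', ''r2'', ''r'', ''b''}"
  by (auto simp: greedy_body_def)

lemma mods_greedy [simp]:
  "nmods greedy_prog = {''i'', ''T'', ''f1'', ''f2'', ''f'', ''X'', ''u'', ''w'', ''v''}"
  "rmods greedy_prog = {''a'', ''r1'', ''r2'', ''r'', ''b''}"
  by (auto simp: greedy_prog_def)

lemma mods_relax_body [simp]:
  "nmods relax_body = {''i'', ''T'', ''f1'', ''f2'', ''f'', ''X'', ''g'', ''P''}"
  "rmods relax_body = {''a'', ''r1'', ''r2'', ''r'', ''l'', ''d''}"
  by (auto simp: relax_body_def)

lemma mods_select_body [simp]:
  "nmods select_body = {''s''}" "rmods select_body = {}"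
  by (auto simp: select_body_def)

lemma mods_select_min [simp]: "nmods select_min = {''s'', ''v''}" "rmods select_min = {}"
  by (auto simp: select_min_def)

lemma mods_dijkstra_body [simp]:
  "nmods dijkstra_body = {''i'', ''T'', ''f1'', ''f2'', ''f'', ''X'', ''g'', ''P'', ''s'', ''v'', ''u'', ''D''}" "rmods dijkstra_body = {''a'', ''r1'', ''r2'', ''r'', ''l'', ''d''}"
  by (auto simp: dijkstra_body_def)

lemma mods_dijkstra [simp]:
  "nmods dijkstra_prog =
    {''i'', ''T'', ''f1'', ''f2'', ''f'', ''X'', ''g'', ''P'', ''s'', ''v'', ''u'', ''D'', ''j''}"
  "rmods dijkstra_prog = {''a'', ''r1'', ''r2'', ''r'', ''l'', ''d''}"
  by (auto simp: dijkstra_prog_def)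

lemma mods_init_body [simp]:
  "nmods init_body = {''P'', ''D''}" "rmods init_body = {''d''}"
  by (auto simp: init_body_def)

lemma mods_init [simp]: "nmods init_prog = {''v'', ''P'', ''D''}" "rmods init_prog = {''d''}"
  by (auto simp: init_prog_def)

lemma mods_terminal_body [simp]:
  "nmods terminal_body = {''t''}" "rmods terminal_body = {''l'', ''e''}"
  by (auto simp: terminal_body_def)

lemma mods_terminal [simp]: "nmods terminal_prog = {''t'', ''v''}" "rmods terminal_prog = {''l'', ''e''}"
  by (auto simp: terminal_prog_def)

lemma mods_potential_body [simp]:
  "nmods potential_body = {}" "rmods potential_body = {''p''}"
  by (auto simp: potential_body_def)

lemma mods_potential [simp]: "nmods potential_prog = {''v''}" "rmods potential_prog = {''p''}"
  by (auto simp: potential_prog_def)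

lemma mods_flip_body [simp]:
  "nmods flip_body = {''X'', ''t''}" "rmods flip_body = {}"
  by (auto simp: flip_body_def)

lemma mods_flip [simp]: "nmods flip_prog = {''v'', ''X'', ''t''}" "rmods flip_prog = {}"
  by (auto simp: flip_prog_def)

lemma mods_augment [simp]:
  "nmods augment_prog = {''i'', ''T'', ''f1'', ''f2'', ''f'', ''X'', ''g'', ''P'', ''s'', ''v'', ''u'',
     ''D'', ''j'', ''t''}"
  "rmods augment_prog = {''a'', ''r1'', ''r2'', ''r'', ''l'', ''d'', ''y'', ''e'', ''p''}"
  by (auto simp: augment_prog_def)

lemma mods_phase [simp]:
  "nmods phase_prog = {''i'', ''T'', ''f1'', ''f2'', ''f'', ''X'', ''g'', ''P'', ''s'', ''v'', ''u'',
     ''D'', ''j'', ''t''}"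
  "rmods phase_prog = {''a'', ''r1'', ''r2'', ''r'', ''l'', ''d'', ''y'', ''e'', ''p'', ''c'', ''h'', ''Q''}"
  by (auto simp: phase_prog_def)

lemma mods_output_body [simp]:
  "nmods output_body = {''X1'', ''X2''}" "rmods output_body = {}"
  by (auto simp: output_body_def)

lemma mods_sign_body [simp]:
  "nmods sign_body = {''F''}" "rmods sign_body = {}"
  by (auto simp: sign_body_def)

lemma mods_setup_body [simp]:
  "nmods setup_body = {''M'', ''X''}" "rmods setup_body = {}"
  by (auto simp: setup_body_def)

lemma mods_solver: "''n'' \<notin> nmods solver_prog" "''m'' \<notin> nmods solver_prog"
  by (auto simp: solver_prog_def setup_prog_def output_prog_def)

lemma well_formed_eval [simp]: "well_formed eval_prog"
  by (simp add: eval_prog_def eval_body_def)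

lemma well_formed_try [simp]: "well_formed try_prog"
  by (simp add: try_prog_def)

lemma well_formed_relax_body [simp]: "well_formed relax_body"
  by (simp add: relax_body_def)

lemma well_formed_solver: "well_formed solver_prog"
  by (simp add: solver_prog_def setup_prog_def output_prog_def greedy_prog_def greedy_search_def
      phase_prog_def augment_prog_def init_prog_def dijkstra_prog_def select_min_def terminal_prog_def
      potential_prog_def flip_prog_def
      greedy_search_body_def greedy_body_def select_body_def dijkstra_body_def init_body_def terminal_body_def potential_body_def flip_body_def output_body_def sign_body_def setup_body_def)

section \<open>Correctness of the program\<close>

definition nodes :: "nat \<Rightarrow> (nat \<Rightarrow> nat) \<Rightarrow> nat set" where
  "nodes n a = {x. x < 2 * n \<and> a x \<noteq> 0}"

lemma nodes_iff [simp]: "x \<in> nodes n a \<longleftrightarrow> x < 2 * n \<and> a x \<noteq> 0"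
  by (simp add: nodes_def)

lemma nodes_upd [simp]:
  "nodes n (a(x := k)) = (if k = 0 then nodes n a - {x} else if x < 2 * n then insert x (nodes n a) else nodes n a)"
  by (auto simp: nodes_def)

text \<open>\<open>eval_spec\<close> is all that the algorithm knows about the oracles.
  \<open>ctx\<close> gathers the data that stay fixed once the setup is done.\<close>

locale solver = pair_problem n \<B> f
  for n :: nat and \<B> :: "nat set set" and f :: "nat set \<Rightarrow> real" +
  fixes orc :: "fun_id \<Rightarrow> (nat \<Rightarrow> nat) \<Rightarrow> ereal" and fl :: bool and qv :: "nat \<Rightarrow> real"
    and ctx :: "state \<Rightarrow> bool"
  defines "ctx \<equiv> \<lambda>s. fst s ''n'' 0 = n \<and> fst s ''m'' 0 = 2 * n \<and> fst s ''F'' 0 = of_bool fl \<and>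
      (\<forall>i<n. snd s ''q'' i = qv i) \<and> (\<forall>x<2 * n. fst s ''M'' x = mate n x)"
  assumes eval_spec: "ctx s \<Longrightarrow>
      (0 < fst (den orc eval_prog s) ''f'' 0 \<longleftrightarrow> nodes n (fst s ''X'') \<in> \<B>) \<and>
      (nodes n (fst s ''X'') \<in> \<B> \<longrightarrow> snd (den orc eval_prog s) ''r'' 0 = f (nodes n (fst s ''X'')))"
begin

lemma ctx_den:
  assumes "ctx s" "nmods c \<inter> {''n'', ''m'', ''F'', ''M''} = {}" "''q'' \<notin> rmods c"
  shows "ctx (den orc c s)"
proof -
  have "fst (den orc c s) x = fst s x" if "x \<in> {''n'', ''m'', ''F'', ''M''}" for x
    using assms(2) that by (intro den_frame_nat) blast
  then show ?thesis using assms(1) den_frame_real[OF assms(3)] by (simp add: ctx_def)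
qed

section \<open>Trial swaps and the greedy algorithm\<close>

lemma try_spec:
  assumes ctx: "ctx s" and A: "A = nodes n (fst s ''X'')"
    and u: "u = fst s ''u'' 0" "u \<in> A" and v: "v = fst s ''v'' 0" "v < 2 * n" "v \<notin> A"
  shows "nodes n (fst (den orc try_prog s) ''X'') = A"
    and "0 < fst (den orc try_prog s) ''f'' 0 \<longleftrightarrow> insert v (A - {u}) \<in> \<B>"
    and "insert v (A - {u}) \<in> \<B> \<Longrightarrow> snd (den orc try_prog s) ''r'' 0 = f (insert v (A - {u}))"
proof -
  define s1 where "s1 = den orc (PN ''X'' (nvar ''u'') (NConst 0) ;; PN ''X'' (nvar ''v'') (NConst 1)) s"
  define s2 where "s2 = den orc eval_prog s1"
  have s: "den orc try_prog s =
      den orc (PN ''X'' (nvar ''v'') (NConst 0) ;; PN ''X'' (nvar ''u'') (NConst 1)) s2"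
    by (simp add: try_prog_def s1_def s2_def)
  have "ctx s1" unfolding s1_def by (rule ctx_den[OF ctx]) auto
  note e = eval_spec[OF this, folded s2_def]
  have X1: "nodes n (fst s1 ''X'') = insert v (A - {u})"
    using u v A by (simp add: s1_def upd_def)
  have X2: "fst s2 ''X'' = fst s1 ''X''" "fst s2 ''u'' = fst s1 ''u''" "fst s2 ''v'' = fst s1 ''v''"
    by (simp_all add: s2_def den_frame_nat)
  have uv: "fst s1 ''u'' 0 = u" "fst s1 ''v'' 0 = v" using u v by (simp_all add: s1_def upd_def)
  have "nodes n (fst (den orc try_prog s) ''X'') = insert u (insert v (A - {u}) - {v})"
    using u A X1 X2 uv by (simp add: s upd_def)
  then show "nodes n (fst (den orc try_prog s) ''X'') = A" using u v by auto
  show "0 < fst (den orc try_prog s) ''f'' 0 \<longleftrightarrow> insert v (A - {u}) \<in> \<B>"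
    using e X1 by (simp add: s upd_def)
  show "insert v (A - {u}) \<in> \<B> \<Longrightarrow> snd (den orc try_prog s) ''r'' 0 = f (insert v (A - {u}))"
    using e X1 by (simp add: s upd_def)
qed

lemma greedy_search_spec:
  assumes ctx: "ctx s" and A: "A = nodes n (fst s ''X'')" and v: "v = fst s ''v'' 0" "v < 2 * n" "v \<notin> A"
    and w: "fst s ''w'' 0 = 0" and b: "snd s ''b'' 0 = f A"
    and s': "s' = den orc greedy_search s"
  shows "nodes n (fst s' ''X'') = A" "snd s' ''b'' 0 \<le> f A"
    "\<And>u. u \<in> A \<Longrightarrow> insert v (A - {u}) \<in> \<B> \<Longrightarrow> snd s' ''b'' 0 \<le> f (insert v (A - {u}))"
    "fst s' ''w'' 0 = 0 \<Longrightarrow> snd s' ''b'' 0 = f A"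
    "\<And>u. fst s' ''w'' 0 = Suc u \<Longrightarrow> u \<in> A \<and> insert v (A - {u}) \<in> \<B> \<and> snd s' ''b'' 0 = f (insert v (A - {u}))"
proof -
  define I where "I = (\<lambda>k (s' :: state). nodes n (fst s' ''X'') = A \<and> snd s' ''b'' 0 \<le> f A \<and>
    (\<forall>u<k. u \<in> A \<longrightarrow> insert v (A - {u}) \<in> \<B> \<longrightarrow> snd s' ''b'' 0 \<le> f (insert v (A - {u}))) \<and>
    (fst s' ''w'' 0 = 0 \<longrightarrow> snd s' ''b'' 0 = f A) \<and>
    (\<forall>u. fst s' ''w'' 0 = Suc u \<longrightarrow> u \<in> A \<and> insert v (A - {u}) \<in> \<B> \<and>
        snd s' ''b'' 0 = f (insert v (A - {u}))))"
  have "I (fst s ''m'' 0) (den orc greedy_search s)"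
    unfolding greedy_search_def
  proof (rule den_For_frame_rule)
    show "I 0 (upd (fst s) ''u'' 0 0, snd s)" using A w b by (simp add: I_def upd_def)
  next
    fix k t
    assume k: "k < fst s ''m'' 0" and I: "I k t" and u: "fst t ''u'' 0 = k"
      and fr: "\<And>x. x \<notin> insert ''u'' (nmods greedy_search_body) \<Longrightarrow> fst t x = fst s x"
      and fr': "\<And>x. x \<notin> rmods greedy_search_body \<Longrightarrow> snd t x = snd s x"
    have k2: "k < 2 * n" using k ctx by (simp add: ctx_def)
    have X: "nodes n (fst t ''X'') = A" using I by (simp add: I_def)
    have kA: "0 < fst t ''X'' k \<longleftrightarrow> k \<in> A" using X k2 by auto
    have ctx': "ctx t" using ctx fr fr' by (simp add: ctx_def)
    have v': "v = fst t ''v'' 0" using v fr by simp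
    define t' where "t' = den orc try_prog t"
    have t': "fst t' ''w'' = fst t ''w''" "snd t' ''b'' = snd t ''b''" "fst t' ''u'' = fst t ''u''"
      by (simp_all add: t'_def den_frame_nat den_frame_real)
    show "I (Suc k) (upd (fst (den orc greedy_search_body t)) ''u'' 0 (Suc k),
        snd (den orc greedy_search_body t))"
    proof (cases "k \<in> A")
      case False
      then show ?thesis using I kA u by (auto simp: I_def upd_def less_Suc_eq greedy_search_body_def)
    next
      case True
      note ts = try_spec[OF ctx' X[symmetric] u[symmetric] True v' v(2,3), folded t'_def]
      show ?thesis using I kA u True t' ts
        by (auto simp: I_def upd_def less_Suc_eq greedy_search_body_def t'_def[symmetric])
    qed
  qed
  then have I: "I (2 * n) s'" using ctx s' by (simp add: ctx_def)
  have "u \<in> A \<Longrightarrow> u < 2 * n" for u using A by simp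
  then show "nodes n (fst s' ''X'') = A" "snd s' ''b'' 0 \<le> f A"
    "\<And>u. u \<in> A \<Longrightarrow> insert v (A - {u}) \<in> \<B> \<Longrightarrow> snd s' ''b'' 0 \<le> f (insert v (A - {u}))"
    "fst s' ''w'' 0 = 0 \<Longrightarrow> snd s' ''b'' 0 = f A"
    "\<And>u. fst s' ''w'' 0 = Suc u \<Longrightarrow> u \<in> A \<and> insert v (A - {u}) \<in> \<B> \<and> snd s' ''b'' 0 = f (insert v (A - {u}))"
    using I unfolding I_def by blast+
qed

lemma greedy_spec:
  assumes ctx: "ctx s" and A: "nodes n (fst s ''X'') \<in> \<B>"
  defines "A' \<equiv> nodes n (fst (den orc greedy_prog s) ''X'')"
  shows "A' \<in> \<B>" "Y \<in> \<B> \<Longrightarrow> f A' \<le> f Y"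
proof -
  define A0 where "A0 = nodes n (fst s ''X'')"
  define I where "I = (\<lambda>k (s' :: state). nodes n (fst s' ''X'') \<in> \<B> \<and> nodes n (fst s' ''X'') \<subseteq> A0 \<union> {..<k} \<and>
    (\<forall>Y\<in>\<B>. Y \<subseteq> A0 \<union> {..<k} \<longrightarrow> f (nodes n (fst s' ''X'')) \<le> f Y))"
  have "I (fst s ''m'' 0) (den orc greedy_prog s)"
    unfolding greedy_prog_def
  proof (rule den_For_frame_rule)
    \<comment> \<open>By exchange, no base is properly contained in another, so \<open>A0\<close> is
      the only base inside \<open>A0\<close>.\<close>
    have "f A0 \<le> f Y" if "Y \<in> \<B>" "Y \<subseteq> A0" for Y
    proof -
      have "Y = A0" using exchange[OF A[folded A0_def] that(1)] that(2) by blast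
      then show ?thesis by simp
    qed
    then show "I 0 (upd (fst s) ''v'' 0 0, snd s)" using A by (simp add: I_def upd_def A0_def)
  next
    fix k t
    assume k: "k < fst s ''m'' 0" and I: "I k t" and v: "fst t ''v'' 0 = k"
      and fr: "\<And>x. x \<notin> insert ''v'' (nmods greedy_body) \<Longrightarrow> fst t x = fst s x"
      and fr': "\<And>x. x \<notin> rmods greedy_body \<Longrightarrow> snd t x = snd s x"
    define B where "B = nodes n (fst t ''X'')"
    have k2: "k < 2 * n" using k ctx by (simp add: ctx_def)
    have kB: "0 < fst t ''X'' k \<longleftrightarrow> k \<in> B" using k2 by (simp add: B_def)
    have ctx': "ctx t" using ctx fr fr' by (simp add: ctx_def)
    have B: "B \<in> \<B>" "B \<subseteq> A0 \<union> {..<k}" "\<And>Y. Y \<in> \<B> \<Longrightarrow> Y \<subseteq> A0 \<union> {..<k} \<Longrightarrow> f B \<le> f Y"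
      using I by (auto simp: I_def B_def)
    have Suck: "A0 \<union> {..<Suc k} = insert k (A0 \<union> {..<k})" by auto
    show "I (Suc k) (upd (fst (den orc greedy_body t)) ''v'' 0 (Suc k), snd (den orc greedy_body t))"
    proof (cases "k \<in> B")
      case True
      \<comment> \<open>A member of the current base was available before, so this round makes no
        new element available.\<close>
      then have "A0 \<union> {..<Suc k} = A0 \<union> {..<k}" using B(2) Suck by auto
      then show ?thesis using I kB v True by (auto simp: I_def upd_def greedy_body_def)
    next
      case False
      define t1 where "t1 = den orc (eval_prog ;; rset ''b'' (rvar ''r'') ;; nset ''w'' (NConst 0)) t"
      have ctx1: "ctx t1" unfolding t1_def by (rule ctx_den[OF ctx']) auto
      have t1: "nodes n (fst t1 ''X'') = B" "fst t1 ''v'' 0 = k" "fst t1 ''w'' 0 = 0" "snd t1 ''b'' 0 = f B"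
        using eval_spec[OF ctx'] B(1) v by (simp_all add: t1_def B_def upd_def den_frame_nat den_frame_real)
      define t2 where "t2 = den orc greedy_search t1"
      note gs = greedy_search_spec[OF ctx1 t1(1)[symmetric] t1(2)[symmetric] k2 False t1(3,4) t2_def]
      have t2v: "fst t2 ''v'' 0 = k" using t1 by (simp add: t2_def den_frame_nat)
      define C where "C = nodes n (fst (den orc greedy_body t) ''X'')"
      have body: "den orc greedy_body t = den orc (PIf (Pos (nvar ''w''))
        (PN ''X'' (nvar ''v'') (NConst 1) ;; PN ''X'' (NSub (nvar ''w'') (NConst 1)) (NConst 0)) PSkip) t2"
        using kB v False by (simp add: greedy_body_def t1_def t2_def)
      have C: "C \<in> \<B> \<and> f C = snd t2 ''b'' 0 \<and> C \<subseteq> insert k B"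
      proof (cases "fst t2 ''w'' 0")
        case 0
        then show ?thesis using gs(1,4) B(1) by (auto simp: C_def body)
      next
        case (Suc u)
        note u = gs(5)[OF this]
        have "C = insert k B - {u}" using u gs(1) t2v k2 Suc by (simp add: C_def body upd_def)
        then have "C = insert k (B - {u})" using u False by auto
        then show ?thesis using u by auto
      qed
      have "f C \<le> f Y" if Y: "Y \<in> \<B>" "Y \<subseteq> A0 \<union> {..<Suc k}" for Y
      proof (cases "k \<in> Y")
        case True
        obtain u where "u \<in> B" "insert k (B - {u}) \<in> \<B>" "f (insert k (B - {u})) \<le> f Y"
          using minimizer_extend[OF B Y(1) _ True False] Y(2) Suck by auto
        then show ?thesis using gs(3)[of u] C by linarith
      next
        case False
        then have "Y \<subseteq> A0 \<union> {..<k}" using Y(2) Suck by auto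
        then show ?thesis using B(3)[OF Y(1)] gs(2) C by linarith
      qed
      moreover have "C \<subseteq> A0 \<union> {..<Suc k}" using C B(2) Suck by blast
      ultimately show ?thesis using C by (simp add: I_def upd_def C_def)
    qed
  qed
  then have "I (2 * n) (den orc greedy_prog s)" using ctx by (simp add: ctx_def)
  then show "A' \<in> \<B>" "Y \<in> \<B> \<Longrightarrow> f A' \<le> f Y"
    using bases_subset[of Y] unfolding I_def A'_def by blast+
qed

section \<open>Shortest paths\<close>

definition relaxes :: "state \<Rightarrow> nat \<Rightarrow> nat \<Rightarrow> bool" where
  "relaxes s u v \<longleftrightarrow> fst s ''D'' v = 0 \<and> arc n \<B> (nodes n (fst s ''X'')) u v \<and>
     snd s ''d'' u + arc_length f (nodes n (fst s ''X'')) (snd s ''p'') u v < snd s ''d'' v"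

lemma relax_body_spec:
  assumes ctx: "ctx s" and A: "A = nodes n (fst s ''X'')" and u: "u = fst s ''u'' 0" "u < 2 * n"
    and v: "v = fst s ''v'' 0" "v < 2 * n" and y: "snd s ''y'' 0 = f A"
    and s': "s' = den orc relax_body s"
  shows "nodes n (fst s' ''X'') = A"
    "fst s' ''P'' = (if relaxes s u v then (fst s ''P'')(v := Suc u) else fst s ''P'')"
    "snd s' ''d'' = (if relaxes s u v
       then (snd s ''d'')(v := snd s ''d'' u + arc_length f A (snd s ''p'') u v) else snd s ''d'')"
proof -
  have uA: "0 < fst s ''X'' u \<longleftrightarrow> u \<in> A" and vA: "0 < fst s ''X'' v \<longleftrightarrow> v \<in> A" using u v A by auto
  have M: "fst s ''M'' u = mate n u" using ctx u by (simp add: ctx_def)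
  have "nodes n (fst s' ''X'') = A \<and>
    fst s' ''P'' = (if relaxes s u v then (fst s ''P'')(v := Suc u) else fst s ''P'') \<and>
    snd s' ''d'' = (if relaxes s u v
       then (snd s ''d'')(v := snd s ''d'' u + arc_length f A (snd s ''p'') u v) else snd s ''d'')"
  proof (cases "fst s ''D'' v = 0")
    case False
    then show ?thesis using v A by (simp add: s' relax_body_def relaxes_def)
  next
    case D: True
    define s1 where "s1 = den orc (nset ''g'' (NConst 0)) s"
    have s1: "ctx s1" unfolding s1_def by (rule ctx_den[OF ctx]) auto
    have e1: "fst s1 = (fst s)(''g'' := (fst s ''g'')(0 := 0))" "snd s1 = snd s" by (simp_all add: s1_def upd_def)
    show ?thesis
    proof (cases "u \<in> A")
      case True
      show ?thesis
      proof (cases "v \<in> A")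
        case vT: True
        then show ?thesis using D uA vA u v True A
          by (auto simp: s' relax_body_def relaxes_def upd_def arc_def)
      next
        case False
        define t where "t = den orc try_prog s1"
        have A1: "A = nodes n (fst s1 ''X'')" "u = fst s1 ''u'' 0" "v = fst s1 ''v'' 0"
          using A u v e1 by simp_all
        note ts = try_spec[OF s1 A1(1,2) True A1(3) v(2) False, folded t_def]
        have tf: "fst t ''u'' 0 = u" "fst t ''v'' 0 = v" "fst t ''g'' 0 = 0" "fst t ''P'' = fst s ''P''"
          "snd t ''d'' = snd s ''d''" "snd t ''p'' = snd s ''p''" "snd t ''y'' = snd s ''y''"
          using e1 u v by (simp_all add: t_def den_frame_nat den_frame_real)
        have body: "s' = den orc (PIf (Pos (nvar ''f''))
           (nset ''g'' (NConst 1) ;; rset ''l'' (RAdd (RSub (RSub (rvar ''r'') (rvar ''y''))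
              (RCell ''p'' (nvar ''v''))) (RCell ''p'' (nvar ''u'')))) PSkip ;;
          PIf (Conj (Pos (nvar ''g''))
         (RLess (RAdd (RCell ''d'' (nvar ''u'')) (rvar ''l'')) (RCell ''d'' (nvar ''v''))))
       (PR ''d'' (nvar ''v'') (RAdd (RCell ''d'' (nvar ''u'')) (rvar ''l'')) ;;
        PN ''P'' (nvar ''v'') (NAdd (nvar ''u'') (NConst 1))) PSkip) t"
        proof -
          have "0 < fst s1 ''X'' u" "\<not> 0 < fst s1 ''X'' v" "fst s1 ''u'' 0 = u" "fst s1 ''v'' 0 = v"
            "\<not> 0 < fst s ''D'' v" "fst s ''v'' 0 = v"
            using uA vA True False e1 u v D by simp_all
          then show ?thesis by (simp add: s' relax_body_def t_def s1_def del: den.simps(2) not_gr_zero)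
        qed
        have ar: "arc n \<B> A u v \<longleftrightarrow> insert v (A - {u}) \<in> \<B>" using True False by (simp add: arc_def)
        have al: "arc_length f A (snd s ''p'') u v = f (insert v (A - {u})) - f A - snd s ''p'' v + snd s ''p'' u"
          using True by (simp add: arc_length_def)
        show ?thesis
        proof (cases "insert v (A - {u}) \<in> \<B>")
          case True
          then have "0 < fst t ''f'' 0" "snd t ''r'' 0 = f (insert v (A - {u}))" using ts by auto
          then show ?thesis using True ts(1) tf y D unfolding body relaxes_def A[symmetric] ar al
            by (simp add: upd_def)
        next
          case False
          then have "\<not> 0 < fst t ''f'' 0" using ts by auto
          then show ?thesis using False ts(1) tf D unfolding body relaxes_def A[symmetric] ar
            by (simp add: upd_def)
        qed
      qed
    next
      case False
      have ar: "arc n \<B> A u v \<longleftrightarrow> v \<in> A \<and> mate n u = v" using False by (auto simp: arc_def)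
      have al: "arc_length f A (snd s ''p'') u v = snd s ''p'' u - snd s ''p'' v"
        using False by (simp add: arc_length_def)
      have "\<not> 0 < fst s ''X'' u" using uA False by simp
      moreover have "fst s ''M'' u < v \<or> v < fst s ''M'' u" if "mate n u \<noteq> v" using that M by auto
      ultimately show ?thesis using D u(1)[symmetric] v(1)[symmetric] M
        unfolding s' relaxes_def A[symmetric] ar al vA[symmetric]
        by (cases "0 < fst s ''X'' v"; cases "mate n u = v") (auto simp add: relax_body_def upd_def A[symmetric])
    qed
  qed
  then show "nodes n (fst s' ''X'') = A"
    "fst s' ''P'' = (if relaxes s u v then (fst s ''P'')(v := Suc u) else fst s ''P'')"
    "snd s' ''d'' = (if relaxes s u v
       then (snd s ''d'')(v := snd s ''d'' u + arc_length f A (snd s ''p'') u v) else snd s ''d'')"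
    by blast+
qed


text \<open>The scan acts as if all arcs out of \<open>u\<close> were relaxed at once:
  \<open>u\<close> is already finished, so its distance stays fixed, and each round touches only the
  entries of its own \<open>v\<close>.\<close>

lemma relax_spec:
  assumes ctx: "ctx s" and A: "A = nodes n (fst s ''X'')" and u: "u = fst s ''u'' 0" "u < 2 * n"
    and y: "snd s ''y'' 0 = f A" and D: "fst s ''D'' u \<noteq> 0"
    and s': "s' = den orc (PFor ''v'' ''m'' relax_body) s"
  shows "nodes n (fst s' ''X'') = A"
    "\<And>v. v < 2 * n \<Longrightarrow> fst s' ''P'' v = (if relaxes s u v then Suc u else fst s ''P'' v)"
    "\<And>v. v < 2 * n \<Longrightarrow> snd s' ''d'' v = (if relaxes s u v
       then snd s ''d'' u + arc_length f A (snd s ''p'') u v else snd s ''d'' v)"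
proof -
  define I where "I = (\<lambda>k (t :: state). nodes n (fst t ''X'') = A \<and>
    (\<forall>v. fst t ''P'' v = (if v < k \<and> relaxes s u v then Suc u else fst s ''P'' v)) \<and>
    (\<forall>v. snd t ''d'' v = (if v < k \<and> relaxes s u v
       then snd s ''d'' u + arc_length f A (snd s ''p'') u v else snd s ''d'' v)))"
  have "I (fst s ''m'' 0) (den orc (PFor ''v'' ''m'' relax_body) s)"
  proof (rule den_For_frame_rule)
    show "I 0 (upd (fst s) ''v'' 0 0, snd s)" using A by (simp add: I_def upd_def)
  next
    fix k t
    assume k: "k < fst s ''m'' 0" and I: "I k t" and v: "fst t ''v'' 0 = k"
      and fr: "\<And>x. x \<notin> insert ''v'' (nmods relax_body) \<Longrightarrow> fst t x = fst s x"
      and fr': "\<And>x. x \<notin> rmods relax_body \<Longrightarrow> snd t x = snd s x"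
    have k2: "k < 2 * n" using k ctx by (simp add: ctx_def)
    have ctx': "ctx t" using ctx fr fr' by (simp add: ctx_def)
    have t: "A = nodes n (fst t ''X'')" "u = fst t ''u'' 0" "snd t ''y'' 0 = f A"
      "fst t ''D'' = fst s ''D''" "snd t ''p'' = snd s ''p''" "snd t ''d'' k = snd s ''d'' k"
      "snd t ''d'' u = snd s ''d'' u"
      using I u y D fr fr' by (auto simp: I_def relaxes_def)
    have rel: "relaxes t u k \<longleftrightarrow> relaxes s u k"
      unfolding relaxes_def t(1)[symmetric] A[symmetric] t(4-7) by simp
    show "I (Suc k) (upd (fst (den orc relax_body t)) ''v'' 0 (Suc k), snd (den orc relax_body t))"
      using relax_body_spec[OF ctx' t(1,2) u(2) v[symmetric] k2 t(3) refl, unfolded rel t(5,7)] I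
      by (simp add: I_def upd_def less_Suc_eq)
  qed
  then have "I (2 * n) s'" using ctx s' by (simp add: ctx_def)
  then show "nodes n (fst s' ''X'') = A"
    "\<And>v. v < 2 * n \<Longrightarrow> fst s' ''P'' v = (if relaxes s u v then Suc u else fst s ''P'' v)"
    "\<And>v. v < 2 * n \<Longrightarrow> snd s' ''d'' v = (if relaxes s u v
       then snd s ''d'' u + arc_length f A (snd s ''p'') u v else snd s ''d'' v)"
    by (simp_all add: I_def)
qed

lemma select_min_spec:
  assumes ctx: "ctx s" and ex: "x < 2 * n" "fst s ''D'' x = 0"
    and s': "s' = den orc select_min s"
  shows "\<exists>u<2 * n. fst s' ''s'' 0 = Suc u \<and> fst s ''D'' u = 0 \<and>
    (\<forall>y<2 * n. fst s ''D'' y = 0 \<longrightarrow> snd s ''d'' u \<le> snd s ''d'' y)"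
proof -
  define s0 where "s0 = den orc (nset ''s'' (NConst 0)) s"
  have s0: "fst s0 ''D'' = fst s ''D''" "snd s0 ''d'' = snd s ''d''" "fst s0 ''s'' 0 = 0" "fst s0 ''m'' 0 = 2 * n"
    using ctx by (simp_all add: s0_def upd_def ctx_def)
  define I where "I = (\<lambda>k (t :: state).
    (fst t ''s'' 0 = 0 \<longrightarrow> (\<forall>y<k. fst s ''D'' y \<noteq> 0)) \<and>
    (\<forall>u. fst t ''s'' 0 = Suc u \<longrightarrow> u < 2 * n \<and> fst s ''D'' u = 0 \<and>
      (\<forall>y<k. fst s ''D'' y = 0 \<longrightarrow> snd s ''d'' u \<le> snd s ''d'' y)))"
  have "I (fst s0 ''m'' 0) (den orc (PFor ''v'' ''m'' select_body) s0)"
  proof (rule den_For_frame_rule)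
    show "I 0 (upd (fst s0) ''v'' 0 0, snd s0)" using s0 by (simp add: I_def upd_def)
  next
    fix k t
    assume k: "k < fst s0 ''m'' 0" and I: "I k t" and v: "fst t ''v'' 0 = k"
      and fr: "\<And>x. x \<notin> insert ''v'' (nmods select_body) \<Longrightarrow> fst t x = fst s0 x"
      and fr': "\<And>x. x \<notin> rmods select_body \<Longrightarrow> snd t x = snd s0 x"
    have k2: "k < 2 * n" using k s0 by simp
    have t: "fst t ''D'' = fst s ''D''" "snd t ''d'' = snd s ''d''" using fr fr' s0 by simp_all
    show "I (Suc k) (upd (fst (den orc select_body t)) ''v'' 0 (Suc k), snd (den orc select_body t))"
    proof (cases "fst t ''s'' 0")
      case 0
      then show ?thesis using I k2 v t by (auto simp: I_def upd_def less_Suc_eq select_body_def)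
    next
      case (Suc u)
      then show ?thesis using I k2 v t by (force simp: I_def upd_def less_Suc_eq select_body_def)
    qed
  qed
  then have "I (2 * n) s'" using s0 s' by (simp add: s0_def select_min_def)
  then show ?thesis using ex unfolding I_def by (cases "fst s' ''s'' 0") auto
qed

lemma dijkstra_spec:
  assumes ctx: "ctx s" and A: "A = nodes n (fst s ''X'')" and y: "snd s ''y'' 0 = f A"
    and init: "\<And>x. x < 2 * n \<Longrightarrow> snd s ''d'' x = K x \<and> fst s ''P'' x = 0 \<and> fst s ''D'' x = 0"
    and p: "p = snd s ''p''"
    and nonneg: "\<And>x y. x < 2 * n \<Longrightarrow> y < 2 * n \<Longrightarrow> arc n \<B> A x y \<Longrightarrow> 0 \<le> arc_length f A p x y"
    and s': "s' = den orc dijkstra_prog s"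
  shows "nodes n (fst s' ''X'') = A"
    "shortest_forest (2 * n) (arc n \<B> A) (arc_length f A p) K (snd s' ''d'') (fst s' ''P'') (fst s' ''D'')"
proof -
  define I where "I = (\<lambda>k (t :: state). nodes n (fst t ''X'') = A \<and>
    dijkstra_inv (2 * n) (arc n \<B> A) (arc_length f A p) K k (snd t ''d'') (fst t ''P'') (fst t ''D''))"
  have "I (fst s ''m'' 0) (den orc dijkstra_prog s)"
    unfolding dijkstra_prog_def
  proof (rule den_For_frame_rule)
    show "I 0 (upd (fst s) ''j'' 0 0, snd s)"
      using A dijkstra_init[of "2 * n" "snd s ''d''" K "fst s ''P''" "fst s ''D''"] init
      by (simp add: I_def upd_def)
  next
    fix k t
    assume k: "k < fst s ''m'' 0" and I: "I k t" and j: "fst t ''j'' 0 = k"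
      and fr: "\<And>x. x \<notin> insert ''j'' (nmods dijkstra_body) \<Longrightarrow> fst t x = fst s x"
      and fr': "\<And>x. x \<notin> rmods dijkstra_body \<Longrightarrow> snd t x = snd s x"
    have k2: "k < 2 * n" using k ctx by (simp add: ctx_def)
    have ctx': "ctx t" using ctx fr fr' by (simp add: ctx_def)
    have inv: "dijkstra_inv (2 * n) (arc n \<B> A) (arc_length f A p) K k (snd t ''d'') (fst t ''P'') (fst t ''D'')"
      and tX: "nodes n (fst t ''X'') = A"
      using I by (auto simp: I_def)
    obtain x where x: "x < 2 * n" "fst t ''D'' x = 0" using dijkstra_unfinished[OF inv k2] by blast
    define t1 where "t1 = den orc select_min t"
    obtain u where u: "u < 2 * n" "fst t1 ''s'' 0 = Suc u" "fst t ''D'' u = 0"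
      "\<And>y. y < 2 * n \<Longrightarrow> fst t ''D'' y = 0 \<Longrightarrow> snd t ''d'' u \<le> snd t ''d'' y"
      using select_min_spec[OF ctx' x t1_def] by blast
    have t1: "fst t1 ''X'' = fst t ''X''" "fst t1 ''D'' = fst t ''D''" "fst t1 ''P'' = fst t ''P''"
      "snd t1 ''d'' = snd t ''d''" "snd t1 ''p'' = p" "snd t1 ''y'' = snd s ''y''" "fst t1 ''j'' = fst t ''j''"
      "ctx t1"
      using ctx' fr' p by (simp_all add: t1_def den_frame_nat den_frame_real ctx_den)
    define t2 where "t2 = den orc (nset ''u'' (NSub (nvar ''s'') (NConst 1)) ;;
     PN ''D'' (nvar ''u'') (NAdd (nvar ''j'') (NConst 1))) t1"
    have t2: "ctx t2" unfolding t2_def by (rule ctx_den[OF t1(8)]) auto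
    have t2': "fst t2 ''u'' 0 = u" "fst t2 ''D'' = (fst t ''D'')(u := Suc k)" "A = nodes n (fst t2 ''X'')"
      "fst t2 ''P'' = fst t ''P''" "snd t2 ''d'' = snd t ''d''" "snd t2 ''p'' = p" "snd t2 ''y'' 0 = f A"
      using t1 u j tX y by (simp_all add: t2_def upd_def)
    have Du: "fst t2 ''D'' u \<noteq> 0" using t2' by simp
    define t3 where "t3 = den orc (PFor ''v'' ''m'' relax_body) t2"
    note rs = relax_spec[OF t2 t2'(3) t2'(1)[symmetric] u(1) t2'(7) Du t3_def]
    have t3D: "fst t3 ''D'' = fst t2 ''D''" unfolding t3_def by (rule den_frame_nat) simp
    have rel: "relaxes t2 u v \<longleftrightarrow> fst t3 ''D'' v = 0 \<and> arc n \<B> A u v \<and>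
      snd t ''d'' u + arc_length f A p u v < snd t ''d'' v" for v
      unfolding relaxes_def t2'(3)[symmetric] t2'(5,6) t3D by simp
    have "dijkstra_inv (2 * n) (arc n \<B> A) (arc_length f A p) K (Suc k) (snd t3 ''d'') (fst t3 ''P'') (fst t3 ''D'')"
    proof (rule dijkstra_step[OF inv nonneg u(1,3,4)])
      show "fst t3 ''D'' y = (if y = u then Suc k else fst t ''D'' y)" for y
        by (simp add: t3D t2')
      show "snd t3 ''d'' y = (if fst t3 ''D'' y = 0 \<and> arc n \<B> A u y \<and>
          snd t ''d'' u + arc_length f A p u y < snd t ''d'' y
        then snd t ''d'' u + arc_length f A p u y else snd t ''d'' y)" if "y < 2 * n" for y
        using rs(3)[OF that] unfolding rel t2'(5,6) .
      show "fst t3 ''P'' y = (if fst t3 ''D'' y = 0 \<and> arc n \<B> A u y \<and>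
          snd t ''d'' u + arc_length f A p u y < snd t ''d'' y then Suc u else fst t ''P'' y)"
        if "y < 2 * n" for y
        using rs(2)[OF that] unfolding rel t2'(4) .
    qed
    moreover have "den orc dijkstra_body t = t3"
      by (simp add: dijkstra_body_def t3_def t2_def t1_def)
    ultimately show "I (Suc k) (upd (fst (den orc dijkstra_body t)) ''j'' 0 (Suc k), snd (den orc dijkstra_body t))"
      using rs(1) by (simp add: I_def upd_def)
  qed
  then have I: "I (2 * n) s'" using ctx s' by (simp add: ctx_def)
  then show "nodes n (fst s' ''X'') = A" by (simp add: I_def)
  show "shortest_forest (2 * n) (arc n \<B> A) (arc_length f A p) K (snd s' ''d'') (fst s' ''P'') (fst s' ''D'')"
    using I by (intro dijkstra_finished) (simp add: I_def)
qed

section \<open>Start values, path length, potential and flipping\<close>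

lemma init_spec:
  assumes ctx: "ctx s" and z: "z = fst s ''z'' 0" "z < n" and x: "x < 2 * n"
    and s': "s' = den orc init_prog s"
  shows "snd s' ''d'' x = (if x = z \<or> x = n + z then snd s ''h'' 0 - snd s ''p'' x else snd s ''e'' 0) \<and>
    fst s' ''P'' x = 0 \<and> fst s' ''D'' x = 0"
proof -
  define I where "I = (\<lambda>k (t :: state). \<forall>x<k. snd t ''d'' x = snd s ''e'' 0 \<and> fst t ''P'' x = 0 \<and> fst t ''D'' x = 0)"
  define t where "t = den orc (PFor ''v'' ''m'' init_body) s"
  have "I (fst s ''m'' 0) t"
    unfolding t_def
  proof (rule den_For_frame_rule)
    show "I 0 (upd (fst s) ''v'' 0 0, snd s)" by (simp add: I_def)
  next
    fix k t
    assume I: "I k t" and v: "fst t ''v'' 0 = k"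
      and fr': "\<And>x. x \<notin> rmods init_body \<Longrightarrow> snd t x = snd s x"
    show "I (Suc k) (upd (fst (den orc init_body t)) ''v'' 0 (Suc k), snd (den orc init_body t))"
      using I v fr' by (auto simp: I_def upd_def less_Suc_eq init_body_def)
  qed
  then have I: "I (2 * n) t" using ctx by (simp add: ctx_def)
  have t: "fst t ''z'' 0 = z" "fst t ''n'' 0 = n" "snd t ''h'' = snd s ''h''" "snd t ''p'' = snd s ''p''"
    using z ctx unfolding t_def by (simp_all add: den_frame_nat den_frame_real ctx_def del: den.simps(7))
  have "s' = den orc (PR ''d'' (nvar ''z'') (RSub (rvar ''h'') (RCell ''p'' (nvar ''z''))) ;;
     PR ''d'' (NAdd (nvar ''n'') (nvar ''z''))
       (RSub (rvar ''h'') (RCell ''p'' (NAdd (nvar ''n'') (nvar ''z''))))) t"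
    by (simp add: s' init_prog_def t_def)
  then show ?thesis using I t x z by (auto simp: I_def upd_def)
qed

lemma terminal_spec:
  assumes ctx: "ctx s" and A: "A = nodes n (fst s ''X'')"
    and tau: "\<tau> = (\<lambda>v. snd s ''d'' v + snd s ''p'' v + (if mate n v \<in> A then snd s ''Q'' v else 0))"
    and s': "s' = den orc terminal_prog s"
  shows "snd s' ''e'' 0 \<le> snd s ''e'' 0" "\<And>v. v < 2 * n \<Longrightarrow> v \<notin> A \<Longrightarrow> snd s' ''e'' 0 \<le> \<tau> v"
    "fst s' ''t'' 0 = 0 \<Longrightarrow> snd s' ''e'' 0 = snd s ''e'' 0"
    "\<And>v. fst s' ''t'' 0 = Suc v \<Longrightarrow> v < 2 * n \<and> v \<notin> A \<and> snd s' ''e'' 0 = \<tau> v \<and> snd s' ''e'' 0 < snd s ''e'' 0"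
proof -
  define s0 where "s0 = den orc (nset ''t'' (NConst 0)) s"
  have s0: "ctx s0" unfolding s0_def by (rule ctx_den[OF ctx]) auto
  have s0': "fst s0 ''X'' = fst s ''X''" "snd s0 = snd s" "fst s0 ''t'' 0 = 0" by (simp_all add: s0_def upd_def)
  define I where "I = (\<lambda>k (t :: state). snd t ''e'' 0 \<le> snd s ''e'' 0 \<and>
    (\<forall>v<k. v \<notin> A \<longrightarrow> snd t ''e'' 0 \<le> \<tau> v) \<and> (fst t ''t'' 0 = 0 \<longrightarrow> snd t ''e'' 0 = snd s ''e'' 0) \<and>
    (\<forall>v. fst t ''t'' 0 = Suc v \<longrightarrow> v < 2 * n \<and> v \<notin> A \<and> snd t ''e'' 0 = \<tau> v \<and> snd t ''e'' 0 < snd s ''e'' 0))"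
  have "I (fst s0 ''m'' 0) (den orc (PFor ''v'' ''m'' terminal_body) s0)"
  proof (rule den_For_frame_rule)
    show "I 0 (upd (fst s0) ''v'' 0 0, snd s0)" using s0' by (simp add: I_def upd_def)
  next
    fix k t
    assume k: "k < fst s0 ''m'' 0" and I: "I k t" and v: "fst t ''v'' 0 = k"
      and fr: "\<And>x. x \<notin> insert ''v'' (nmods terminal_body) \<Longrightarrow> fst t x = fst s0 x"
      and fr': "\<And>x. x \<notin> rmods terminal_body \<Longrightarrow> snd t x = snd s0 x"
    have k2: "k < 2 * n" using k s0 by (simp add: ctx_def)
    have M: "fst t ''M'' k = mate n k" using s0 fr k2 by (simp add: ctx_def)
    have t: "fst t ''X'' = fst s ''X''" "snd t ''d'' = snd s ''d''" "snd t ''p'' = snd s ''p''"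
      "snd t ''Q'' = snd s ''Q''" using fr fr' s0' by simp_all
    have kA: "0 < fst s ''X'' k \<longleftrightarrow> k \<in> A" "0 < fst s ''X'' (mate n k) \<longleftrightarrow> mate n k \<in> A"
      using k2 A by (simp_all add: mate_less)
    define t' where "t' = den orc terminal_body t"
    have "fst t' ''t'' 0 = (if k \<notin> A \<and> \<tau> k < snd t ''e'' 0 then Suc k else fst t ''t'' 0) \<and>
       snd t' ''e'' 0 = (if k \<notin> A \<and> \<tau> k < snd t ''e'' 0 then \<tau> k else snd t ''e'' 0)"
      unfolding kA(1)[symmetric] tau kA(2)[symmetric] t'_def
      by (simp add: terminal_body_def upd_def v M t)
    then show "I (Suc k) (upd (fst (den orc terminal_body t)) ''v'' 0 (Suc k), snd (den orc terminal_body t))"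
      unfolding t'_def[symmetric] using I k2 by (auto simp: I_def upd_def less_Suc_eq)
  qed
  then have I: "I (2 * n) s'" using s0 s' by (simp add: ctx_def terminal_prog_def s0_def)
  show "snd s' ''e'' 0 \<le> snd s ''e'' 0" "\<And>v. v < 2 * n \<Longrightarrow> v \<notin> A \<Longrightarrow> snd s' ''e'' 0 \<le> \<tau> v"
    "fst s' ''t'' 0 = 0 \<Longrightarrow> snd s' ''e'' 0 = snd s ''e'' 0"
    "\<And>v. fst s' ''t'' 0 = Suc v \<Longrightarrow> v < 2 * n \<and> v \<notin> A \<and> snd s' ''e'' 0 = \<tau> v \<and> snd s' ''e'' 0 < snd s ''e'' 0"
    using I unfolding I_def by blast+
qed

lemma potential_spec:
  assumes ctx: "ctx s" and x: "x < 2 * n"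
  shows "snd (den orc potential_prog s) ''p'' x = (if snd s ''d'' x < snd s ''e'' 0
    then snd s ''p'' x - snd s ''e'' 0 + snd s ''d'' x else snd s ''p'' x)"
proof -
  define I where "I = (\<lambda>k (t :: state). \<forall>x. snd t ''p'' x = (if x < k \<and> snd s ''d'' x < snd s ''e'' 0
    then snd s ''p'' x - snd s ''e'' 0 + snd s ''d'' x else snd s ''p'' x))"
  have "I (fst s ''m'' 0) (den orc potential_prog s)"
    unfolding potential_prog_def
  proof (rule den_For_frame_rule)
    show "I 0 (upd (fst s) ''v'' 0 0, snd s)" by (simp add: I_def)
  next
    fix k t
    assume I: "I k t" and v: "fst t ''v'' 0 = k"
      and fr': "\<And>x. x \<notin> rmods potential_body \<Longrightarrow> snd t x = snd s x"
    show "I (Suc k) (upd (fst (den orc potential_body t)) ''v'' 0 (Suc k), snd (den orc potential_body t))"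
      using I v fr' by (auto simp: I_def upd_def less_Suc_eq potential_body_def)
  qed
  then show ?thesis using ctx x by (simp add: ctx_def I_def)
qed

text \<open>Since the nodes of the path are distinct, flipping its head and then dropping it
  preserves the symmetric difference of the current set and the remaining path. This is the loop
  invariant.\<close>

lemma flip_spec:
  assumes ctx: "ctx s" and A: "A = nodes n (fst s ''X'')"
    and L: "parent_path (fst s ''P'') (fst s ''t'' 0) L" "distinct L" "set L \<subseteq> {..<2 * n}" "length L \<le> 2 * n"
  shows "nodes n (fst (den orc flip_prog s) ''X'') = (A - set L) \<union> (set L - A)"
proof -
  define I where "I = (\<lambda>k (t :: state). \<exists>K. parent_path (fst s ''P'') (fst t ''t'' 0) K \<and> distinct K \<and>
    set K \<subseteq> {..<2 * n} \<and> length K \<le> 2 * n - k \<and>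
    (nodes n (fst t ''X'') - set K) \<union> (set K - nodes n (fst t ''X'')) = (A - set L) \<union> (set L - A))"
  have "I (fst s ''m'' 0) (den orc flip_prog s)"
    unfolding flip_prog_def
  proof (rule den_For_frame_rule)
    show "I 0 (upd (fst s) ''v'' 0 0, snd s)"
      unfolding I_def using L A by (intro exI[of _ L]) (simp add: upd_def)
  next
    fix k t
    assume I: "I k t" and v: "fst t ''v'' 0 = k"
      and fr: "\<And>x. x \<notin> insert ''v'' (nmods flip_body) \<Longrightarrow> fst t x = fst s x"
    obtain K where K: "parent_path (fst s ''P'') (fst t ''t'' 0) K" "distinct K"
      "set K \<subseteq> {..<2 * n}" "length K \<le> 2 * n - k"
      "(nodes n (fst t ''X'') - set K) \<union> (set K - nodes n (fst t ''X'')) = (A - set L) \<union> (set L - A)"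
      using I unfolding I_def by blast
    show "I (Suc k) (upd (fst (den orc flip_body t)) ''v'' 0 (Suc k), snd (den orc flip_body t))"
    proof (cases "fst t ''t'' 0")
      case 0
      then have "K = []" using K(1) by simp
      then show ?thesis using K 0 unfolding I_def
        by (intro exI[of _ "[]"]) (simp add: flip_body_def upd_def)
    next
      case (Suc x)
      then obtain K' where K': "K = x # K'" "parent_path (fst s ''P'') (fst s ''P'' x) K'"
        using K(1) by (auto simp: parent_path_Suc_iff)
      define t' where "t' = den orc flip_body t"
      have x: "x < 2 * n" using K(3) K'(1) by simp
      have t': "fst t' ''t'' 0 = fst s ''P'' x"
        "nodes n (fst t' ''X'') = (if x \<in> nodes n (fst t ''X'') then nodes n (fst t ''X'') - {x}
           else insert x (nodes n (fst t ''X'')))"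
        using Suc fr x by (auto simp: t'_def flip_body_def upd_def)
      have "(nodes n (fst t' ''X'') - set K') \<union> (set K' - nodes n (fst t' ''X'')) =
        (nodes n (fst t ''X'') - set K) \<union> (set K - nodes n (fst t ''X''))"
        unfolding t'(2) using K'(1) K(2) by auto
      then show ?thesis using K K' t' unfolding I_def t'_def[symmetric]
        by (intro exI[of _ K']) (simp add: upd_def)
    qed
  qed
  then have "I (2 * n) (den orc flip_prog s)" using ctx by (simp add: ctx_def)
  then show ?thesis by (auto simp: I_def)
qed

section \<open>One augmentation and one phase\<close>

lemma augment_spec:
  assumes ctx: "ctx s" and A: "A = nodes n (fst s ''X'')" and z: "z = fst s ''z'' 0" "z < n" "z \<in> A" "n + z \<in> A"
    and pQ: "p = snd s ''p''" "Q = snd s ''Q''"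
    and cert: "certified A p Q" and Q: "\<And>x. x < 2 * n \<Longrightarrow> 0 \<le> Q x \<and> Q (mate n x) = Q x"
    and h: "snd s ''h'' 0 = max (p z) (p (n + z))" and e: "snd s ''e'' 0 = c + max (p z) (p (n + z))"
    and s': "s' = den orc augment_prog s"
  shows "certified (nodes n (fst s' ''X'')) (snd s' ''p'') (Q(z := c, n + z := c))"
proof -
  define m where "m = max (p z) (p (n + z))"
  have base: "A \<in> \<B>" using cert by (simp add: certified_def)
  define s1 where "s1 = den orc (eval_prog ;; rset ''y'' (rvar ''r'')) s"
  have ctx1: "ctx s1" unfolding s1_def by (rule ctx_den[OF ctx]) auto
  have s1: "fst s1 ''X'' = fst s ''X''" "fst s1 ''z'' = fst s ''z''" "snd s1 ''p'' = p" "snd s1 ''Q'' = Q"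
    "snd s1 ''h'' = snd s ''h''" "snd s1 ''e'' = snd s ''e''" "snd s1 ''y'' 0 = f A"
    using eval_spec[OF ctx] base A pQ by (simp_all add: s1_def den_frame_nat den_frame_real upd_def)
  define s2 where "s2 = den orc init_prog s1"
  have ctx2: "ctx s2" unfolding s2_def by (rule ctx_den[OF ctx1]) auto
  have s2: "A = nodes n (fst s2 ''X'')" "snd s2 ''y'' 0 = f A" "p = snd s2 ''p''" "snd s2 ''Q'' = Q"
    "snd s2 ''e'' = snd s ''e''"
    using s1 A by (simp_all add: s2_def den_frame_nat den_frame_real)
  define K where "K = (\<lambda>x. if x = z \<or> x = n + z then m - p x else c + m)"
  have init: "snd s2 ''d'' x = K x \<and> fst s2 ''P'' x = 0 \<and> fst s2 ''D'' x = 0" if "x < 2 * n" for x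
    using init_spec[OF ctx1, of z x s2] that s1 z h e by (simp add: s2_def K_def m_def)
  have nonneg: "0 \<le> arc_length f A p x y" if "x < 2 * n" "arc n \<B> A x y" for x y
  proof (cases "x \<in> A")
    case True
    then have xy: "y \<notin> A" "insert y (A - {x}) \<in> \<B>" using that by (auto simp: arc_def)
    then have "f A - sum p A \<le> f (insert y (A - {x})) - sum p (insert y (A - {x}))"
      using cert by (auto simp: certified_def)
    moreover have "sum p (insert y (A - {x})) = sum p A - p x + p y"
      using finite_base[OF base] True xy by (simp add: sum.insert_if sum_diff1)
    ultimately show ?thesis using True by (simp add: arc_length_def)
  next
    case False
    then show ?thesis using that cert by (auto simp: certified_def pair_optimal_def arc_def arc_length_def)
  qed
  define s3 where "s3 = den orc dijkstra_prog s2"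
  have ctx3: "ctx s3" unfolding s3_def by (rule ctx_den[OF ctx2]) auto
  have ds: "nodes n (fst s3 ''X'') = A" "shortest_forest (2 * n) (arc n \<B> A) (arc_length f A p) K
      (snd s3 ''d'') (fst s3 ''P'') (fst s3 ''D'')"
    using dijkstra_spec[OF ctx2 s2(1,2) init s2(3) nonneg s3_def] by blast+
  have s3: "snd s3 ''p'' = p" "snd s3 ''Q'' = Q" "snd s3 ''e'' 0 = c + m"
    using s2 e by (simp_all add: s3_def den_frame_real m_def)
  define s4 where "s4 = den orc terminal_prog s3"
  have ctx4: "ctx s4" unfolding s4_def by (rule ctx_den[OF ctx3]) auto
  define d where "d = snd s3 ''d''"
  note ts = terminal_spec[OF ctx3 ds(1)[symmetric] refl s4_def, unfolded s3, folded d_def]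
  have s4: "A = nodes n (fst s4 ''X'')" "snd s4 ''p'' = p" "snd s4 ''d'' = d" "fst s4 ''P'' = fst s3 ''P''"
    using s3 ds(1) by (simp_all add: s4_def d_def den_frame_nat den_frame_real)
  define D where "D = snd s4 ''e'' 0"
  define s5 where "s5 = den orc potential_prog s4"
  have ctx5: "ctx s5" unfolding s5_def by (rule ctx_den[OF ctx4]) auto
  have s5: "A = nodes n (fst s5 ''X'')" "fst s5 ''P'' = fst s3 ''P''" "fst s5 ''t'' = fst s4 ''t''"
    using s4 by (simp_all add: s5_def den_frame_nat)
  define p' where "p' = (\<lambda>x. if d x < D then p x - D + d x else p x)"
  have s': "s' = den orc flip_prog s5"
    by (simp add: s' augment_prog_def s5_def s4_def s3_def s2_def s1_def)
  have p': "snd s' ''p'' x = p' x" if "x < 2 * n" for x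
    using potential_spec[OF ctx4 that] s4 by (simp add: s' s5_def p'_def D_def den_frame_real)
  have forest: "shortest_forest (2 * n) (arc n \<B> A) (arc_length f A p) K d (fst s3 ''P'') (fst s3 ''D'')"
    using ds(2) by (simp add: d_def)
  interpret augmentation n \<B> f A p Q z c d "fst s3 ''P''" "fst s3 ''D''" m D p' "Q(z := c, n + z := c)"
    by unfold_locales (use cert z(2-4) Q forest[unfolded K_def m_def] ts(1,2) in \<open>simp_all add: D_def m_def p'_def\<close>)
  show ?thesis
  proof (cases "fst s4 ''t'' 0")
    case 0
    then have "nodes n (fst s' ''X'') = A"
      using flip_spec[OF ctx5 s5(1), of "[]"] by (simp add: s' s5)
    moreover have "D = c + m" using ts(3) 0 by (simp add: D_def)
    ultimately show ?thesis using certified_cong[OF certified_no_path] p' by simp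
  next
    case (Suc y)
    note t = ts(4)[OF Suc]
    obtain L where L: "parent_path (fst s3 ''P'') (Suc y) L" "length L \<le> fst s3 ''D'' y" "distinct L"
      "\<forall>x\<in>set L. x < 2 * n"
      using parent_path_exists[OF forest] t by blast
    have "fst s3 ''D'' y \<le> 2 * n" using forest t unfolding shortest_forest_def by blast
    then have "nodes n (fst s' ''X'') = (A - set L) \<union> (set L - A)"
      using flip_spec[OF ctx5 s5(1), of L] L Suc by (auto simp: s' s5)
    moreover have "certified ((A - set L) \<union> (set L - A)) p' (Q(z := c, n + z := c))"
      using t L(1) by (intro certified_path[of y]) (auto simp: D_def)
    ultimately show ?thesis using certified_cong p' by simp
  qed
qed

definition penalty_inv :: "nat \<Rightarrow> state \<Rightarrow> bool" where
  "penalty_inv k s \<longleftrightarrow> ctx s \<and> certified (nodes n (fst s ''X'')) (snd s ''p'') (snd s ''Q'') \<and>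
     (\<forall>i<n. snd s ''Q'' i = (if i < k then \<bar>qv i\<bar> else 0) \<and> snd s ''Q'' (n + i) = snd s ''Q'' i)"

lemma phase_spec:
  assumes inv: "penalty_inv k s" and z: "fst s ''z'' 0 = k" and k: "k < n"
    and sign: "\<And>i. i < n \<Longrightarrow> if fl then qv i \<le> 0 else 0 \<le> qv i"
  shows "penalty_inv (Suc k) (den orc phase_prog s)"
proof -
  define A p Q c where "A = nodes n (fst s ''X'')" "p = snd s ''p''" "Q = snd s ''Q''" "c = \<bar>qv k\<bar>"
  note defs = A_p_Q_c_def
  have ctx: "ctx s" and cert: "certified A p Q"
    and Qi: "\<And>i. i < n \<Longrightarrow> Q i = (if i < k then \<bar>qv i\<bar> else 0) \<and> Q (n + i) = Q i"
    using inv by (auto simp: penalty_inv_def defs)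
  have Q: "0 \<le> Q x \<and> Q (mate n x) = Q x" if "x < 2 * n" for x
  proof (cases "x < n")
    case True
    then show ?thesis using Qi[OF True] by (simp add: mate_def)
  next
    case False
    then have "x - n < n" "n + (x - n) = x" using that by auto
    then show ?thesis using Qi[of "x - n"] False by (simp add: mate_def)
  qed
  have c0: "0 \<le> c" by (simp add: defs)
  define Q' where "Q' = Q(k := c, n + k := c)"
  define s1 where "s1 = den orc (PIf (Pos (nvar ''F'')) (rset ''c'' (RSub (RConst 0) (RCell ''q'' (nvar ''z''))))
       (rset ''c'' (RCell ''q'' (nvar ''z'')))) s"
  have ctx1: "ctx s1" unfolding s1_def by (rule ctx_den[OF ctx]) auto
  have s1: "A = nodes n (fst s1 ''X'')" "fst s1 ''z'' 0 = k" "snd s1 ''p'' = p" "snd s1 ''Q'' = Q" "snd s1 ''c'' 0 = c"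
    "fst s1 ''n'' 0 = n"
    using z ctx sign[OF k] k by (auto simp: s1_def defs upd_def ctx_def)
  have kA: "0 < fst s1 ''X'' k \<longleftrightarrow> k \<in> A" "0 < fst s1 ''X'' (n + k) \<longleftrightarrow> n + k \<in> A"
    using s1(1) k by auto
  define P where "P = PIf (Conj (Pos (NCell ''X'' (nvar ''z''))) (Pos (NCell ''X'' (NAdd (nvar ''n'') (nvar ''z'')))))
       (PIf (RLess (RCell ''p'' (nvar ''z'')) (RCell ''p'' (NAdd (nvar ''n'') (nvar ''z''))))
          (rset ''h'' (RCell ''p'' (NAdd (nvar ''n'') (nvar ''z''))))
          (rset ''h'' (RCell ''p'' (nvar ''z''))) ;;
        rset ''e'' (RAdd (rvar ''c'') (rvar ''h'')) ;;
        PIf (RLess (RConst 0) (rvar ''e'')) augment_prog PSkip)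
       PSkip"
  define s2 where "s2 = den orc P s1"
  have ctx2: "ctx s2" unfolding s2_def P_def by (rule ctx_den[OF ctx1]) auto
  have s2: "fst s2 ''z'' 0 = k" "fst s2 ''n'' 0 = n" "snd s2 ''Q'' = Q" "snd s2 ''c'' 0 = c"
    using s1 by (simp_all add: s2_def P_def den_frame_nat den_frame_real upd_def)
  have Q'_other: "Q' x = Q x" if "x \<noteq> k" "x \<noteq> n + k" for x using that by (simp add: Q'_def)
  \<comment> \<open>A larger penalty weakens the lower bound on \<open>p\<close>. It strengthens
    only the condition for a pair that is entirely in the base, and in that case
    \<open>p \<le> - c\<close> holds already.\<close>
  have keep: "certified A p Q'" if "\<not> (k \<in> A \<and> n + k \<in> A) \<or> c + max (p k) (p (n + k)) \<le> 0"
    unfolding certified_def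
  proof (intro conjI ballI allI impI)
    show "A \<in> \<B>" "\<And>Y. Y \<in> \<B> \<Longrightarrow> f A - sum p A \<le> f Y - sum p Y" using cert by (auto simp: certified_def)
    fix x assume x: "x < 2 * n"
    have po: "pair_optimal n A p Q x" using cert x by (simp add: certified_def)
    show "pair_optimal n A p Q' x"
    proof (cases "x = k \<or> x = n + k")
      case True
      then have m: "mate n x = n + k \<and> x = k \<or> mate n x = k \<and> x = n + k" using k by (auto simp: mate_def)
      have "Q' x = c" "0 \<le> c" "Q x = 0" using True c0 Qi[OF k] by (auto simp: Q'_def)
      then show ?thesis using po m that by (auto simp: pair_optimal_def)
    next
      case False
      then show ?thesis using po Q'_other[of x] by (simp add: pair_optimal_def)
    qed
  qed
  have "certified (nodes n (fst s2 ''X'')) (snd s2 ''p'') Q'"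
  proof (cases "k \<in> A \<and> n + k \<in> A")
    case False
    then have "s2 = s1" using s1(2,6) kA by (auto simp: s2_def P_def)
    moreover have "certified A p Q'" using keep False by blast
    ultimately show ?thesis using s1(3) s1(1)[symmetric] by simp
  next
    case both: True
    define s3 where "s3 = den orc (PIf (RLess (RCell ''p'' (nvar ''z'')) (RCell ''p'' (NAdd (nvar ''n'') (nvar ''z''))))
          (rset ''h'' (RCell ''p'' (NAdd (nvar ''n'') (nvar ''z''))))
          (rset ''h'' (RCell ''p'' (nvar ''z''))) ;;
        rset ''e'' (RAdd (rvar ''c'') (rvar ''h''))) s1"
    have ctx3: "ctx s3" unfolding s3_def by (rule ctx_den[OF ctx1]) auto
    have s3: "A = nodes n (fst s3 ''X'')" "fst s3 ''z'' 0 = k" "snd s3 ''p'' = p" "snd s3 ''Q'' = Q"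
      "snd s3 ''h'' 0 = max (p k) (p (n + k))" "snd s3 ''e'' 0 = c + max (p k) (p (n + k))"
      using s1 by (auto simp: s3_def upd_def max_def)
    have s23: "s2 = den orc (PIf (RLess (RConst 0) (rvar ''e'')) augment_prog PSkip) s3"
      using s1(2,6) kA both by (simp add: s2_def P_def s3_def)
    show ?thesis
    proof (cases "0 < snd s3 ''e'' 0")
      case False
      then have "s2 = s3" by (simp add: s23)
      moreover have "certified A p Q'" using keep False s3(6) by simp
      ultimately show ?thesis using s3(3) s3(1)[symmetric] by simp
    next
      case True
      then have "s2 = den orc augment_prog s3" by (simp add: s23)
      from augment_spec[OF ctx3 s3(1) s3(2)[symmetric] k _ _ s3(3,4)[symmetric] cert Q s3(5,6) this] both
      show ?thesis by (simp add: Q'_def)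
    qed
  qed
  moreover have "den orc phase_prog s =
     den orc (PR ''Q'' (nvar ''z'') (rvar ''c'') ;; PR ''Q'' (NAdd (nvar ''n'') (nvar ''z'')) (rvar ''c'')) s2"
    by (simp add: phase_prog_def s2_def P_def s1_def)
  then have "fst (den orc phase_prog s) = fst s2" "snd (den orc phase_prog s) = (snd s2)(''Q'' := Q')"
    using s2 by (simp_all add: upd_def Q'_def)
  moreover have "Q' i = (if i < Suc k then \<bar>qv i\<bar> else 0) \<and> Q' (n + i) = Q' i" if "i < n" for i
    using Qi[OF that] k that by (auto simp: Q'_def defs(4))
  ultimately show ?thesis using ctx2 by (simp add: penalty_inv_def ctx_def)
qed

end

section \<open>The reduction\<close>

text \<open>The right-hand side is finite and \<open>-\<infinity>\<close> is excluded, so both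
  values on the left are finite. The exchange thus stays inside the effective domain and can be
  expressed in real numbers.\<close>

lemma valuated_matroid_exchange:
  assumes vm: "valuated_matroid V w" and X: "X \<in> eff_dom V w" and Y: "Y \<in> eff_dom V w" and v: "v \<in> X" "v \<notin> Y"
  shows "\<exists>u. u \<in> Y \<and> u \<notin> X \<and> insert u (X - {v}) \<in> eff_dom V w \<and> insert v (Y - {u}) \<in> eff_dom V w \<and>
    real_of_ereal (w (insert u (X - {v}))) + real_of_ereal (w (insert v (Y - {u})))
      \<le> real_of_ereal (w X) + real_of_ereal (w Y)"
proof -
  obtain u where u: "u \<in> Y" "u \<notin> X" "w (insert u (X - {v})) + w (insert v (Y - {u})) \<le> w X + w Y"
  proof -
    have "v \<in> X - Y" using v by simp
    then obtain u where u: "u \<in> Y - X" "w ((X - {v}) \<union> {u}) + w ((Y \<union> {v}) - {u}) \<le> w X + w Y"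
      using vm X Y unfolding valuated_matroid_def by blast
    moreover have "(Y \<union> {v}) - {u} = insert v (Y - {u})" using u v by auto
    ultimately show ?thesis using that[of u] by simp
  qed
  have sub: "insert u (X - {v}) \<subseteq> V" "insert v (Y - {u}) \<subseteq> V" using u v X Y by (auto simp: eff_dom_def)
  have ninf: "w Z \<noteq> - \<infinity>" if "Z \<subseteq> V" for Z using vm that by (simp add: valuated_matroid_def)
  have XY: "X \<subseteq> V" "Y \<subseteq> V" "w X < \<infinity>" "w Y < \<infinity>" using X Y by (auto simp: eff_dom_def)
  obtain a b where ab: "w X = ereal a" "w Y = ereal b"
    using ninf[OF XY(1)] ninf[OF XY(2)] XY(3,4) by (cases "w X"; cases "w Y") auto
  obtain c d where cd: "w (insert u (X - {v})) = ereal c" "w (insert v (Y - {u})) = ereal d"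
    using ninf[OF sub(1)] ninf[OF sub(2)] u(3) ab
    by (cases "w (insert u (X - {v}))"; cases "w (insert v (Y - {u}))") auto
  show ?thesis using u sub ab cd by (intro exI[of _ u]) (auto simp: eff_dom_def)
qed

locale penalized_instance =
  fixes V :: "'a set" and w1 w2 :: "'a set \<Rightarrow> ereal" and q :: "'a \<Rightarrow> real" and e :: "nat \<Rightarrow> 'a"
    and n :: nat and fl :: bool
  assumes vm1: "valuated_matroid V w1" and vm2: "valuated_matroid V w2"
    and e: "bij_betw e {..<n} V" and fl: "fl \<longleftrightarrow> (\<exists>i<n. q (e i) < 0)"
    and sign: "(\<forall>v\<in>V. q v \<ge> 0) \<or> (\<forall>v\<in>V. q v \<le> 0)"
begin

lemma card_V: "card V = n"
  using bij_betw_same_card[OF e] by simp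

lemma e_in_V: "i < n \<Longrightarrow> e i \<in> V"
  using e by (auto simp: bij_betw_def)

lemma e_eq_iff: "i < n \<Longrightarrow> j < n \<Longrightarrow> e i = e j \<longleftrightarrow> i = j"
  using e by (auto simp: bij_betw_def inj_on_def)

lemma V_cases: "v \<in> V \<Longrightarrow> \<exists>i<n. v = e i"
  using e by (auto simp: bij_betw_def)

lemma set_eqI_V: "A \<subseteq> V \<Longrightarrow> B \<subseteq> V \<Longrightarrow> (\<And>i. i < n \<Longrightarrow> e i \<in> A \<longleftrightarrow> e i \<in> B) \<Longrightarrow> A = B"
  using V_cases by blast

definition S1 :: "nat set \<Rightarrow> 'a set" where "S1 A = e ` {i. i < n \<and> i \<in> A}"
text \<open>Comparing with \<open>fl\<close> complements the second set when the flag is on; the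
  upper half of \<open>A\<close> is then a base of the dual matroid.\<close>

definition S2 :: "nat set \<Rightarrow> 'a set" where "S2 A = e ` {i. i < n \<and> (n + i \<in> A) \<noteq> fl}"
definition \<B> :: "nat set set" where
  "\<B> = {A. A \<subseteq> {..<2 * n} \<and> S1 A \<in> eff_dom V w1 \<and> S2 A \<in> eff_dom V w2}"
definition shift :: "nat set \<Rightarrow> real" where
  "shift A = (\<Sum>i<n. if fl \<and> i \<in> A then q (e i) else 0)"
definition f :: "nat set \<Rightarrow> real" where
  "f A = real_of_ereal (w1 (S1 A)) + real_of_ereal (w2 (S2 A)) + shift A"

lemma S1_iff: "i < n \<Longrightarrow> e i \<in> S1 A \<longleftrightarrow> i \<in> A"
  by (auto simp: S1_def e_eq_iff)

lemma S2_iff: "i < n \<Longrightarrow> e i \<in> S2 A \<longleftrightarrow> (n + i \<in> A) \<noteq> fl"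
  by (auto simp: S2_def e_eq_iff)

lemma S2_iff_flag: "fl \<Longrightarrow> i < n \<Longrightarrow> e i \<in> S2 A \<longleftrightarrow> n + i \<notin> A"
  and S2_iff_noflag: "\<not> fl \<Longrightarrow> i < n \<Longrightarrow> e i \<in> S2 A \<longleftrightarrow> n + i \<in> A"
  using S2_iff[of i A] by blast+

lemma S_subset: "S1 A \<subseteq> V" "S2 A \<subseteq> V"
  using e_in_V by (auto simp: S1_def S2_def)

lemmas S_subsetD = S_subset[THEN subsetD]

lemma shift_exchange:
  assumes "v < n" "v \<in> X" "v \<notin> Y" "u < n" "u \<in> Y" "u \<notin> X"
  shows "shift (insert u (X - {v})) + shift (insert v (Y - {u})) = shift X + shift Y"
  unfolding shift_def sum.distrib[symmetric]
proof -
  define g where "g = (\<lambda>Z i. if fl \<and> i \<in> Z then q (e i) else (0::real))"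
  have "g (insert u (X - {v})) i + g (insert v (Y - {u})) i = g X i + g Y i" for i
    using assms by (auto simp: g_def)
  then show "(\<Sum>i<n. (if fl \<and> i \<in> insert u (X - {v}) then q (e i) else 0) +
      (if fl \<and> i \<in> insert v (Y - {u}) then q (e i) else 0)) =
    (\<Sum>i<n. (if fl \<and> i \<in> X then q (e i) else 0) + (if fl \<and> i \<in> Y then q (e i) else 0))"
    by (simp add: g_def)
qed

lemma S1_exchange_low:
  assumes "u < n" "v < n"
  shows "S1 (insert u (X - {v})) = insert (e u) (S1 X - {e v})"
  using assms by (intro set_eqI_V) (auto simp: S1_iff e_eq_iff e_in_V dest: S_subsetD)

lemma S2_exchange_low:
  assumes "u < n" "v < n"
  shows "S2 (insert u (X - {v})) = S2 X"
  using assms by (intro set_eqI_V) (auto simp: S2_iff dest: S_subsetD)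

lemma S1_exchange_high: "S1 (insert (n + u) (X - {n + v})) = S1 X"
  by (intro set_eqI_V) (auto simp: S1_iff dest: S_subsetD)

lemma shift_high: "shift (insert (n + u) (X - {n + v})) = shift X"
  unfolding shift_def by (intro sum.cong) auto

lemma S2_exchange_high:
  assumes "u < n" "v < n" "n + u \<notin> X" "n + v \<in> X"
  shows "\<not> fl \<Longrightarrow> S2 (insert (n + u) (X - {n + v})) = insert (e u) (S2 X - {e v})"
    and "fl \<Longrightarrow> S2 (insert (n + u) (X - {n + v})) = insert (e v) (S2 X - {e u})"
proof -
  show "S2 (insert (n + u) (X - {n + v})) = insert (e u) (S2 X - {e v})" if *: "\<not> fl"
    using assms by (intro set_eqI_V) (auto simp: S2_iff_noflag[OF *] e_eq_iff e_in_V dest: S_subsetD)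
  show "S2 (insert (n + u) (X - {n + v})) = insert (e v) (S2 X - {e u})" if *: fl
    using assms by (intro set_eqI_V) (auto simp: S2_iff_flag[OF *] e_eq_iff e_in_V dest: S_subsetD)
qed

text \<open>An exchange stays within one half and uses one of the two given functions. In the dual
  case, an element that leaves \<open>X\<close> enters its complement, so the property of
  \<open>w2\<close> is applied with the roles of \<open>X\<close> and \<open>Y\<close>
  interchanged.\<close>

lemma real_valuated_matroid: "real_valuated_matroid {..<2 * n} \<B> f"
proof
  fix X Y v assume X: "X \<in> \<B>" and Y: "Y \<in> \<B>" and v: "v \<in> X" "v \<notin> Y"
  have v2: "v < 2 * n" using X v by (auto simp: \<B>_def)
  have XY: "X \<subseteq> {..<2 * n}" "Y \<subseteq> {..<2 * n}" "S1 X \<in> eff_dom V w1" "S2 X \<in> eff_dom V w2"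
    "S1 Y \<in> eff_dom V w1" "S2 Y \<in> eff_dom V w2" using X Y by (auto simp: \<B>_def)
  show "\<exists>u. u \<in> Y \<and> u \<notin> X \<and> insert u (X - {v}) \<in> \<B> \<and> insert v (Y - {u}) \<in> \<B> \<and>
        f (insert u (X - {v})) + f (insert v (Y - {u})) \<le> f X + f Y"
  proof (cases "v < n")
    case True
    have "e v \<in> S1 X" "e v \<notin> S1 Y" using v True by (simp_all add: S1_iff)
    from valuated_matroid_exchange[OF vm1 XY(3,5) this] obtain b where
      b: "b \<in> S1 Y" "b \<notin> S1 X" "insert b (S1 X - {e v}) \<in> eff_dom V w1"
        "insert (e v) (S1 Y - {b}) \<in> eff_dom V w1"
        "real_of_ereal (w1 (insert b (S1 X - {e v}))) + real_of_ereal (w1 (insert (e v) (S1 Y - {b})))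
          \<le> real_of_ereal (w1 (S1 X)) + real_of_ereal (w1 (S1 Y))" by blast
    obtain u where u: "u < n" "b = e u" "u \<in> Y" "u \<notin> X"
      using b(1,2) V_cases[of b] S_subset S1_iff by blast
    show ?thesis
      using b u True v XY shift_exchange[of v X Y u]
      by (intro exI[of _ u])
        (auto simp: \<B>_def f_def S1_exchange_low S2_exchange_low)
  next
    case False
    define k where "k = v - n"
    have k: "k < n" "v = n + k" using False v2 by (auto simp: k_def)
    show ?thesis
    proof (cases fl)
      case fl: True
      have "e k \<in> S2 Y" "e k \<notin> S2 X" using v k by (simp_all add: S2_iff_flag[OF fl])
      from valuated_matroid_exchange[OF vm2 XY(6,4) this] obtain b where
        b: "b \<in> S2 X" "b \<notin> S2 Y" "insert b (S2 Y - {e k}) \<in> eff_dom V w2"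
          "insert (e k) (S2 X - {b}) \<in> eff_dom V w2"
          "real_of_ereal (w2 (insert b (S2 Y - {e k}))) + real_of_ereal (w2 (insert (e k) (S2 X - {b})))
            \<le> real_of_ereal (w2 (S2 Y)) + real_of_ereal (w2 (S2 X))" by blast
      obtain j where j: "j < n" "b = e j" using b(1) V_cases[of b] S_subset by blast
      then have jXY: "n + j \<in> Y" "n + j \<notin> X" using b(1,2) by (auto simp: S2_iff_flag[OF fl])
      show ?thesis
        using b j jXY k v XY
          S2_exchange_high(2)[of j k X, OF j(1) k(1) jXY(2) v(1)[unfolded k(2)] fl]
          S2_exchange_high(2)[of k j Y, OF k(1) j(1) v(2)[unfolded k(2)] jXY(1) fl]
        by (intro exI[of _ "n + j"]) (auto simp: \<B>_def f_def S1_exchange_high shift_high)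
    next
      case fl: False
      have "e k \<in> S2 X" "e k \<notin> S2 Y" using v k by (simp_all add: S2_iff_noflag[OF fl])
      from valuated_matroid_exchange[OF vm2 XY(4,6) this] obtain b where
        b: "b \<in> S2 Y" "b \<notin> S2 X" "insert b (S2 X - {e k}) \<in> eff_dom V w2"
          "insert (e k) (S2 Y - {b}) \<in> eff_dom V w2"
          "real_of_ereal (w2 (insert b (S2 X - {e k}))) + real_of_ereal (w2 (insert (e k) (S2 Y - {b})))
            \<le> real_of_ereal (w2 (S2 X)) + real_of_ereal (w2 (S2 Y))" by blast
      obtain j where j: "j < n" "b = e j" using b(1) V_cases[of b] S_subset by blast
      then have jXY: "n + j \<in> Y" "n + j \<notin> X" using b(1,2) by (auto simp: S2_iff_noflag[OF fl])
      show ?thesis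
        using b j jXY k v XY
          S2_exchange_high(1)[of j k X, OF j(1) k(1) jXY(2) v(1)[unfolded k(2)] fl]
          S2_exchange_high(1)[of k j Y, OF k(1) j(1) v(2)[unfolded k(2)] jXY(1) fl]
        by (intro exI[of _ "n + j"]) (auto simp: \<B>_def f_def S1_exchange_high shift_high)
    qed
  qed
qed (auto simp: \<B>_def)

section \<open>Oracle access and evaluation of the combined function\<close>

abbreviation orc :: "fun_id \<Rightarrow> (nat \<Rightarrow> nat) \<Rightarrow> ereal" where "orc \<equiv> oracles e V w1 w2"

lemma orc_not_MInf: "orc k x \<noteq> - \<infinity>"
proof -
  have "decode e V x \<subseteq> V" using e_in_V by (auto simp: decode_def card_V)
  then show ?thesis using vm1 vm2 by (cases k) (auto simp: oracles_def valuated_matroid_def)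
qed

definition ctx :: "state \<Rightarrow> bool" where
  "ctx s \<longleftrightarrow> fst s ''n'' 0 = n \<and> fst s ''m'' 0 = 2 * n \<and> fst s ''F'' 0 = of_bool fl \<and>
      (\<forall>i<n. snd s ''q'' i = q (e i)) \<and> (\<forall>x<2 * n. fst s ''M'' x = mate n x)"

lemma eval_correct:
  assumes ctx: "ctx s" and A: "A = nodes n (fst s ''X'')" and s': "s' = den orc eval_prog s"
  shows "0 < fst s' ''f'' 0 \<longleftrightarrow> A \<in> \<B>" "A \<in> \<B> \<Longrightarrow> snd s' ''r'' 0 = f A"
proof -
  define s0 where "s0 = den orc (rset ''a'' (RConst 0)) s"
  have s0: "fst s0 = fst s" "snd s0 ''q'' = snd s ''q''" "snd s0 ''a'' 0 = 0" by (simp_all add: s0_def upd_def)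
  define I where "I = (\<lambda>k (t :: state). (\<forall>i<k. fst t ''T'' i = of_bool ((n + i \<in> A) \<noteq> fl)) \<and>
    snd t ''a'' 0 = (\<Sum>i<k. if fl \<and> i \<in> A then q (e i) else 0))"
  define s1 where "s1 = den orc (PFor ''i'' ''n'' eval_body) s0"
  have "I (fst s0 ''n'' 0) s1"
    unfolding s1_def
  proof (rule den_For_frame_rule)
    show "I 0 (upd (fst s0) ''i'' 0 0, snd s0)" using s0 by (simp add: I_def upd_def)
  next
    fix k t
    assume k: "k < fst s0 ''n'' 0" and I: "I k t" and v: "fst t ''i'' 0 = k"
      and fr: "\<And>x. x \<notin> insert ''i'' (nmods eval_body) \<Longrightarrow> fst t x = fst s0 x"
      and fr': "\<And>x. x \<notin> rmods eval_body \<Longrightarrow> snd t x = snd s0 x"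
    have k2: "k < n" using k s0 ctx by (simp add: ctx_def)
    have t: "fst t ''X'' = fst s ''X''" "fst t ''n'' 0 = n" "fst t ''F'' 0 = of_bool fl" "snd t ''q'' k = q (e k)"
      using fr fr' s0 ctx k2 by (simp_all add: ctx_def)
    have A': "k \<in> A \<longleftrightarrow> fst s ''X'' k \<noteq> 0" "n + k \<in> A \<longleftrightarrow> fst s ''X'' (n + k) \<noteq> 0" using A k2 by auto
    show "I (Suc k) (upd (fst (den orc eval_body t)) ''i'' 0 (Suc k), snd (den orc eval_body t))"
      using I v t A' by (cases fl) (auto simp: I_def upd_def less_Suc_eq eval_body_def)
  qed
  then have I: "I n s1" using s0 ctx by (simp add: ctx_def)
  have X1: "fst s1 ''X'' = fst s ''X''" using s0 unfolding s1_def by (simp add: den_frame_nat del: den.simps(7))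
  have o1: "orc W1 (fst s1 ''X'') = w1 (S1 A)"
    using A X1 by (auto simp: oracles_def decode_def S1_def card_V intro!: arg_cong[of _ _ w1])
  have "{i. i < n \<and> fst s1 ''T'' i \<noteq> 0} = {i. i < n \<and> (n + i \<in> A) \<noteq> fl}"
    using I by (auto simp: I_def)
  then have o2: "orc W2 (fst s1 ''T'') = w2 (S2 A)"
    by (simp add: oracles_def decode_def S2_def card_V)
  have a: "snd s1 ''a'' 0 = shift A" using I by (simp add: I_def shift_def)
  define s2 where "s2 = den orc (PQuery W1 ''X'' ''f1'' ''r1'') s1"
  define s3 where "s3 = den orc (PQuery W2 ''T'' ''f2'' ''r2'') s2"
  have s2: "0 < fst s2 ''f1'' 0 \<longleftrightarrow> w1 (S1 A) \<noteq> \<infinity>" "w1 (S1 A) \<noteq> \<infinity> \<Longrightarrow> snd s2 ''r1'' 0 = real_of_ereal (w1 (S1 A))"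
    "snd s2 ''a'' = snd s1 ''a''" "fst s2 ''T'' = fst s1 ''T''"
    using o1 by (simp_all add: s2_def upd_def)
  have s3: "0 < fst s3 ''f2'' 0 \<longleftrightarrow> w2 (S2 A) \<noteq> \<infinity>" "w2 (S2 A) \<noteq> \<infinity> \<Longrightarrow> snd s3 ''r2'' 0 = real_of_ereal (w2 (S2 A))"
    "snd s3 ''a'' 0 = shift A" "fst s3 ''f1'' = fst s2 ''f1''" "snd s3 ''r1'' = snd s2 ''r1''"
    using o2 s2 a by (simp_all add: s3_def upd_def)
  have s': "s' = den orc (PIf (Conj (Pos (nvar ''f1'')) (Pos (nvar ''f2'')))
       (nset ''f'' (NConst 1) ;; rset ''r'' (RAdd (RAdd (rvar ''r1'') (rvar ''r2'')) (rvar ''a'')))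
       (nset ''f'' (NConst 0))) s3"
    unfolding s' eval_prog_def s3_def s2_def s1_def s0_def by (simp only: den.simps(5))
  have AB: "A \<in> \<B> \<longleftrightarrow> w1 (S1 A) \<noteq> \<infinity> \<and> w2 (S2 A) \<noteq> \<infinity>"
    using S_subset by (auto simp: \<B>_def eff_dom_def A)
  show "0 < fst s' ''f'' 0 \<longleftrightarrow> A \<in> \<B>" using s2 s3 AB by (auto simp: s' upd_def)
  show "snd s' ''r'' 0 = f A" if "A \<in> \<B>" using that s2 s3 AB by (auto simp: s' upd_def f_def)
qed

sublocale solver n \<B> f orc fl "\<lambda>i. q (e i)" ctx
proof -
  interpret real_valuated_matroid "{..<2 * n}" \<B> f by (rule real_valuated_matroid)
  have c: "ctx \<equiv> \<lambda>s. fst s ''n'' 0 = n \<and> fst s ''m'' 0 = 2 * n \<and> fst s ''F'' 0 = of_bool fl \<and>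
      (\<forall>i<n. snd s ''q'' i = q (e i)) \<and> (\<forall>x<2 * n. fst s ''M'' x = mate n x)"
    by (rule eq_reflection) (simp add: fun_eq_iff ctx_def)
  show "solver n \<B> f orc fl (\<lambda>i. q (e i))"
    using eval_correct by unfold_locales (simp_all add: ctx_def)
  show "ctx \<equiv> \<lambda>s. fst s ''n'' 0 = n \<and> fst s ''m'' 0 = 2 * n \<and> fst s ''F'' 0 = of_bool fl \<and>
      (\<forall>i<n. snd s ''q'' i = q (e i)) \<and> (\<forall>x<2 * n. fst s ''M'' x = mate n x)" by (rule c)
qed

text \<open>With the flag on, \<open>shift\<close> charges \<open>q\<close> for every member of the
  first set, and \<open>\<bar>q\<bar>\<close> takes it back where both copies are present, that is,
  where the element is missing from the second set.\<close>

lemma objective: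
  assumes "A \<in> \<B>"
  shows "w1 (S1 A) + w2 (S2 A) + ereal (\<Sum>v\<in>S1 A \<inter> S2 A. q v) = ereal (f A + penalty (\<lambda>i. \<bar>q (e i)\<bar>) A)"
proof -
  have S: "S1 A \<in> eff_dom V w1" "S2 A \<in> eff_dom V w2" using assms by (auto simp: \<B>_def)
  have r: "w1 (S1 A) = ereal (real_of_ereal (w1 (S1 A)))" "w2 (S2 A) = ereal (real_of_ereal (w2 (S2 A)))"
    using S vm1 vm2 S_subset[of A]
    by (cases "w1 (S1 A)"; cases "w2 (S2 A)"; auto simp: eff_dom_def valuated_matroid_def)+
  have "S1 A \<inter> S2 A = e ` {i. i < n \<and> i \<in> A \<and> (n + i \<in> A) \<noteq> fl}"
    by (intro set_eqI_V) (auto simp: S1_iff S2_iff e_eq_iff e_in_V dest: S_subsetD)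
  moreover have "inj_on e {i. i < n \<and> i \<in> A \<and> (n + i \<in> A) \<noteq> fl}" by (auto simp: inj_on_def e_eq_iff)
  ultimately have "(\<Sum>v\<in>S1 A \<inter> S2 A. q v) = (\<Sum>i | i < n \<and> i \<in> A \<and> (n + i \<in> A) \<noteq> fl. q (e i))"
    by (simp add: sum.reindex)
  also have "\<dots> = (\<Sum>i<n. if i \<in> A \<and> (n + i \<in> A) \<noteq> fl then q (e i) else 0)"
    by (rule sum.mono_neutral_cong_left) auto
  also have "\<dots> = shift A + penalty (\<lambda>i. \<bar>q (e i)\<bar>) A"
    unfolding shift_def penalty_def sum.distrib[symmetric]
  proof (rule sum.cong[OF refl])
    fix i assume "i \<in> {..<n}"
    \<comment> \<open>By \<open>sign\<close>, a single negative value forces all values to be at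
      most \<open>0\<close>.\<close>
    then have "if fl then q (e i) \<le> 0 else 0 \<le> q (e i)"
      using sign fl e_in_V by (auto simp: not_less) (meson dual_order.strict_trans2 not_less_iff_gr_or_eq)+
    then show "(if i \<in> A \<and> (n + i \<in> A) \<noteq> fl then q (e i) else 0) =
      (if fl \<and> i \<in> A then q (e i) else 0) + (if i \<in> A \<and> n + i \<in> A then \<bar>q (e i)\<bar> else 0)"
      by auto
  qed
  finally have "(\<Sum>v\<in>S1 A \<inter> S2 A. q v) = shift A + penalty (\<lambda>i. \<bar>q (e i)\<bar>) A" .
  then show ?thesis by (subst r(1), subst r(2)) (simp add: f_def)
qed

section \<open>Input, output and correctness of the whole program\<close>

lemma setup_spec:
  assumes s: "fst s ''n'' 0 = n" "fst s ''m'' 0 = 2 * n" "fst s ''F'' 0 = 0" "\<And>i. i < n \<Longrightarrow> snd s ''q'' i = q (e i)"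
    and s': "s' = den orc setup_prog s"
  shows "ctx s'"
    and "\<And>i. i < n \<Longrightarrow> i \<in> nodes n (fst s' ''X'') \<longleftrightarrow> fst s ''B1'' i \<noteq> 0"
    and "\<And>i. i < n \<Longrightarrow> n + i \<in> nodes n (fst s' ''X'') \<longleftrightarrow> (fst s ''B2'' i \<noteq> 0) \<noteq> fl"
    and "snd s' = snd s"
proof -
  define s1 where "s1 = den orc (PFor ''i'' ''n'' sign_body) s"
  define I where "I = (\<lambda>k (t :: state). fst t ''F'' 0 = of_bool (\<exists>i<k. q (e i) < 0))"
  have "I (fst s ''n'' 0) s1"
    unfolding s1_def
  proof (rule den_For_frame_rule)
    show "I 0 (upd (fst s) ''i'' 0 0, snd s)" using s by (simp add: I_def upd_def)
  next
    fix k t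
    assume k: "k < fst s ''n'' 0" and I: "I k t" and v: "fst t ''i'' 0 = k"
      and fr': "\<And>x. x \<notin> rmods sign_body \<Longrightarrow> snd t x = snd s x"
    have t: "snd t ''q'' k = q (e k)" using fr' s k by simp
    show "I (Suc k) (upd (fst (den orc sign_body t)) ''i'' 0 (Suc k), snd (den orc sign_body t))"
      using I v t by (auto simp: I_def upd_def less_Suc_eq sign_body_def)
  qed
  then have F1: "fst s1 ''F'' 0 = of_bool fl" using s fl by (simp add: I_def)
  have s1: "fst s1 ''n'' 0 = n" "fst s1 ''m'' 0 = 2 * n" "fst s1 ''B1'' = fst s ''B1''" "fst s1 ''B2'' = fst s ''B2''"
    using s unfolding s1_def by (simp_all add: den_frame_nat del: den.simps(7))
  define J where "J = (\<lambda>k (t :: state). \<forall>i<k. fst t ''M'' i = n + i \<and> fst t ''M'' (n + i) = i \<and>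
    fst t ''X'' i = fst s ''B1'' i \<and> fst t ''X'' (n + i) = of_bool ((fst s ''B2'' i \<noteq> 0) \<noteq> fl))"
  have s'1: "s' = den orc (PFor ''i'' ''n'' setup_body) s1" by (simp add: s' setup_prog_def s1_def)
  have "J (fst s1 ''n'' 0) s'"
    unfolding s'1
  proof (rule den_For_frame_rule)
    show "J 0 (upd (fst s1) ''i'' 0 0, snd s1)" by (simp add: J_def)
  next
    fix k t
    assume k: "k < fst s1 ''n'' 0" and J: "J k t" and v: "fst t ''i'' 0 = k"
      and fr: "\<And>x. x \<notin> insert ''i'' (nmods setup_body) \<Longrightarrow> fst t x = fst s1 x"
    have k2: "k < n" using k s1 by simp
    have t: "fst t ''n'' 0 = n" "fst t ''F'' 0 = of_bool fl" "fst t ''B1'' = fst s ''B1''" "fst t ''B2'' = fst s ''B2''"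
      using fr F1 s1 by simp_all
    show "J (Suc k) (upd (fst (den orc setup_body t)) ''i'' 0 (Suc k), snd (den orc setup_body t))"
      using J v t k2 by (cases fl) (auto simp: J_def upd_def less_Suc_eq setup_body_def)
  qed
  then have J: "J n s'" using s1 by simp
  have M: "fst s' ''M'' x = mate n x" if "x < 2 * n" for x
  proof (cases "x < n")
    case True
    then show ?thesis using J by (simp add: J_def mate_def)
  next
    case False
    then have "x - n < n" "n + (x - n) = x" using that by auto
    then show ?thesis using J False unfolding J_def mate_def by metis
  qed
  show ss: "snd s' = snd s"
    unfolding s' by (intro ext den_frame_real[THEN fun_cong]) (simp add: setup_prog_def)
  have "fst s' ''n'' = fst s1 ''n''" "fst s' ''m'' = fst s1 ''m''" "fst s' ''F'' = fst s1 ''F''"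
    unfolding s'1 by (simp_all add: den_frame_nat del: den.simps(7))
  then show "ctx s'" using M F1 s1 s(4) ss by (simp add: ctx_def)
  show "i \<in> nodes n (fst s' ''X'') \<longleftrightarrow> fst s ''B1'' i \<noteq> 0" if "i < n" for i
    using J that by (simp add: J_def)
  show "n + i \<in> nodes n (fst s' ''X'') \<longleftrightarrow> (fst s ''B2'' i \<noteq> 0) \<noteq> fl" if "i < n" for i
    using J that by (simp add: J_def)
qed

lemma output_spec:
  assumes ctx: "ctx s" and A: "A = nodes n (fst s ''X'')" and s': "s' = den orc output_prog s"
  shows "decode e V (fst s' ''X1'') = S1 A" "decode e V (fst s' ''X2'') = S2 A"
proof -
  define I where "I = (\<lambda>k (t :: state). \<forall>i<k. (fst t ''X1'' i \<noteq> 0 \<longleftrightarrow> i \<in> A) \<and>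
    (fst t ''X2'' i \<noteq> 0 \<longleftrightarrow> (n + i \<in> A) \<noteq> fl))"
  have "I (fst s ''n'' 0) s'"
    unfolding s' output_prog_def
  proof (rule den_For_frame_rule)
    show "I 0 (upd (fst s) ''i'' 0 0, snd s)" by (simp add: I_def)
  next
    fix k t
    assume k: "k < fst s ''n'' 0" and I: "I k t" and v: "fst t ''i'' 0 = k"
      and fr: "\<And>x. x \<notin> insert ''i'' (nmods output_body) \<Longrightarrow> fst t x = fst s x"
    have k2: "k < n" using k ctx by (simp add: ctx_def)
    have t: "fst t ''n'' 0 = n" "fst t ''F'' 0 = of_bool fl" "fst t ''X'' = fst s ''X''"
      using fr ctx by (simp_all add: ctx_def)
    have A': "k \<in> A \<longleftrightarrow> fst s ''X'' k \<noteq> 0" "n + k \<in> A \<longleftrightarrow> fst s ''X'' (n + k) \<noteq> 0" using A k2 by auto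
    show "I (Suc k) (upd (fst (den orc output_body t)) ''i'' 0 (Suc k), snd (den orc output_body t))"
      using I v t k2 A' by (cases fl) (auto simp: I_def upd_def less_Suc_eq output_body_def)
  qed
  then have I: "I n s'" using ctx by (simp add: ctx_def)
  have "{i. i < n \<and> fst s' ''X1'' i \<noteq> 0} = {i. i < n \<and> i \<in> A}"
    "{i. i < n \<and> fst s' ''X2'' i \<noteq> 0} = {i. i < n \<and> (n + i \<in> A) \<noteq> fl}"
    using I by (auto simp: I_def)
  then show "decode e V (fst s' ''X1'') = S1 A" "decode e V (fst s' ''X2'') = S2 A"
    by (simp_all add: decode_def card_V S1_def S2_def)
qed

text \<open>Carries optimality back: every feasible pair comes from some base, so no pair can beat
  the best base.\<close>

lemma pair_representation:
  assumes "Y1 \<in> eff_dom V w1" "Y2 \<in> eff_dom V w2"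
  shows "\<exists>A\<in>\<B>. S1 A = Y1 \<and> S2 A = Y2"
proof -
  define A where "A = {x. x < n \<and> e x \<in> Y1} \<union> {x. n \<le> x \<and> x < 2 * n \<and> (e (x - n) \<in> Y2) \<noteq> fl}"
  have Y: "Y1 \<subseteq> V" "Y2 \<subseteq> V" using assms by (auto simp: eff_dom_def)
  have "S1 A = Y1" using Y S_subset by (intro set_eqI_V) (auto simp: S1_iff A_def)
  moreover have "S2 A = Y2"
  proof (rule set_eqI_V[OF S_subset(2) Y(2)])
    fix i assume "i < n"
    then show "e i \<in> S2 A \<longleftrightarrow> e i \<in> Y2" using S2_iff[of i A] by (auto simp: A_def)
  qed
  moreover have "A \<subseteq> {..<2 * n}" by (auto simp: A_def)
  ultimately show ?thesis using assms by (intro bexI[of _ A]) (auto simp: \<B>_def)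
qed

lemma solver_correct:
  assumes B: "B1 \<in> eff_dom V w1" "B2 \<in> eff_dom V w2"
    and s: "fst s ''n'' 0 = n" "fst s ''m'' 0 = 2 * n" "fst s ''F'' 0 = 0"
      "fst s ''B1'' = encode e V B1" "fst s ''B2'' = encode e V B2"
      "\<And>i. i < n \<Longrightarrow> snd s ''q'' i = q (e i)" "snd s ''p'' = (\<lambda>_. 0)" "snd s ''Q'' = (\<lambda>_. 0)"
    and s': "s' = den orc solver_prog s"
  shows "\<exists>A\<in>\<B>. decode e V (fst s' ''X1'') = S1 A \<and> decode e V (fst s' ''X2'') = S2 A \<and>
    (\<forall>Y\<in>\<B>. f A + penalty (\<lambda>i. \<bar>q (e i)\<bar>) A \<le> f Y + penalty (\<lambda>i. \<bar>q (e i)\<bar>) Y)"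
proof -
  define s1 where "s1 = den orc setup_prog s"
  have su: "ctx s1"
    "\<And>i. i < n \<Longrightarrow> i \<in> nodes n (fst s1 ''X'') \<longleftrightarrow> fst s ''B1'' i \<noteq> 0"
    "\<And>i. i < n \<Longrightarrow> n + i \<in> nodes n (fst s1 ''X'') \<longleftrightarrow> (fst s ''B2'' i \<noteq> 0) \<noteq> fl"
    "snd s1 = snd s"
    using setup_spec[OF s(1-3,6) s1_def] by blast+
  define A0 where "A0 = nodes n (fst s1 ''X'')"
  have BV: "B1 \<subseteq> V" "B2 \<subseteq> V" using B by (auto simp: eff_dom_def)
  have "S1 A0 = B1"
    using su(2) s(4) S_subset BV
    by (intro set_eqI_V) (auto simp: S1_iff A0_def encode_def card_V simp del: nodes_iff)
  moreover have "S2 A0 = B2"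
  proof (rule set_eqI_V[OF S_subset(2) BV(2)])
    fix i assume i: "i < n"
    show "e i \<in> S2 A0 \<longleftrightarrow> e i \<in> B2"
      using S2_iff[OF i, of A0] su(3)[OF i] s(5) i by (auto simp: A0_def encode_def card_V simp del: nodes_iff)
  qed
  moreover have "A0 \<subseteq> {..<2 * n}" by (auto simp: A0_def)
  ultimately have A0: "A0 \<in> \<B>" using B by (simp add: \<B>_def)
  define s2 where "s2 = den orc greedy_prog s1"
  define A1 where "A1 = nodes n (fst s2 ''X'')"
  have ctx2: "ctx s2" unfolding s2_def by (rule ctx_den[OF su(1)]) auto
  have "certified A1 (\<lambda>x. 0) (\<lambda>x. 0)"
    using greedy_spec[OF su(1) A0[unfolded A0_def]] unfolding A1_def s2_def by (rule certified_zero)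
  \<comment> \<open>No part of the program initialises \<open>p\<close> and \<open>Q\<close>: their
    cells are \<open>0\<close> in the initial state, which is just the certificate of a greedy
    optimum.\<close>
  moreover have "snd s2 ''p'' = (\<lambda>_. 0)" "snd s2 ''Q'' = (\<lambda>_. 0)"
    using s(7,8) su(4) by (simp_all add: s2_def den_frame_real)
  ultimately have init: "penalty_inv 0 s2" using ctx2 by (simp add: penalty_inv_def A1_def)
  define s3 where "s3 = den orc (PFor ''z'' ''n'' phase_prog) s2"
  have "penalty_inv (fst s2 ''n'' 0) s3"
    unfolding s3_def
  proof (rule den_For_rule)
    show "penalty_inv 0 (upd (fst s2) ''z'' 0 0, snd s2)"
      using init by (simp add: penalty_inv_def ctx_def upd_def)
  next
    fix k t
    assume k: "k < fst s2 ''n'' 0" and I: "penalty_inv k t" and z: "fst t ''z'' 0 = k"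
    have "k < n" using k ctx2 by (simp add: ctx_def)
    moreover have "if fl then q (e i) \<le> 0 else 0 \<le> q (e i)" if "i < n" for i
      using sign fl e_in_V that by (cases fl) (auto simp: not_less dest: leD)
    ultimately have "penalty_inv (Suc k) (den orc phase_prog t)"
      using phase_spec[OF I z] by blast
    then show "penalty_inv (Suc k) (upd (fst (den orc phase_prog t)) ''z'' 0 (Suc k), snd (den orc phase_prog t))"
      by (simp add: penalty_inv_def ctx_def upd_def)
  qed
  then have inv: "penalty_inv n s3" using ctx2 by (simp add: ctx_def)
  define A where "A = nodes n (fst s3 ''X'')"
  have ctx3: "ctx s3" and cert: "certified A (snd s3 ''p'') (snd s3 ''Q'')"
    and Q: "\<And>i. i < n \<Longrightarrow> snd s3 ''Q'' i = \<bar>q (e i)\<bar> \<and> snd s3 ''Q'' (n + i) = \<bar>q (e i)\<bar>"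
    using inv by (auto simp: penalty_inv_def A_def)
  have "s' = den orc output_prog s3" by (simp add: s' solver_prog_def s3_def s2_def s1_def)
  note out = output_spec[OF ctx3 A_def this]
  have pen: "penalty (snd s3 ''Q'') Y = penalty (\<lambda>i. \<bar>q (e i)\<bar>) Y" for Y
    unfolding penalty_def using Q by (intro sum.cong) auto
  have "f A + penalty (snd s3 ''Q'') A \<le> f Y + penalty (snd s3 ''Q'') Y" if "Y \<in> \<B>" for Y
    using Q by (intro certified_optimal[OF cert that]) auto
  then show ?thesis using out cert unfolding pen by (intro bexI[of _ A]) (auto simp: certified_def)
qed

end

theorem theorem16:
  shows "\<exists>(P :: com) (p :: nat poly).
    \<forall>(V :: 'a set) (\<B>1 :: 'a set set) (\<B>2 :: 'a set set)
      (w1 :: 'a set \<Rightarrow> ereal) (w2 :: 'a set \<Rightarrow> ereal) (q :: 'a \<Rightarrow> real).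
      finite V \<longrightarrow>
      matroid_bases V \<B>1 \<longrightarrow> matroid_bases V \<B>2 \<longrightarrow>
      valuated_matroid V w1 \<longrightarrow> valuated_matroid V w2 \<longrightarrow>
      eff_dom V w1 = \<B>1 \<longrightarrow> eff_dom V w2 = \<B>2 \<longrightarrow>
      (\<forall>v\<in>V. q v \<ge> 0) \<or> (\<forall>v\<in>V. q v \<le> 0) \<longrightarrow>
      solves_within P (poly p (card V)) V w1 w2 q
        {(X1, X2). is_arg_min
           (\<lambda>(X1, X2). w1 X1 + w2 X2 + ereal (\<Sum>v\<in>X1 \<inter> X2. q v))
           (\<lambda>(X1, X2). X1 \<in> \<B>1 \<and> X2 \<in> \<B>2)
           (X1, X2)}"
proof -
  obtain p0 :: "nat poly" where p0: "\<And>N. poly p0 N = cost N solver_prog"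
    using cost_poly[of solver_prog] by blast
  \<comment> \<open>\<open>m\<close> is assigned ahead of the loop program, since
    \<open>exec_compile\<close> requires the latter to leave \<open>m\<close> alone.\<close>
  define double :: com where "double = NAssign ''m'' (NConst 0) (NAdd (nvar ''n'') (nvar ''n''))"
  show ?thesis
  \<comment> \<open>Both loop bounds are at most \<open>2n\<close>, hence the substitution in
    \<open>p0\<close>. The constant 8 is the assignment, which takes 7 steps, and one step for
    sequencing.\<close>
  proof (intro exI[of _ "Seq double (compile solver_prog)"] exI[of _ "pcompose p0 [:0, 2:] + [:8:]"]
      allI impI)
    fix V :: "'a set" and \<B>1 \<B>2 w1 w2 and q :: "'a \<Rightarrow> real"
    assume vm: "valuated_matroid V w1" "valuated_matroid V w2"
      and \<B>: "eff_dom V w1 = \<B>1" "eff_dom V w2 = \<B>2"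
      and sign: "(\<forall>v\<in>V. q v \<ge> 0) \<or> (\<forall>v\<in>V. q v \<le> 0)"
    define n where "n = card V"
    show "solves_within (Seq double (compile solver_prog)) (poly (pcompose p0 [:0, 2:] + [:8:]) (card V)) V w1 w2 q
        {(X1, X2). is_arg_min
           (\<lambda>(X1, X2). w1 X1 + w2 X2 + ereal (\<Sum>v\<in>X1 \<inter> X2. q v))
           (\<lambda>(X1, X2). X1 \<in> \<B>1 \<and> X2 \<in> \<B>2)
           (X1, X2)}"
      unfolding solves_within_def
    proof (intro allI impI)
      fix e B1 B2
      assume e: "bij_betw e {..<card V} V" and B: "B1 \<in> eff_dom V w1" "B2 \<in> eff_dom V w2"
      interpret penalized_instance V w1 w2 q e n "\<exists>i<n. q (e i) < 0"
        using vm e sign by unfold_locales (auto simp: n_def)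
      define s0 where "s0 = init_state e V B1 B2 q"
      define s where "s = (upd (fst s0) ''m'' 0 (n + n), snd s0)"
      have n0: "fst s0 ''n'' 0 = n" by (simp add: s0_def init_state_def n_def)
      have run1: "exec orc double s0 7 s"
        using exec.NAssign[of orc "''m''" "NConst 0" "NAdd (nvar ''n'') (nvar ''n'')" s0] n0
        by (simp add: double_def s_def eval_nat_numeral)
      obtain t where t: "exec orc (compile solver_prog) s t (den orc solver_prog s)"
        "t \<le> cost (2 * n) solver_prog"
      proof -
        have "fst s ''n'' 0 \<le> 2 * n" "fst s ''m'' 0 \<le> 2 * n" using n0 by (simp_all add: s_def upd_def)
        from exec_compile[of orc, OF orc_not_MInf well_formed_solver mods_solver this] show ?thesis
          using that by blast
      qed
      note run = exec.Seq[OF run1 t(1)]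
      have time: "7 + t + 1 \<le> poly (pcompose p0 [:0, 2:] + [:8:]) (card V)"
        using t(2) by (simp add: poly_pcompose p0 n_def mult.commute)
      obtain A where A: "A \<in> \<B>" "decode e V (fst (den orc solver_prog s) ''X1'') = S1 A"
        "decode e V (fst (den orc solver_prog s) ''X2'') = S2 A"
        "\<And>Y. Y \<in> \<B> \<Longrightarrow> f A + penalty (\<lambda>i. \<bar>q (e i)\<bar>) A \<le> f Y + penalty (\<lambda>i. \<bar>q (e i)\<bar>) Y"
      proof -
        have "fst s ''n'' 0 = n" "fst s ''m'' 0 = 2 * n" "fst s ''F'' 0 = 0" "fst s ''B1'' = encode e V B1"
          "fst s ''B2'' = encode e V B2" "\<And>i. i < n \<Longrightarrow> snd s ''q'' i = q (e i)"
          "snd s ''p'' = (\<lambda>_. 0)" "snd s ''Q'' = (\<lambda>_. 0)"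
          by (simp_all add: s_def s0_def init_state_def upd_def n_def)
        from solver_correct[OF B this refl] show ?thesis using that by blast
      qed
      have "is_arg_min (\<lambda>(X1, X2). w1 X1 + w2 X2 + ereal (\<Sum>v\<in>X1 \<inter> X2. q v))
           (\<lambda>(X1, X2). X1 \<in> \<B>1 \<and> X2 \<in> \<B>2) (S1 A, S2 A)"
        unfolding is_arg_min_def
      proof (intro conjI notI)
        show "case (S1 A, S2 A) of (X1, X2) \<Rightarrow> X1 \<in> \<B>1 \<and> X2 \<in> \<B>2"
          using A(1) \<B> by (simp add: \<B>_def)
        assume "\<exists>y. (case y of (X1, X2) \<Rightarrow> X1 \<in> \<B>1 \<and> X2 \<in> \<B>2) \<and>
          (case y of (X1, X2) \<Rightarrow> w1 X1 + w2 X2 + ereal (\<Sum>v\<in>X1 \<inter> X2. q v)) <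
          (case (S1 A, S2 A) of (X1, X2) \<Rightarrow> w1 X1 + w2 X2 + ereal (\<Sum>v\<in>X1 \<inter> X2. q v))"
        then obtain Y1 Y2 where Y: "Y1 \<in> \<B>1" "Y2 \<in> \<B>2" "w1 Y1 + w2 Y2 + ereal (\<Sum>v\<in>Y1 \<inter> Y2. q v) <
          w1 (S1 A) + w2 (S2 A) + ereal (\<Sum>v\<in>S1 A \<inter> S2 A. q v)" by auto
        obtain Z where "Z \<in> \<B>" "S1 Z = Y1" "S2 Z = Y2" using pair_representation Y(1,2) \<B> by metis
        then show False using Y(3) objective[of Z] objective[OF A(1)] A(4)[of Z] by simp
      qed
      then show "\<exists>t s. exec orc (Seq double (compile solver_prog)) (init_state e V B1 B2 q) t s \<and>
          t \<le> poly (pcompose p0 [:0, 2:] + [:8:]) (card V) \<and>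
          (decode e V (fst s ''X1''), decode e V (fst s ''X2'')) \<in>
          {(X1, X2). is_arg_min
           (\<lambda>(X1, X2). w1 X1 + w2 X2 + ereal (\<Sum>v\<in>X1 \<inter> X2. q v))
           (\<lambda>(X1, X2). X1 \<in> \<B>1 \<and> X2 \<in> \<B>2)
           (X1, X2)}"
        using run time A(2,3) unfolding s0_def[symmetric] by fastforce
    qed
  qed
qed

end
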